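(* Let $\mathcal X,\mathcal Y$ be compact metrizable spaces and let $c:\mathcal X\times\mathcal M(\mathcal Y)\to\mathbb R$ be a cost function satisfying: (A) there exist continuous functions $a_k:\mathcal X\to\mathbb R$ and $b_k:\mathcal X\times\mathcal Y\to\mathbb R$, $k\ge 0$, such that $c(x,m)=\sup_{k\ge 0}\left\{\int b_k(x,y)\,m(dy)+a_k(x)\right\}$ for all $x\in\mathcal X$, $m\in\mathcal M(\mathcal Y)$; (Approx) for all $\mu\in\mathcal P(\mathcal X)$, $\nu\in\mathcal P(\mathcal Y)$ and all $\pi\in\Pi(\mathrm{Supp}(\mu),\nu)$ there exists a sequence $\pi_n\in\Pi(\ll\mu,\nu)$ converging weakly to $\pi$ and such that $I_c^\mu[\pi_n]\to\bar I_c^\mu[\pi]$. Then for all $\mu\in\mathcal P(\mathcal X)$ and $\nu\in\mathcal P(\mathcal Y)$, $$\mathcal I_c(\mu,\nu)=\sup_{f\in\mathcal C_b(\mathcal Y)}\left\{\int K_cf(x)\,\mu(dx)-\int f(y)\,\nu(dy)\right\},\qquad K_cf(x)=\inf_{m\in\mathcal M(\mathcal Y)}\left\{\int f\,dm+c(x,m)\right\}.$$ In particular, this duality formula holds whenever $c$ satisfies (A) and at least one of the following two conditions: (B) $\frac{c(x,\lambda m)}{\lambda}\to+\infty$ as $\lambda\to+\infty$ for all $x\in\mathcal X$ and $m\in\mathcal M(\mathcal Y)\setminus\{0\}$; (C) for all $m\in\mathcal M(\mathcal Y)$ the functions $c(\cdot,m)$ and $c'_\infty(\cdot,m)$ are continuous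 on $\mathcal X$, and there exists $a\ge 0$ such that $c'_\infty(x,p)\le a$ for all $x\in\mathcal X$ and $p\in\mathcal P(\mathcal Y)$.
   Context: $\mathcal P(E)$ denotes the Borel probability measures on $E$; $\mathcal M(\mathcal Y)$ the finite nonnegative Borel measures on $\mathcal Y$ with the weak topology; $\mathcal C_b(\mathcal Y)$ the (bounded) continuous real functions on $\mathcal Y$. A nonnegative kernel from $\mathcal X$ to $\mathcal Y$ is a family $q=(q^x)_{x\in\mathcal X}$ in $\mathcal M(\mathcal Y)$ with $x\mapsto q^x(A)$ measurable for all Borel $A$. $\mathcal Q(\mu,\nu)$ is the set of nonnegative kernels with $\int q^x(dy)\,\mu(dx)=\nu(dy)$, and $$\mathcal I_c(\mu,\nu)=\inf_{q\in\mathcal Q(\mu,\nu)}\int c(x,q^x)\,\mu(dx).$$ $\Pi(\ll\mu,\nu)$ is the set of Borel probability measures $\pi$ on $\mathcal X\times\mathcal Y$ with first marginal $\pi_1\ll\mu$ and second marginal $\nu$; $\Pi(\mathrm{Supp}(\mu),\nu)$ is the set of those with $\pi_1(\mathrm{Supp}(\mu))=1$ and second marginal $\nu$. Write $\pi(dxdy)=\pi_1(dx)\pi^x(dy)$. The recession function is $c'_\infty(x,m)=\lim_{\lambda\to\infty}\frac{c(x,\lambda m)}{\lambda}\in\mathbb R\cup\{+\infty\}$. For $\pi\in\Pi(\ll\mu,\nu)$, $I_c^\mu[\pi]=\int c\left(x,\frac{d\pi_1}{d\mu}(x)\pi^x\right)\mu(dx)$, and for any $\pi\in\mathcal P(\mathcal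 X\times\mathcal Y)$, $$\bar I_c^\mu[\pi]=\int c\left(x,\frac{d\pi_1^{ac}}{d\mu}(x)\pi^x\right)\mu(dx)+\int c'_\infty(x,\pi^x)\,\pi_1^s(dx),$$ where $\pi_1=\pi_1^{ac}+\pi_1^s$ is the Lebesgue decomposition of $\pi_1$ with respect to $\mu$. *)

theory Defs
  imports "HOL-Probability.Probability"
begin

text \<open>
  Spaces are types of class \<^class>\<open>polish_space\<close> whose universe is compact; completeness and second
  countability hold in every compact metric space, so for such types the class imposes nothing
  beyond metrizability.  Costs are total functions on \<^typ>\<open>'y measure\<close>, but only their values on
  \<open>fin_measures\<close> are ever constrained or used (up to null sets).
\<close>

definition prob_measures :: "'a::topological_space measure set" where
  "prob_measures = {M. sets M = sets borel \<and> prob_space M}"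

definition fin_measures :: "'a::topological_space measure set" where
  "fin_measures = {M. sets M = sets borel \<and> finite_measure M}"

text \<open>
  Integral of an extended real function.  When the positive and the negative part both have infinite
  integral, the value is set to \<open>-\<infinity>\<close>, so that such an integral is neutral in a supremum.  For a cost
  of the form (A) this can only happen for \<open>\<integral> K\<^sub>c f d\<mu>\<close>: all the other integrands below have an
  integrable negative part.
\<close>
definition ext_integral :: "'a measure \<Rightarrow> ('a \<Rightarrow> ereal) \<Rightarrow> ereal" where
  "ext_integral M f =
     (let P = \<integral>\<^sup>+x. e2ennreal (f x) \<partial>M; N = \<integral>\<^sup>+x. e2ennreal (- f x) \<partial>M
      in if P = \<infinity> \<and> N = \<infinity> then -\<infinity> else enn2ereal P - enn2ereal N)"

definition nonneg_kernel :: "('x::topological_space \<Rightarrow> 'y::topological_space measure) \<Rightarrow> bool" where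
  "nonneg_kernel q \<longleftrightarrow> (\<forall>x. q x \<in> fin_measures) \<and>
     (\<forall>A\<in>sets borel. (\<lambda>x. emeasure (q x) A) \<in> borel_measurable borel)"

definition kernels :: "'x::topological_space measure \<Rightarrow> 'y::topological_space measure
    \<Rightarrow> ('x \<Rightarrow> 'y measure) set" where
  "kernels \<mu> \<nu> = {q. nonneg_kernel q \<and>
     (\<forall>A\<in>sets borel. (\<integral>\<^sup>+x. emeasure (q x) A \<partial>\<mu>) = emeasure \<nu> A)}"

definition transport_cost :: "('x::topological_space \<Rightarrow> 'y::topological_space measure \<Rightarrow> real)
    \<Rightarrow> 'x measure \<Rightarrow> 'y measure \<Rightarrow> ereal" where
  "transport_cost c \<mu> \<nu> = (INF q\<in>kernels \<mu> \<nu>. ext_integral \<mu> (\<lambda>x. ereal (c x (q x))))"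

definition Kc :: "('x \<Rightarrow> 'y::topological_space measure \<Rightarrow> real) \<Rightarrow> ('y \<Rightarrow> real) \<Rightarrow> 'x \<Rightarrow> ereal" where
  "Kc c f x = (INF m\<in>fin_measures. ereal ((\<integral>y. f y \<partial>m) + c x m))"

definition dual_value :: "('x::topological_space \<Rightarrow> 'y::topological_space measure \<Rightarrow> real)
    \<Rightarrow> 'x measure \<Rightarrow> 'y measure \<Rightarrow> ereal" where
  "dual_value c \<mu> \<nu> = (SUP f\<in>bcontfun. ext_integral \<mu> (Kc c f) - ereal (\<integral>y. f y \<partial>\<nu>))"

definition marg1 :: "('x::topological_space \<times> 'y::topological_space) measure \<Rightarrow> 'x measure" where
  "marg1 \<pi> = distr \<pi> borel fst"

definition marg2 :: "('x::topological_space \<times> 'y::topological_space) measure \<Rightarrow> 'y measure" where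
  "marg2 \<pi> = distr \<pi> borel snd"

definition supp :: "'a::topological_space measure \<Rightarrow> 'a set" where
  "supp \<mu> = {x. \<forall>U. open U \<and> x \<in> U \<longrightarrow> emeasure \<mu> U > 0}"

definition Pi_ac :: "'x::topological_space measure \<Rightarrow> 'y::topological_space measure
    \<Rightarrow> ('x \<times> 'y) measure set" where
  "Pi_ac \<mu> \<nu> = {\<pi> \<in> prob_measures. absolutely_continuous \<mu> (marg1 \<pi>) \<and> marg2 \<pi> = \<nu>}"

definition Pi_supp :: "'x::topological_space measure \<Rightarrow> 'y::topological_space measure
    \<Rightarrow> ('x \<times> 'y) measure set" where
  "Pi_supp \<mu> \<nu> = {\<pi> \<in> prob_measures. emeasure (marg1 \<pi>) (supp \<mu>) = 1 \<and> marg2 \<pi> = \<nu>}"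

definition weakly_converges :: "(nat \<Rightarrow> 'a::topological_space measure) \<Rightarrow> 'a measure \<Rightarrow> bool" where
  "weakly_converges \<pi>s \<pi> \<longleftrightarrow>
     (\<forall>f\<in>bcontfun. (\<lambda>n. \<integral>z. (f z :: real) \<partial>(\<pi>s n)) \<longlonglongrightarrow> (\<integral>z. f z \<partial>\<pi>))"

definition is_disintegration :: "('x::topological_space \<times> 'y::topological_space) measure
    \<Rightarrow> ('x \<Rightarrow> 'y measure) \<Rightarrow> bool" where
  "is_disintegration \<pi> \<kappa> \<longleftrightarrow> \<kappa> \<in> borel \<rightarrow>\<^sub>M prob_algebra borel \<and>
     (\<forall>A\<in>sets borel. \<forall>B\<in>sets borel.
        emeasure \<pi> (A \<times> B) = (\<integral>\<^sup>+x\<in>A. emeasure (\<kappa> x) B \<partial>(marg1 \<pi>)))"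

text \<open>
  A disintegration is unique only up to a null set of the first marginal, whence the choice.  Neither
  \<open>cost_ac\<close> nor \<open>cost_bar\<close> depends on it: the density of the absolutely continuous part vanishes
  \<open>\<mu>\<close>-almost everywhere on such a null set, and the singular part does not charge it.
\<close>
definition disintegration :: "('x::topological_space \<times> 'y::topological_space) measure
    \<Rightarrow> 'x \<Rightarrow> 'y measure" where
  "disintegration \<pi> = (SOME \<kappa>. is_disintegration \<pi> \<kappa>)"

definition is_lebesgue_decomposition ::
    "'a measure \<Rightarrow> 'a measure \<Rightarrow> 'a measure \<Rightarrow> 'a measure \<Rightarrow> bool" where
  "is_lebesgue_decomposition \<mu> \<rho> \<alpha> \<sigma> \<longleftrightarrow>
     sets \<alpha> = sets \<mu> \<and> sets \<sigma> = sets \<mu> \<and>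
     (\<forall>A\<in>sets \<mu>. emeasure \<rho> A = emeasure \<alpha> A + emeasure \<sigma> A) \<and>
     absolutely_continuous \<mu> \<alpha> \<and>
     (\<exists>N\<in>sets \<mu>. emeasure \<mu> N = 0 \<and> emeasure \<sigma> (space \<mu> - N) = 0)"

definition ac_part :: "'a measure \<Rightarrow> 'a measure \<Rightarrow> 'a measure" where
  "ac_part \<mu> \<rho> = (THE \<alpha>. \<exists>\<sigma>. is_lebesgue_decomposition \<mu> \<rho> \<alpha> \<sigma>)"

definition sing_part :: "'a measure \<Rightarrow> 'a measure \<Rightarrow> 'a measure" where
  "sing_part \<mu> \<rho> = (THE \<sigma>. \<exists>\<alpha>. is_lebesgue_decomposition \<mu> \<rho> \<alpha> \<sigma>)"

definition recession :: "('x \<Rightarrow> 'y measure \<Rightarrow> real) \<Rightarrow> 'x \<Rightarrow> 'y measure \<Rightarrow> ereal" where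
  "recession c x m =
     Lim at_top (\<lambda>l::real. ereal (c x (scale_measure (ennreal l) m) / l))"

definition cost_ac :: "('x::topological_space \<Rightarrow> 'y::topological_space measure \<Rightarrow> real)
    \<Rightarrow> 'x measure \<Rightarrow> ('x \<times> 'y) measure \<Rightarrow> ereal" where
  "cost_ac c \<mu> \<pi> = ext_integral \<mu> (\<lambda>x.
     ereal (c x (scale_measure (RN_deriv \<mu> (marg1 \<pi>) x) (disintegration \<pi> x))))"

definition cost_bar :: "('x::topological_space \<Rightarrow> 'y::topological_space measure \<Rightarrow> real)
    \<Rightarrow> 'x measure \<Rightarrow> ('x \<times> 'y) measure \<Rightarrow> ereal" where
  "cost_bar c \<mu> \<pi> =
     ext_integral \<mu> (\<lambda>x.
       ereal (c x (scale_measure (RN_deriv \<mu> (ac_part \<mu> (marg1 \<pi>)) x) (disintegration \<pi> x)))) +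
     ext_integral (sing_part \<mu> (marg1 \<pi>)) (\<lambda>x. recession c x (disintegration \<pi> x))"

definition cond_A :: "('x::topological_space \<Rightarrow> 'y::topological_space measure \<Rightarrow> real) \<Rightarrow> bool" where
  "cond_A c \<longleftrightarrow> (\<exists>(a :: nat \<Rightarrow> 'x \<Rightarrow> real) (b :: nat \<Rightarrow> 'x \<times> 'y \<Rightarrow> real).
     (\<forall>k. continuous_on UNIV (a k)) \<and> (\<forall>k. continuous_on UNIV (b k)) \<and>
     (\<forall>x. \<forall>m\<in>fin_measures. ereal (c x m) = (SUP k. ereal ((\<integral>y. b k (x, y) \<partial>m) + a k x))))"

definition cond_Approx :: "('x::topological_space \<Rightarrow> 'y::topological_space measure \<Rightarrow> real) \<Rightarrow> bool" where
  "cond_Approx c \<longleftrightarrow> (\<forall>\<mu>\<in>prob_measures. \<forall>\<nu>\<in>prob_measures. \<forall>\<pi>\<in>Pi_supp \<mu> \<nu>.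
     \<exists>\<pi>s :: nat \<Rightarrow> ('x \<times> 'y) measure.
       (\<forall>n. \<pi>s n \<in> Pi_ac \<mu> \<nu>) \<and> weakly_converges \<pi>s \<pi> \<and>
       (\<lambda>n. cost_ac c \<mu> (\<pi>s n)) \<longlonglongrightarrow> cost_bar c \<mu> \<pi>)"

definition cond_B :: "('x \<Rightarrow> 'y::topological_space measure \<Rightarrow> real) \<Rightarrow> bool" where
  "cond_B c \<longleftrightarrow> (\<forall>x. \<forall>m\<in>fin_measures - {null_measure borel}.
     filterlim (\<lambda>l::real. c x (scale_measure (ennreal l) m) / l) at_top at_top)"

definition cond_C :: "('x::topological_space \<Rightarrow> 'y::topological_space measure \<Rightarrow> real) \<Rightarrow> bool" where
  "cond_C c \<longleftrightarrow>
     (\<forall>m\<in>fin_measures. continuous_on UNIV (\<lambda>x. c x m) \<and> continuous_on UNIV (\<lambda>x. recession c x m)) \<and>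
     (\<exists>a::real. a \<ge> 0 \<and> (\<forall>x. \<forall>p\<in>prob_measures. recession c x p \<le> ereal a))"

end

theory Submission
  imports Defs
begin

text \<open>
  Call a pair \<open>(A, B)\<close> of continuous functions a minorant if \<open>\<integral> B (x, y) dm + A x \<le> c x m\<close> for all \<open>x\<close> and \<open>m\<close>.
  The value \<open>L \<pi> (A, B) = \<integral> B d\<pi> + \<integral> A d\<mu>\<close> is affine in the minorant and in the plan \<open>\<pi>\<close>, and the plans in
  \<open>Pi_supp \<mu> \<nu>\<close> form a weakly compact convex set.  For a fixed minorant, the minimum of \<open>L\<close> over the plans
  is at most the dual value, as the choice \<open>f y = - min B (\<sqdot>, y)\<close> over the support of \<open>\<mu>\<close> shows.  By a minimax
  argument a single plan \<open>\<pi>\<close> satisfies \<open>L \<pi> \<le> dual value\<close> for all minorants simultaneously.  Mixing the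
  minorants \<open>(a k, b k)\<close> with continuous weights that approximate the indicator functions of the sets where the
  \<open>k\<close>-th one is largest, this yields \<open>cost_bar c \<mu> \<pi> \<le> dual value\<close>.  It remains to bound the transport cost by
  \<open>cost_bar c \<mu> \<pi>\<close>: under (Approx) by approximation, under (B) because the singular part of \<open>\<pi>\<close>
  vanishes, and under (C) by smearing the singular part out over small balls charged by \<open>\<mu>\<close>.
\<close>

subsection \<open>Sums of measures\<close>

text \<open>Compactness is available for plans but not for kernels: a minimizing sequence of kernels
  may concentrate, and the first marginal of its weak limit may then be singular to \<mu>, merely
  carried by \<open>supp \<mu>\<close>. Hence the detour through \<open>Pi_supp\<close> and
  \<open>cost_bar\<close>, where the singular part is charged through the recession function. The
  limiting plan is extracted from a sequence, so only countably many inequalities are imposed on it,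
  and these have to be fixed before the plan and its disintegration are known. This is why the
  weights come from one countable family that approximates every Borel indicator in L1 of every
  finite Borel measure. A single weight can serve the absolutely continuous and the singular part at
  once because the two live on disjoint Borel sets. Mixing with weights that depend on x preserves
  minorants, since the defining inequality is required for each x separately and is stable under
  convex combinations. Upper bounds are proved against a real t above the dual value, which covers
  infinite dual values without separate cases.\<close>

definition add_measure :: "'a measure \<Rightarrow> 'a measure \<Rightarrow> 'a measure" where
  "add_measure M N = measure_of (space M) (sets M) (\<lambda>A. emeasure M A + emeasure N A)"

lemma space_add_measure [simp]: "space (add_measure M N) = space M"
  by (simp add: add_measure_def)

lemma sets_add_measure [simp, measurable_cong]: "sets (add_measure M N) = sets M"
  by (simp add: add_measure_def)

lemma emeasure_add_measure:
  assumes "sets N = sets M" "A \<in> sets M"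
  shows "emeasure (add_measure M N) A = emeasure M A + emeasure N A"
  unfolding add_measure_def
proof (rule emeasure_measure_of_sigma)
  show "sigma_algebra (space M) (sets M)" ..
  show "positive (sets M) (\<lambda>A. emeasure M A + emeasure N A)"
    by (simp add: positive_def)
  show "countably_additive (sets M) (\<lambda>A. emeasure M A + emeasure N A)"
  proof (rule countably_additiveI)
    fix F :: "nat \<Rightarrow> 'a set" assume F: "range F \<subseteq> sets M" "disjoint_family F"
    then have "(\<Sum>i. emeasure M (F i) + emeasure N (F i)) =
        (\<Sum>i. emeasure M (F i)) + (\<Sum>i. emeasure N (F i))"
      by (intro suminf_add [symmetric]) auto
    then show "(\<Sum>i. emeasure M (F i) + emeasure N (F i)) =
        emeasure M (\<Union>i. F i) + emeasure N (\<Union>i. F i)"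
      using F assms(1) by (simp add: suminf_emeasure)
  qed
qed (rule assms(2))

lemma nn_integral_add_measure:
  assumes N: "sets N = sets M" and f: "f \<in> borel_measurable M"
  shows "(\<integral>\<^sup>+x. f x \<partial>add_measure M N) = (\<integral>\<^sup>+x. f x \<partial>M) + (\<integral>\<^sup>+x. f x \<partial>N)"
  using f
proof induction
  case (cong f g)
  have "space N = space M" using N by (rule sets_eq_imp_space_eq)
  with cong(3) have "(\<integral>\<^sup>+x. g x \<partial>N) = (\<integral>\<^sup>+x. f x \<partial>N)" "(\<integral>\<^sup>+x. g x \<partial>M) = (\<integral>\<^sup>+x. f x \<partial>M)"
      "(\<integral>\<^sup>+x. g x \<partial>add_measure M N) = (\<integral>\<^sup>+x. f x \<partial>add_measure M N)"
    by (auto intro!: nn_integral_cong)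
  with cong show ?case by simp
next
  case (set A)
  then show ?case using N by (simp add: emeasure_add_measure)
next
  case (mult u c)
  have [measurable]: "u \<in> borel_measurable N" using mult(2) by (simp add: measurable_cong_sets[OF N refl])
  show ?case using mult by (simp add: nn_integral_cmult distrib_left)
next
  case (add u v)
  have [measurable]: "u \<in> borel_measurable N" "v \<in> borel_measurable N"
    using add(1,3) by (simp_all add: measurable_cong_sets[OF N refl] add)
  show ?case using add by (simp add: nn_integral_add ac_simps)
next
  case (seq U)
  have [measurable]: "U i \<in> borel_measurable N" for i
    using seq(1) by (simp add: measurable_cong_sets[OF N refl])
  have *: "(\<integral>\<^sup>+x. (SUP i. U i) x \<partial>K) = (SUP i. \<integral>\<^sup>+x. U i x \<partial>K)"
    if "\<And>i. U i \<in> borel_measurable K" for K :: "'a measure"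
    unfolding SUP_apply using that \<open>incseq U\<close>
    by (intro nn_integral_monotone_convergence_SUP) (auto simp: mono_def le_fun_def)
  have m: "incseq (\<lambda>i. \<integral>\<^sup>+x. U i x \<partial>K)" for K
    using \<open>incseq U\<close> by (auto simp: incseq_def le_fun_def intro!: nn_integral_mono)
  show ?case
    unfolding *[OF seq(1)] *[OF \<open>U _ \<in> borel_measurable N\<close>]
    using seq(1) by (subst *) (simp_all add: seq.IH ennreal_SUP_add[OF m m])
qed

lemma finite_measure_add_measure:
  assumes "finite_measure M" "finite_measure N" "sets N = sets M"
  shows "finite_measure (add_measure M N)"
proof
  have "space N = space M" using assms(3) by (rule sets_eq_imp_space_eq)
  then show "emeasure (add_measure M N) (space (add_measure M N)) \<noteq> \<infinity>"
    using assms finite_measure.emeasure_finite[OF assms(1), of "space M"]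
      finite_measure.emeasure_finite[OF assms(2), of "space N"]
    by (simp add: emeasure_add_measure)
qed

lemma
  fixes f :: "'a \<Rightarrow> real"
  assumes N: "sets N = sets M" and f: "integrable M f" "integrable N f"
  shows integrable_add_measure: "integrable (add_measure M N) f"
    and integral_add_measure:
      "(\<integral>x. f x \<partial>add_measure M N) = (\<integral>x. f x \<partial>M) + (\<integral>x. f x \<partial>N)"
proof -
  have [measurable]: "f \<in> borel_measurable M" using f by auto
  show *: "integrable (add_measure M N) f"
    using f by (simp add: integrable_iff_bounded nn_integral_add_measure[OF N])
  have fin: "(\<integral>\<^sup>+x. ennreal (f x) \<partial>K) < \<infinity>" "(\<integral>\<^sup>+x. ennreal (- f x) \<partial>K) < \<infinity>"
    if "integrable K f" for K
    using that by (auto simp: real_integrable_def top.not_eq_extremum)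
  show "(\<integral>x. f x \<partial>add_measure M N) = (\<integral>x. f x \<partial>M) + (\<integral>x. f x \<partial>N)"
    using f fin[OF f(1)] fin[OF f(2)]
    by (simp add: real_lebesgue_integral_def * nn_integral_add_measure[OF N] enn2real_plus)
qed

subsection \<open>Weak convergence and compactness\<close>

text \<open>For open \<open>U\<close> these functions increase with \<open>n\<close> to the
  indicator of \<open>U\<close>. The case \<open>UNIV\<close> is separate because
  \<open>infdist\<close> to the empty set is 0, so the formula would vanish identically
  there.\<close>

definition open_ramp :: "'a::metric_space set \<Rightarrow> nat \<Rightarrow> 'a \<Rightarrow> real" where
  "open_ramp U n x = (if U = UNIV then 1 else min 1 (real n * infdist x (- U)))"

lemma open_ramp_bounds: "0 \<le> open_ramp U n x" "open_ramp U n x \<le> 1"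
  by (auto simp: open_ramp_def infdist_nonneg)

lemma open_ramp_outside: "x \<notin> U \<Longrightarrow> open_ramp U n x = 0"
  by (auto simp: open_ramp_def)

lemma continuous_open_ramp: "continuous_on UNIV (open_ramp U n)"
  unfolding open_ramp_def by (cases "U = UNIV") (auto intro!: continuous_intros)

lemma open_ramp_measurable [measurable]: "open_ramp U n \<in> borel_measurable borel"
  by (rule borel_measurable_continuous_onI[OF continuous_open_ramp])

lemma open_ramp_tendsto:
  assumes "open U"
  shows "(\<lambda>n. open_ramp U n x) \<longlonglongrightarrow> indicator U x"
proof (cases "x \<in> U \<and> U \<noteq> UNIV")
  case True
  then have "infdist x (- U) > 0"
    using assms infdist_pos_not_in_closed[of "-U" x] by auto
  then obtain m where m: "1 < real m * infdist x (- U)"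
    using reals_Archimedean3 by blast
  have "open_ramp U n x = 1" if "n \<ge> m" for n
  proof -
    have "real m * infdist x (- U) \<le> real n * infdist x (- U)"
      using that by (intro mult_right_mono) (auto simp: infdist_nonneg)
    then show ?thesis using m True by (simp add: open_ramp_def)
  qed
  then show ?thesis using True
    by (intro tendsto_eventually) (auto simp: eventually_sequentially)
next
  case False
  then consider "U = UNIV" | "x \<notin> U" by blast
  then show ?thesis
    by cases (simp_all add: open_ramp_outside, simp add: open_ramp_def)
qed

lemma bcontfunI_compact:
  fixes f :: "'a::topological_space \<Rightarrow> 'b::metric_space"
  assumes "compact (UNIV :: 'a set)" "continuous_on UNIV f"
  shows "f \<in> bcontfun"
  using compact_imp_bounded[OF compact_continuous_image[OF assms(2,1)]] assms(2)
  by (simp add: bcontfun_def)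

lemma open_ramp_bcontfun: "open_ramp U n \<in> bcontfun"
  using continuous_open_ramp[of U n]
  by (auto simp: bcontfun_def bounded_iff open_ramp_bounds intro!: exI[of _ 1])

lemma integrable_bcontfun:
  fixes f :: "'a::topological_space \<Rightarrow> real"
  assumes "finite_measure M" "sets M = sets borel" "f \<in> bcontfun"
  shows "integrable M f"
proof -
  obtain B where "\<And>x. norm (f x) \<le> B"
    using assms(3) by (auto simp: bcontfun_def bounded_iff)
  moreover have "f \<in> borel_measurable M"
    using assms borel_measurable_continuous_onI[of f]
    by (simp add: bcontfun_def measurable_cong_sets[OF assms(2) refl])
  ultimately show ?thesis
    by (intro finite_measure.integrable_const_bound[OF assms(1)]) auto
qed

lemma integral_open_ramp_tendsto:
  assumes "finite_measure M" and [measurable_cong]: "sets M = sets borel" and U: "open U"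
  shows "(\<lambda>n. \<integral>x. open_ramp U n x \<partial>M) \<longlonglongrightarrow> measure M U"
proof -
  interpret finite_measure M by fact
  have [measurable]: "U \<in> sets M" using U assms(2) by simp
  have "(\<lambda>n. \<integral>x. open_ramp U n x \<partial>M) \<longlonglongrightarrow> (\<integral>x. indicator U x \<partial>M)"
    by (rule integral_dominated_convergence[where w="\<lambda>_. 1"])
       (auto simp: open_ramp_bounds open_ramp_tendsto[OF U])
  then show ?thesis by simp
qed

lemma finite_measure_eqI_bcontfun:
  fixes M N :: "'a::metric_space measure"
  assumes M: "finite_measure M" "sets M = sets borel" and N: "finite_measure N" "sets N = sets borel"
    and eq: "\<And>f. f \<in> bcontfun \<Longrightarrow> (\<integral>x. f x \<partial>M) = (\<integral>x. (f x :: real) \<partial>N)"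
  shows "M = N"
proof (rule measure_eqI_generator_eq)
  interpret M: finite_measure M by fact
  interpret N: finite_measure N by fact
  show "Int_stable {U :: 'a set. open U}" by (auto simp: Int_stable_def)
  show "{U. open U} \<subseteq> Pow (UNIV :: 'a set)" by simp
  show "sets M = sigma_sets UNIV {U. open U}" "sets N = sigma_sets UNIV {U. open U}"
    using M N by (simp_all add: borel_def)
  show "range (\<lambda>_::nat. UNIV) \<subseteq> {U :: 'a set. open U}" "(\<Union>i::nat. UNIV) = (UNIV :: 'a set)"
    by auto
  show "emeasure M UNIV \<noteq> \<infinity>" for i :: nat by simp
  show "emeasure M U = emeasure N U" if "U \<in> {U. open U}" for U
  proof -
    from that have "measure M U = measure N U"
      using integral_open_ramp_tendsto[OF M, of U] integral_open_ramp_tendsto[OF N, of U]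
      by (auto simp: eq[OF open_ramp_bcontfun] intro: LIMSEQ_unique)
    then show ?thesis by (simp add: M.emeasure_eq_measure N.emeasure_eq_measure)
  qed
qed

instance prod :: (polish_space, polish_space) polish_space ..

section \<open>Coding a compact metric space by real numbers\<close>

lemma ternary_sum_separates:
  fixes d :: "nat \<Rightarrow> real"
  assumes d: "\<And>k. d k \<in> {-1, 0, 1}" and small: "\<bar>\<Sum>k. d k / 3 ^ k\<bar> < 1 / (2 * 3 ^ m)" and "n \<le> m"
  shows "d n = 0"
proof (rule ccontr)
  assume "d n \<noteq> 0"
  \<comment> \<open>The first nonzero digit contributes \<open>1 / 3 ^ j\<close> in absolute value,
    and all later digits together at most half of that, so they cannot cancel it. In base 2 the tail
    could equal the leading term, which is why the code is ternary.\<close>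
  define j where "j = (LEAST k. d k \<noteq> 0)"
  have j: "d j \<noteq> 0" "\<And>k. k < j \<Longrightarrow> d k = 0" "j \<le> n"
    unfolding j_def using \<open>d n \<noteq> 0\<close> LeastI[of "\<lambda>k. d k \<noteq> 0" n] Least_le[of "\<lambda>k. d k \<noteq> 0" n]
    by (auto dest: not_less_Least)
  have le: "\<bar>d k / 3 ^ k\<bar> \<le> (1/3) ^ k" for k
    using d[of k] by (auto simp: power_divide)
  have sm: "summable (\<lambda>k. d k / 3 ^ k)"
    by (rule summable_rabs_cancel, rule summable_comparison_test'[where g="\<lambda>k. (1/3)^k" and N=0])
       (use le in \<open>auto intro: summable_geometric\<close>)
  have geo: "(\<lambda>k. (1/3::real) ^ (k + Suc j)) sums ((1/3)^j / 2)"
    using sums_mult[OF geometric_sums[of "1/3::real"], of "(1/3) ^ Suc j"]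
    by (simp add: power_add mult.commute)
  have "(\<Sum>k. d k / 3 ^ k) = (\<Sum>k. d (k + Suc j) / 3 ^ (k + Suc j)) + (\<Sum>k<Suc j. d k / 3 ^ k)"
    by (rule suminf_split_initial_segment[OF sm])
  moreover have "(\<Sum>k<Suc j. d k / 3 ^ k) = d j / 3 ^ j"
    using j by simp
  moreover have "\<bar>\<Sum>k. d (k + Suc j) / 3 ^ (k + Suc j)\<bar> \<le> (1/3)^j / 2"
  proof -
    have "summable (\<lambda>k. \<bar>d (k + Suc j) / 3 ^ (k + Suc j)\<bar>)"
      by (rule summable_comparison_test'[where g="\<lambda>k. (1/3)^(k + Suc j)" and N=0])
         (use le geo in \<open>auto simp: sums_iff simp del: power_Suc\<close>)
    then have "\<bar>\<Sum>k. d (k + Suc j) / 3 ^ (k + Suc j)\<bar> \<le> (\<Sum>k. \<bar>d (k + Suc j) / 3 ^ (k + Suc j)\<bar>)"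
      by (rule summable_rabs)
    also have "\<dots> \<le> (\<Sum>k. (1/3) ^ (k + Suc j))"
      using \<open>summable (\<lambda>k. \<bar>d (k + Suc j) / 3 ^ (k + Suc j)\<bar>)\<close> geo le
      by (intro suminf_le) (auto simp: sums_iff simp del: power_Suc)
    finally show ?thesis using geo by (simp add: sums_iff)
  qed
  moreover have "\<bar>d j / 3 ^ j\<bar> = (1/3) ^ j"
    using d[of j] j(1) by (auto simp: power_divide)
  ultimately have "(1/3) ^ j / 2 \<le> \<bar>\<Sum>k. d k / 3 ^ k\<bar>" by linarith
  moreover have "1 / (2 * 3 ^ m) \<le> (1/3::real) ^ j / 2"
    using j(3) \<open>n \<le> m\<close> by (simp add: power_divide divide_simps)
  ultimately show False using small by linarith
qed

text \<open>
  Every compact metric space is the image of a closed set of reals under a continuous map with a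
  Borel right inverse: the membership bits in a countable base serve as ternary digits.  This
  reduces weak compactness and disintegration to the real line.
\<close>

lemma real_coding:
  assumes "compact (UNIV :: 'a::polish_space set)"
  obtains s :: "'a::polish_space \<Rightarrow> real" and C \<phi> where "s \<in> borel_measurable borel" "\<And>x. 0 \<le> s x \<and> s x \<le> 2"
    "closed C" "range s \<subseteq> C" "continuous_on C \<phi>" "\<And>x. \<phi> (s x) = x"
proof -
  obtain \<B> :: "'a set set" where \<B>: "countable \<B>" "topological_basis \<B>"
    using ex_countable_basis by auto
  have "\<B> \<noteq> {}"
    using topological_basisE[OF \<B>(2) open_UNIV UNIV_I] by blast
  define B where "B = from_nat_into \<B>"
  have B: "range B = \<B>" unfolding B_def using \<B> \<open>\<B> \<noteq> {}\<close> by simp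
  have [measurable]: "B n \<in> sets borel" for n
    using B topological_basis_open[OF \<B>(2)] by (auto intro!: borel_open)
  define s where "s x = (\<Sum>n. indicator (B n) x / 3 ^ n :: real)" for x
  have le: "indicator (B n) x / 3 ^ n \<le> (1/3::real) ^ n" for n x
    by (simp add: power_divide indicator_def)
  have sm: "summable (\<lambda>n. indicator (B n) x / 3 ^ n :: real)" for x
    by (rule summable_comparison_test'[where g="\<lambda>k. (1/3)^k" and N=0])
       (use le in \<open>auto intro: summable_geometric\<close>)
  have smeas: "s \<in> borel_measurable borel"
    unfolding s_def by measurable
  have s02: "0 \<le> s x \<and> s x \<le> 2" for x
  proof
    show "0 \<le> s x" unfolding s_def by (intro suminf_nonneg sm) auto
    have "s x \<le> (\<Sum>n. (1/3) ^ n)" unfolding s_def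
      by (intro suminf_le sm le summable_geometric) simp
    also have "\<dots> = 3/2" by (simp add: suminf_geometric)
    finally show "s x \<le> 2" by simp
  qed
  \<comment> \<open>Although \<open>s\<close> need not be continuous, close codes force close
    points. Finitely many basic sets of small diameter cover the space and \<open>m\<close> bounds
    their indices; codes closer than \<open>1 / (2 * 3 ^ m)\<close> agree in all digits up to
    \<open>m\<close>, so both points lie in a common member of the cover.\<close>
  have sep: "\<exists>\<delta>>0. \<forall>x y. \<bar>s x - s y\<bar> < \<delta> \<longrightarrow> dist x y < \<epsilon>" if "\<epsilon> > 0" for \<epsilon>
  proof -
    have "\<exists>b\<in>\<B>. x \<in> b \<and> b \<subseteq> ball x (\<epsilon>/2)" for x
      by (rule topological_basisE[OF \<B>(2) open_ball, of x x "\<epsilon>/2"]) (use that in auto)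
    then obtain b where b: "\<And>x. b x \<in> \<B>" "\<And>x. x \<in> b x" "\<And>x. b x \<subseteq> ball x (\<epsilon>/2)" by metis
    obtain T where T: "finite T" "UNIV \<subseteq> (\<Union>x\<in>T. b x)"
    proof (rule compactE_image[OF assms, of UNIV b])
      show "open (b x)" for x using b(1) topological_basis_open[OF \<B>(2)] by blast
    qed (use b(2) in auto)
    have "\<forall>x. \<exists>n. b x = B n" using b(1) B by (metis rangeE)
    then obtain i where i: "\<And>x. b x = B (i x)" by metis
    define m where "m = Max (insert 0 (i ` T))"
    have m: "i x \<le> m" if "x \<in> T" for x unfolding m_def using T that by simp
    show ?thesis
    proof (intro exI[of _ "1 / (2 * 3 ^ m)"] conjI allI impI)
      fix x y assume xy: "\<bar>s x - s y\<bar> < 1 / (2 * 3 ^ m)"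
      obtain z where z: "z \<in> T" "x \<in> b z" using T by auto
      have "s x - s y = (\<Sum>n. (indicator (B n) x - indicator (B n) y) / 3 ^ n)"
        unfolding s_def by (subst suminf_diff[OF sm sm]) (simp add: diff_divide_distrib)
      then have "(indicator (B (i z)) x - indicator (B (i z)) y :: real) = 0"
        using xy m[OF z(1)]
        by (intro ternary_sum_separates[of "\<lambda>n. indicator (B n) x - indicator (B n) y" m])
           (auto simp: indicator_def)
      then have "y \<in> b z" using z i by (auto simp: indicator_def split: if_splits)
      then have "dist z x < \<epsilon>/2" "dist z y < \<epsilon>/2" using z b(3)[of z] by auto
      then show "dist x y < \<epsilon>" by metric
    qed simp
  qed
  have inj: "inj s"
  proof (rule injI)
    fix x y assume "s x = s y"
    then have "dist x y < \<epsilon>" if "\<epsilon> > 0" for \<epsilon> using sep[OF that] by auto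
    then show "x = y" by (metis dist_pos_lt less_irrefl)
  qed
  \<comment> \<open>Uniform continuity extends the decoding map to the closure of the range. This
    supplies the closed set, as the range itself need not be closed.\<close>
  have "uniformly_continuous_on (range s) (inv s)"
    unfolding uniformly_continuous_on_def
  proof (intro allI impI)
    fix \<epsilon> :: real assume "\<epsilon> > 0"
    from sep[OF this] obtain \<delta> where "\<delta> > 0" "\<And>x y. \<bar>s x - s y\<bar> < \<delta> \<Longrightarrow> dist x y < \<epsilon>" by blast
    then show "\<exists>d>0. \<forall>x\<in>range s. \<forall>x'\<in>range s. dist x' x < d \<longrightarrow> dist (inv s x') (inv s x) < \<epsilon>"
      by (intro exI[of _ \<delta>]) (auto simp: inj dist_real_def)
  qed
  then obtain \<phi> where \<phi>: "uniformly_continuous_on (closure (range s)) \<phi>"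
      "\<And>x. x \<in> range s \<Longrightarrow> inv s x = \<phi> x"
    using uniformly_continuous_on_extension_on_closure by metis
  show ?thesis
  proof (rule that[OF smeas s02, of "closure (range s)" \<phi>])
    show "\<phi> (s x) = x" for x using \<phi>(2)[of "s x"] inj by simp
  qed (use \<phi> closure_subset[of "range s"] in \<open>auto simp: uniformly_continuous_imp_continuous\<close>)
qed

section \<open>Weak sequential compactness of probability measures\<close>

lemma prob_measures_distr:
  assumes "M \<in> prob_measures" "f \<in> borel \<rightarrow>\<^sub>M borel"
  shows "distr M borel f \<in> prob_measures"
proof -
  have "f \<in> M \<rightarrow>\<^sub>M borel"
    using assms by (simp add: prob_measures_def measurable_cong_sets[of M borel])
  then show ?thesis
    using assms by (simp add: prob_measures_def prob_space.prob_space_distr)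
qed

lemma real_distribution_iff_prob_measures:
  "real_distribution M \<longleftrightarrow> M \<in> prob_measures"
  by (auto simp: prob_measures_def real_distribution_def real_distribution_axioms_def
      dest: sets_eq_imp_space_eq)

text \<open>The closed-set half of the portmanteau theorem, for full mass: ramps supported in the
  open complement integrate to 0 along the sequence, hence also in the limit, and they increase to
  the indicator of the complement.\<close>

lemma weak_limit_closed_full:
  fixes C :: "'a::metric_space set"
  assumes "weakly_converges M N" "\<And>n. M n \<in> prob_measures" "N \<in> prob_measures" "closed C"
    and full: "\<And>n. emeasure (M n) C = 1"
  shows "emeasure N C = 1"
proof -
  interpret N: prob_space N using assms by (simp add: prob_measures_def)
  have sN: "sets N = sets borel" using assms by (simp add: prob_measures_def)
  have CN: "C \<in> sets N" using assms(4) sN by (simp add: borel_closed)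
  have "(\<integral>x. open_ramp (-C) k x \<partial>N) = 0" for k
  proof -
    have "(\<integral>x. open_ramp (-C) k x \<partial>(M n)) = 0" for n
    proof -
      interpret M: prob_space "M n" using assms by (simp add: prob_measures_def)
      have sM: "sets (M n) = sets borel" using assms by (simp add: prob_measures_def)
      then have "C \<in> sets (M n)" using assms(4) by (simp add: borel_closed)
      then have "AE x in M n. x \<in> C"
        using full[of n] by (simp add: M.emeasure_eq_measure M.prob_eq_1)
      then show ?thesis by (intro integral_eq_zero_AE) (auto simp: open_ramp_outside)
    qed
    moreover have "(\<lambda>n. \<integral>x. open_ramp (-C) k x \<partial>(M n)) \<longlonglongrightarrow> (\<integral>x. open_ramp (-C) k x \<partial>N)"
      using assms(1) open_ramp_bcontfun by (auto simp: weakly_converges_def)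
    ultimately show ?thesis by (simp add: LIMSEQ_const_iff)
  qed
  then have "measure N (-C) = 0"
    using integral_open_ramp_tendsto[of N "-C"] assms(4) sN N.finite_measure_axioms
    by (auto simp: LIMSEQ_const_iff open_Compl)
  moreover have "- C = space N - C" using sets_eq_imp_space_eq[OF sN] by auto
  ultimately show ?thesis using N.prob_compl[OF CN] by (simp add: N.emeasure_eq_measure)
qed

text \<open>Coding moves all measures into [0, 2], where they are tight and Helly's selection
  theorem applies. The limit on the line is still carried by \<open>C\<close> because
  \<open>C\<close> is closed, so it can be decoded.\<close>

theorem weakly_convergent_subsequence:
  fixes M :: "nat \<Rightarrow> 'a::polish_space measure"
  assumes "compact (UNIV :: 'a set)" and M: "\<And>n. M n \<in> prob_measures"
  obtains r N where "strict_mono r" "N \<in> prob_measures" "weakly_converges (M \<circ> r) N"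
proof -
  obtain s :: "'a \<Rightarrow> real" and C \<phi> where s[measurable]: "s \<in> borel_measurable borel" and s02: "\<And>x. 0 \<le> s x \<and> s x \<le> 2"
    and C: "closed C" "range s \<subseteq> C" and \<phi>: "continuous_on C \<phi>" "\<And>x. \<phi> (s x) = x"
    by (rule real_coding[OF assms(1)], rule that)
  have [measurable_cong]: "sets (M n) = sets borel" for n using M by (simp add: prob_measures_def)
  define R where "R n = distr (M n) borel s" for n
  have R: "R n \<in> prob_measures" for n unfolding R_def by (intro prob_measures_distr M s)
  \<comment> \<open>Tightness is phrased with intervals that are open on the left, so the left end
    has to lie strictly below the smallest possible code 0.\<close>
  have "emeasure (R n) {-1<..2} = 1" for n
  proof -
    interpret prob_space "M n" using M by (simp add: prob_measures_def)
    have "s x \<in> {-1<..2}" for x using s02[of x] by auto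
    then have "s -` {-1<..2} \<inter> space (M n) = space (M n)" by auto
    then show ?thesis unfolding R_def by (simp add: emeasure_distr emeasure_space_1)
  qed
  then have "1 - \<epsilon> < measure (R n) {-1<..2}" if "\<epsilon> > 0" for n \<epsilon>
    using that by (simp add: measure_def)
  then have "tight R" unfolding tight_def
    by (intro conjI allI impI exI[of _ "-1::real"] exI[of _ "2::real"])
       (auto simp: real_distribution_iff_prob_measures R)
  from tight_imp_convergent_subsubsequence[OF this strict_mono_id]
  obtain r Q where r: "strict_mono r" and Q: "real_distribution Q" "weak_conv_m (R \<circ> r) Q" by auto
  have conv: "(\<lambda>n. \<integral>x. f x \<partial>R (r n)) \<longlonglongrightarrow> (\<integral>x. f x \<partial>Q)" if "f \<in> bcontfun" for f :: "real \<Rightarrow> real"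
  proof -
    obtain B where "\<And>x. norm (f x) \<le> B" using \<open>f \<in> bcontfun\<close> by (auto simp: bcontfun_def bounded_iff)
    then show ?thesis
      using weak_conv_imp_integral_bdd_continuous_conv[of "R \<circ> r" Q f B] Q R that
      by (auto simp: real_distribution_iff_prob_measures bcontfun_def continuous_on_eq_continuous_at)
  qed
  have Qp: "Q \<in> prob_measures" using Q by (simp add: real_distribution_iff_prob_measures)
  have [measurable_cong]: "sets Q = sets borel" using Qp by (simp add: prob_measures_def)
  have [measurable]: "C \<in> sets borel" using C by (simp add: borel_closed)
  have QC: "emeasure Q C = 1"
  proof (rule weak_limit_closed_full[of "R \<circ> r" Q])
    show "weakly_converges (R \<circ> r) Q" using conv by (simp add: weakly_converges_def)
    fix n
    interpret prob_space "M (r n)" using M by (simp add: prob_measures_def)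
    have "s -` C \<inter> space (M (r n)) = space (M (r n))" using C by auto
    then show "emeasure ((R \<circ> r) n) C = 1"
      unfolding R_def by (simp add: emeasure_distr emeasure_space_1)
  qed (use R Qp C in auto)
  define \<psi> where "\<psi> x = (if x \<in> C then \<phi> x else undefined)" for x
  have [measurable]: "\<psi> \<in> borel \<rightarrow>\<^sub>M borel"
    unfolding \<psi>_def using \<phi>(1) by (intro borel_measurable_continuous_on_if C) auto
  show ?thesis
  proof (rule that[of r "distr Q borel \<psi>"])
    show "distr Q borel \<psi> \<in> prob_measures" by (intro prob_measures_distr Qp) measurable
    show "weakly_converges (M \<circ> r) (distr Q borel \<psi>)"
      unfolding weakly_converges_def
    proof
      fix f :: "'a \<Rightarrow> real" assume f: "f \<in> bcontfun"
      then have fc: "continuous_on UNIV f" and [measurable]: "f \<in> borel_measurable borel"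
        by (auto simp: bcontfun_def borel_measurable_continuous_onI)
      obtain B where B: "\<And>x. norm (f x) \<le> B" using f by (auto simp: bcontfun_def bounded_iff)
      \<comment> \<open>Convergence on the line can only be tested with functions on the whole line.
        The decoded test function is continuous on \<open>C\<close>, and Tietze's theorem extends it
        with the same bound.\<close>
      obtain F where F: "continuous_on UNIV F" "\<And>x. x \<in> C \<Longrightarrow> F x = (f \<circ> \<phi>) x" "\<And>x. norm (F x) \<le> B"
      proof (rule Tietze[of C "f \<circ> \<phi>" UNIV B])
        show "continuous_on C (f \<circ> \<phi>)"
          by (intro continuous_on_compose \<phi> continuous_on_subset[OF fc]) auto
        show "0 \<le> B" using B[of undefined] norm_ge_zero order_trans by blast
      qed (use B C in auto)
      have [measurable]: "F \<in> borel_measurable borel"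
        using F by (intro borel_measurable_continuous_onI)
      have "F \<in> bcontfun" using F by (auto simp: bcontfun_def bounded_iff)
      then have "(\<lambda>n. \<integral>x. F x \<partial>R (r n)) \<longlonglongrightarrow> (\<integral>x. F x \<partial>Q)" by (rule conv)
      also have "(\<lambda>n. \<integral>x. F x \<partial>R (r n)) = (\<lambda>n. \<integral>x. f x \<partial>(M \<circ> r) n)"
      proof
        fix n
        have "F (s x) = f x" for x using F(2)[of "s x"] C(2) \<phi>(2) by auto
        then show "(\<integral>x. F x \<partial>R (r n)) = (\<integral>x. f x \<partial>(M \<circ> r) n)"
          unfolding R_def by (simp add: integral_distr)
      qed
      also have "(\<integral>x. F x \<partial>Q) = (\<integral>x. f x \<partial>distr Q borel \<psi>)"
      proof -
        interpret Q: prob_space Q using Qp by (simp add: prob_measures_def)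
        have "AE x in Q. x \<in> C" using QC by (simp add: Q.emeasure_eq_measure Q.prob_eq_1)
        then have "(\<integral>x. F x \<partial>Q) = (\<integral>x. f (\<psi> x) \<partial>Q)"
          by (intro integral_cong_AE) (measurable, auto simp: \<psi>_def F)
        then show ?thesis by (simp add: integral_distr)
      qed
      finally show "(\<lambda>n. \<integral>z. f z \<partial>(M \<circ> r) n) \<longlonglongrightarrow> (\<integral>z. f z \<partial>distr Q borel \<psi>)" .
    qed
  qed (rule r)
qed

subsection \<open>Disintegration\<close>

text \<open>Test the hypothesis on the set where the conclusion fails; the finite integral of
  \<open>g\<close> permits the subtraction.\<close>

lemma AE_le_if_nn_integral_le:
  assumes [measurable]: "f \<in> borel_measurable M" "g \<in> borel_measurable M"
    and le: "\<And>A. A \<in> sets M \<Longrightarrow> (\<integral>\<^sup>+x. f x * indicator A x \<partial>M) \<le> (\<integral>\<^sup>+x. g x * indicator A x \<partial>M)"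
    and fin: "(\<integral>\<^sup>+x. g x \<partial>M) < \<infinity>"
  shows "AE x in M. f x \<le> g x"
proof -
  define A where "A = {x \<in> space M. g x < f x}"
  have [measurable]: "A \<in> sets M" unfolding A_def by measurable
  have "(\<integral>\<^sup>+x. g x * indicator A x \<partial>M) \<le> (\<integral>\<^sup>+x. g x \<partial>M)"
    by (intro nn_integral_mono) (auto split: split_indicator)
  then have "(\<integral>\<^sup>+x. (f x * indicator A x - g x * indicator A x) \<partial>M) =
      (\<integral>\<^sup>+x. f x * indicator A x \<partial>M) - (\<integral>\<^sup>+x. g x * indicator A x \<partial>M)"
    using fin by (intro nn_integral_diff) (auto simp: A_def split: split_indicator)
  also have "\<dots> = 0"
    using le[of A] le_less_trans[OF le[of A] le_less_trans[OF \<open>_ \<le> (\<integral>\<^sup>+x. g x \<partial>M)\<close> fin]]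
    by (intro diff_eq_0_ennreal) auto
  finally have "AE x in M. f x * indicator A x - g x * indicator A x = 0"
    by (subst (asm) nn_integral_0_iff_AE) auto
  with AE_space show ?thesis
  proof eventually_elim
    case (elim x)
    then show ?case using ennreal_minus_eq_0[of "f x" "g x"] by (cases "x \<in> A") (auto simp: A_def)
  qed
qed

text \<open>For rational \<open>r\<close> the conditional probability that the second coordinate is
  at most \<open>r\<close> is a Radon-Nikodym derivative \<open>g r\<close>. Monotonicity in
  \<open>r\<close> and the values 0 below 0 and 1 from 2 on are countably many almost sure
  statements, so they hold together off one null set. Passing from rationals to reals by an infimum
  from the right produces a distribution function for every \<open>x\<close>.\<close>

lemma regular_conditional_cdf:
  fixes P :: "('a \<times> real) measure"
  assumes P: "prob_space P" and setsP [measurable_cong]: "sets P = sets (M \<Otimes>\<^sub>M borel)"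
    and bnd: "AE z in P. 0 \<le> snd z \<and> snd z \<le> 2"
  defines "\<rho> \<equiv> distr P M fst"
  obtains F where "\<And>x t. 0 \<le> F x t \<and> F x t \<le> 1" "\<And>x s t. s \<le> t \<Longrightarrow> F x s \<le> F x t"
    "\<And>x t. continuous (at_right t) (F x)" "\<And>x t. t < 0 \<Longrightarrow> F x t = 0" "\<And>x t. 2 \<le> t \<Longrightarrow> F x t = 1"
    "\<And>t::real. (\<lambda>x. F x t) \<in> borel_measurable M"
    "\<And>t A. A \<in> sets M \<Longrightarrow> measure P (A \<times> {..t}) = (\<integral>x. indicator A x * (F x t :: real) \<partial>\<rho>)"
proof -
  interpret P: prob_space P by fact
  have spP: "space P = space M \<times> UNIV"
    using sets_eq_imp_space_eq[OF setsP] by (simp add: space_pair_measure)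
  have [measurable]: "fst \<in> P \<rightarrow>\<^sub>M M" "snd \<in> borel_measurable P" by measurable
  have sets\<rho>[measurable_cong]: "sets \<rho> = sets M" by (simp add: \<rho>_def)
  have sp\<rho>: "space \<rho> = space M" by (simp add: \<rho>_def)
  interpret \<rho>: prob_space \<rho> unfolding \<rho>_def by (rule P.prob_space_distr) measurable
  have AU[measurable]: "A \<times> B \<in> sets P" if "A \<in> sets M" "B \<in> sets borel" for A B
    using that by (auto simp: setsP)
  define N where "N r = distr (density P (indicator (space M \<times> {..real_of_rat r}))) M fst" for r
  have setsN[measurable_cong]: "sets (N r) = sets M" for r by (simp add: N_def)
  have emN: "emeasure (N r) A = emeasure P (A \<times> {..real_of_rat r})" if [measurable]: "A \<in> sets M" for A r
  proof -
    have "fst -` A \<inter> space P = A \<times> UNIV" using sets.sets_into_space[OF that] by (auto simp: spP)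
    then have "emeasure (N r) A = emeasure (density P (indicator (space M \<times> {..real_of_rat r}))) (A \<times> UNIV)"
      unfolding N_def by (subst emeasure_distr) auto
    also have "\<dots> = (\<integral>\<^sup>+z. indicator (A \<times> {..real_of_rat r}) z \<partial>P)"
      using sets.sets_into_space[OF that]
      by (subst emeasure_density, measurable, intro nn_integral_cong) (auto split: split_indicator)
    finally show ?thesis by simp
  qed
  have em\<rho>: "emeasure \<rho> A = emeasure P (A \<times> UNIV)" if "A \<in> sets M" for A
  proof -
    have "fst -` A \<inter> space P = A \<times> UNIV" using sets.sets_into_space[OF that] by (auto simp: spP)
    then show ?thesis unfolding \<rho>_def using that by (simp add: emeasure_distr)
  qed
  have Nle: "emeasure (N r) A \<le> emeasure \<rho> A" if "A \<in> sets M" for r A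
    using that by (simp add: emN em\<rho>) (intro emeasure_mono, auto)
  have ac: "absolutely_continuous \<rho> (N r)" for r
    unfolding absolutely_continuous_def
  proof
    fix A assume "A \<in> null_sets \<rho>"
    then show "A \<in> null_sets (N r)" using Nle[of A r] by (auto simp: null_sets_def setsN sets\<rho>)
  qed
  define g where "g r = RN_deriv \<rho> (N r)" for r
  have [measurable]: "g r \<in> borel_measurable M" for r
    unfolding g_def using borel_measurable_RN_deriv[of \<rho> "N r"]
    by (simp add: measurable_cong_sets[OF sets\<rho> refl])
  have g: "(\<integral>\<^sup>+x. g r x * indicator A x \<partial>\<rho>) = emeasure P (A \<times> {..real_of_rat r})" if [measurable]: "A \<in> sets M" for A r
  proof -
    have "(\<integral>\<^sup>+x. g r x * indicator A x \<partial>\<rho>) = emeasure (density \<rho> (g r)) A"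
      by (subst emeasure_density) auto
    also have "density \<rho> (g r) = N r" unfolding g_def
      by (rule \<rho>.density_RN_deriv[OF ac]) (simp add: setsN sets\<rho>)
    finally show ?thesis using emN that by simp
  qed
  have gint: "(\<integral>\<^sup>+x. g r x \<partial>\<rho>) = emeasure P (space M \<times> {..real_of_rat r})" for r
  proof -
    have "(\<integral>\<^sup>+x. g r x \<partial>\<rho>) = (\<integral>\<^sup>+x. g r x * indicator (space M) x \<partial>\<rho>)"
      by (intro nn_integral_cong) (simp add: sp\<rho>)
    then show ?thesis by (simp add: g)
  qed
  have gfin: "(\<integral>\<^sup>+x. g r x \<partial>\<rho>) < \<infinity>" for r
    by (simp add: gint P.emeasure_eq_measure)
  have mono_AE: "AE x in \<rho>. \<forall>r r'. r \<le> r' \<longrightarrow> g r x \<le> g r' x"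
    unfolding AE_all_countable
  proof (intro allI)
    fix r r' :: rat
    show "AE x in \<rho>. r \<le> r' \<longrightarrow> g r x \<le> g r' x"
    proof (cases "r \<le> r'")
      case True
      have "AE x in \<rho>. g r x \<le> g r' x"
      proof (rule AE_le_if_nn_integral_le[OF _ _ _ gfin])
        fix A assume "A \<in> sets \<rho>"
        then have [measurable]: "A \<in> sets M" by (simp add: sets\<rho>)
        show "(\<integral>\<^sup>+x. g r x * indicator A x \<partial>\<rho>) \<le> (\<integral>\<^sup>+x. g r' x * indicator A x \<partial>\<rho>)"
          using True[folded of_rat_less_eq[where 'a=real]] by (auto simp: g intro!: emeasure_mono)
      qed auto
      then show ?thesis by simp
    qed simp
  qed
  have low_AE: "AE x in \<rho>. \<forall>r<0. g r x = 0"
    unfolding AE_all_countable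
  proof (intro allI)
    fix r :: rat
    show "AE x in \<rho>. r < 0 \<longrightarrow> g r x = 0"
    proof (cases "r < 0")
      case True
      have "emeasure P (space M \<times> {..real_of_rat r}) = 0"
        using bnd True by (subst AE_iff_measurable[of _ _ "\<lambda>z. \<not> snd z \<le> real_of_rat r", symmetric])
          (auto simp: spP elim!: eventually_mono dest: order_trans)
      then have "(\<integral>\<^sup>+x. g r x \<partial>\<rho>) = 0"
        by (simp add: gint)
      then show ?thesis using nn_integral_0_iff_AE[of "g r" \<rho>] by auto
    qed simp
  qed
  have high_AE: "AE x in \<rho>. \<forall>r\<ge>2. g r x = 1"
    unfolding AE_all_countable
  proof (intro allI)
    fix r :: rat
    show "AE x in \<rho>. 2 \<le> r \<longrightarrow> g r x = 1"
    proof (cases "2 \<le> r")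
      case True
      have eq: "(\<integral>\<^sup>+x. g r x * indicator A x \<partial>\<rho>) = (\<integral>\<^sup>+x. 1 * indicator A x \<partial>\<rho>)" if [measurable]: "A \<in> sets M" for A
      proof -
        have "emeasure P (A \<times> {..real_of_rat r}) = emeasure P (A \<times> UNIV)"
        proof (rule emeasure_eq_AE)
          have "2 \<le> real_of_rat r"
            using True of_rat_less_eq[of 2 r, where 'a=real] by simp
          then show "AE z in P. z \<in> A \<times> {..real_of_rat r} \<longleftrightarrow> z \<in> A \<times> UNIV"
            using bnd by (elim eventually_mono) auto
        qed auto
        then show ?thesis by (simp add: g em\<rho>)
      qed
      have "AE x in \<rho>. g r x \<le> 1" "AE x in \<rho>. 1 \<le> g r x"
        using gfin[of r] by (intro AE_le_if_nn_integral_le; simp add: eq[simplified] sets\<rho> \<rho>.emeasure_space_1)+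
      then show ?thesis by auto
    qed simp
  qed
  define good where "good x \<longleftrightarrow> (\<forall>r r'. r \<le> r' \<longrightarrow> g r x \<le> g r' x) \<and> (\<forall>r<0. g r x = 0) \<and> (\<forall>r\<ge>2. g r x = 1)" for x
  have [measurable]: "Measurable.pred M good" unfolding good_def by measurable
  have good_AE: "AE x in \<rho>. good x"
    using mono_AE low_AE high_AE by eventually_elim (simp add: good_def)
  \<comment> \<open>Off the good set the conditional law is replaced by the unit mass at 0, so that
    the required properties hold for every \<open>x\<close> and not just almost everywhere.\<close>
  define G where "G r x = (if good x then enn2real (g r x) else if r < 0 then 0 else 1)" for r x
  have [measurable]: "G r \<in> borel_measurable M" for r unfolding G_def by measurable
  have g1: "g r x \<le> 1" if "good x" for r x
  proof -
    have "r \<le> max r 2" "2 \<le> max r 2" by auto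
    then have "g r x \<le> g (max r 2) x" "g (max r 2) x = 1" using that unfolding good_def by blast+
    then show ?thesis by metis
  qed
  have G_mono: "G r x \<le> G r' x" if "r \<le> r'" for r r' x
    using that g1 le_less_trans[OF g1[of x r'], of top] by (auto simp: G_def good_def intro!: enn2real_mono)
  have G_low: "G r x = 0" if "r < 0" for r x using that by (auto simp: G_def good_def)
  have G_high: "G r x = 1" if "2 \<le> r" for r x using that by (auto simp: G_def good_def)
  have G01: "0 \<le> G r x" "G r x \<le> 1" for r x
    using G_mono[of r "max r 2" x] G_high[of "max r 2" x] by (auto simp: G_def)
  \<comment> \<open>The infimum runs over rationals strictly above \<open>t\<close>; the strictness
    is what makes \<open>F x\<close> right-continuous.\<close>
  define F where "F x t = (INF r\<in>{r. t < real_of_rat r}. G r x)" for x t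
  have ne: "{r. t < real_of_rat r} \<noteq> {}" for t using of_rat_dense[of t "t+1"] by auto
  have bb: "bdd_below ((\<lambda>r. G r x) ` S)" for S x by (rule bdd_belowI2[of _ 0]) (rule G01)
  have F_le: "F x t \<le> G r x" if "t < real_of_rat r" for x t r
    unfolding F_def using that by (intro cINF_lower bb) auto
  have F_ge: "c \<le> F x t" if "\<And>r. t < real_of_rat r \<Longrightarrow> c \<le> G r x" for c x t
    unfolding F_def using that by (intro cINF_greatest ne) auto
  have F_less: "\<exists>r. t < real_of_rat r \<and> G r x < c" if "F x t < c" for x t c
    using that F_ge[of t c x] by (metis leD not_le)
  have F01: "0 \<le> F x t \<and> F x t \<le> 1" for x t
  proof -
    obtain r where "t < real_of_rat r" using ne[of t] by auto
    then show ?thesis using F_le[of t r x] G01(2)[of r x] F_ge[of t 0 x] G01(1) by (auto intro: order_trans)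
  qed
  have F_mono: "F x s \<le> F x t" if "s \<le> t" for x s t
    using that by (intro F_ge F_le) auto
  have F_meas: "(\<lambda>x. F x t) \<in> borel_measurable M" for t
    unfolding borel_measurable_iff_less
  proof
    fix c
    \<comment> \<open>A strict upper bound on the infimum is attained by one of its members, so the
      sublevel set is a countable union over rationals.\<close>
    have "{x \<in> space M. F x t < c} = {x \<in> space M. \<exists>r. t < real_of_rat r \<and> G r x < c}"
      using F_less le_less_trans[OF F_le] by blast
    then show "{x \<in> space M. F x t < c} \<in> sets M" by simp
  qed
  have F_right: "\<exists>\<delta>>0. \<forall>u. t \<le> u \<and> u < t + \<delta> \<longrightarrow> F x u < c" if c: "F x t < c" for x t c
  proof -
    obtain r where r: "t < real_of_rat r" "G r x < c" using F_less[OF c] by auto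
    have "F x u < c" if "u < t + (real_of_rat r - t)" for u
      using F_le[of u r x] r that by simp
    then show ?thesis using r by (intro exI[of _ "real_of_rat r - t"]) auto
  qed
  \<comment> \<open>Rationals decreasing to \<open>t\<close> from strictly above: along them
    \<open>G\<close> tends to \<open>F\<close>, and the half-lines \<open>{..q n}\<close> shrink to
    \<open>{..t}\<close>, so the integral identity passes from rational to real thresholds.\<close>
  have "\<exists>q. \<forall>n. t < real_of_rat (q n) \<and> real_of_rat (q n) < t + 1 / Suc n" for t
    by (intro choice allI) (auto intro!: of_rat_dense)
  then obtain q where q: "\<And>t n. t < real_of_rat (q t n) \<and> real_of_rat (q t n) < t + 1 / Suc n"
    by metis
  have q_ev: "\<forall>\<^sub>F n in sequentially. real_of_rat (q t n) < u" if "t < u" for t u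
  proof -
    have "\<forall>\<^sub>F n in sequentially. 1 / Suc n < u - t"
      using LIMSEQ_inverse_real_of_nat that by (intro order_tendstoD) (auto simp: divide_inverse)
    then show ?thesis by eventually_elim (use q in \<open>smt (verit)\<close>)
  qed
  have Gq: "(\<lambda>n. G (q t n) x) \<longlonglongrightarrow> F x t" for t x
  proof (rule order_tendstoI)
    fix a assume "a < F x t"
    then show "\<forall>\<^sub>F n in sequentially. a < G (q t n) x"
      using less_le_trans[OF _ F_le] q by (intro always_eventually) blast
  next
    fix a assume "F x t < a"
    then obtain r where r: "t < real_of_rat r" "G r x < a" using F_less by blast
    from q_ev[OF r(1)] show "\<forall>\<^sub>F n in sequentially. G (q t n) x < a"
      by eventually_elim (rule le_less_trans[OF G_mono r(2)], simp add: of_rat_less less_imp_le)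
  qed
  show ?thesis
  proof (rule that[of F, OF F01 F_mono _ _ _ F_meas])
    show "continuous (at_right t) (F x)" for x t
      unfolding continuous_within
    proof (rule order_tendstoI)
      fix a assume a: "a < F x t"
      show "\<forall>\<^sub>F u in at_right t. a < F x u"
        unfolding eventually_at_right_field
        by (intro exI[of _ "t+1"] conjI allI impI less_le_trans[OF a F_mono]) auto
    next
      fix a assume "F x t < a"
      from F_right[OF this] obtain \<delta> where "\<delta> > 0" "\<And>u. t \<le> u \<and> u < t + \<delta> \<Longrightarrow> F x u < a" by blast
      then show "\<forall>\<^sub>F u in at_right t. F x u < a"
        unfolding eventually_at_right_field by (intro exI[of _ "t+\<delta>"]) auto
    qed
    show "F x t = 0" if t: "t < 0" for x t
    proof -
      obtain r where "t < real_of_rat r" "real_of_rat r < 0" using of_rat_dense[OF t] by auto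
      then have "F x t \<le> 0" using F_le[of t r x] G_low[of r x] by simp
      then show ?thesis using F01[of x t] by linarith
    qed
    show "F x t = 1" if t: "2 \<le> t" for x t
    proof (rule antisym)
      have "2 \<le> r" if "t < real_of_rat r" for r
      proof -
        have "real_of_rat 2 \<le> real_of_rat r" using that t by simp
        then show ?thesis by (simp only: of_rat_less_eq)
      qed
      then show "1 \<le> F x t" using G_high by (intro F_ge) auto
    qed (use F01 in auto)
    fix t A assume A[measurable]: "A \<in> sets M"
    have GA: "measure P (A \<times> {..real_of_rat r}) = (\<integral>x. indicator A x * G r x \<partial>\<rho>)" for r
    proof -
      have "(\<integral>\<^sup>+x. ennreal (indicator A x * G r x) \<partial>\<rho>) = (\<integral>\<^sup>+x. g r x * indicator A x \<partial>\<rho>)"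
        using good_AE
        by (intro nn_integral_cong_AE, eventually_elim)
           (use less_imp_neq[OF le_less_trans[OF g1 ennreal_one_less_top]] in
             \<open>auto simp: G_def ennreal_enn2real_if split: split_indicator\<close>)
      then show ?thesis
        by (subst integral_eq_nn_integral) (auto simp: g measure_def G01)
    qed
    have "(\<lambda>n. \<integral>x. indicator A x * G (q t n) x \<partial>\<rho>) \<longlonglongrightarrow> (\<integral>x. indicator A x * F x t \<partial>\<rho>)"
      using F_meas by (intro integral_dominated_convergence[where w="\<lambda>_. 1"])
        (auto intro!: tendsto_intros Gq simp: G01 split: split_indicator)
    moreover have "(\<lambda>n. \<integral>z. (indicator (A \<times> {..real_of_rat (q t n)}) z :: real) \<partial>P) \<longlonglongrightarrow> (\<integral>z. (indicator (A \<times> {..t}) z :: real) \<partial>P)"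
    proof (rule integral_dominated_convergence[where w="\<lambda>_. 1"])
      show "AE z in P. (\<lambda>n. indicator (A \<times> {..real_of_rat (q t n)}) z) \<longlonglongrightarrow> (indicator (A \<times> {..t}) z :: real)"
      proof (rule AE_I2)
        fix z assume "z \<in> space P"
        show "(\<lambda>n. indicator (A \<times> {..real_of_rat (q t n)}) z) \<longlonglongrightarrow> (indicator (A \<times> {..t}) z :: real)"
        proof (cases "snd z \<le> t")
          case True
          then have "snd z \<le> real_of_rat (q t n)" for n using q[of t n] by linarith
          then show ?thesis using True by (cases z) (auto simp: indicator_def)
        next
          case False
          then have "\<forall>\<^sub>F n in sequentially. real_of_rat (q t n) < snd z" by (intro q_ev) auto
          then have "\<forall>\<^sub>F n in sequentially. indicator (A \<times> {..real_of_rat (q t n)}) z = (indicator (A \<times> {..t}) z :: real)"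
            by eventually_elim (use False in \<open>cases z, auto simp: indicator_def\<close>)
          then show ?thesis by (rule tendsto_eventually)
        qed
      qed
    qed (auto split: split_indicator)
    ultimately show "measure P (A \<times> {..t}) = (\<integral>x. indicator A x * F x t \<partial>\<rho>)"
      using GA by (auto intro: LIMSEQ_unique)
  qed
qed

text \<open>For fixed \<open>A\<close> both sides are finite measures in \<open>B\<close>, named
  \<open>K\<close> and \<open>L\<close> in the proof. They agree on half-lines by the identity for
  the distribution function, and the half-lines are an intersection-stable generator.\<close>

lemma regular_conditional_distribution:
  fixes P :: "('a \<times> real) measure"
  assumes P: "prob_space P" and setsP: "sets P = sets (M \<Otimes>\<^sub>M borel)"
    and bnd: "AE z in P. 0 \<le> snd z \<and> snd z \<le> 2"
  obtains \<kappa> where "\<kappa> \<in> M \<rightarrow>\<^sub>M prob_algebra borel"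
    "\<And>A B. A \<in> sets M \<Longrightarrow> B \<in> sets borel \<Longrightarrow>
       emeasure P (A \<times> B) = (\<integral>\<^sup>+x\<in>A. emeasure (\<kappa> x) B \<partial>(distr P M fst))"
proof -
  define \<rho> where "\<rho> = distr P M fst"
  obtain F where F01: "\<And>x t. 0 \<le> F x t \<and> F x t \<le> 1" and F: "\<And>x s t. s \<le> t \<Longrightarrow> F x s \<le> F x t"
    "\<And>x t. continuous (at_right t) (F x)" and Flow: "\<And>x t. t < 0 \<Longrightarrow> F x t = 0"
    and Fhigh: "\<And>x t. 2 \<le> t \<Longrightarrow> F x t = 1"
    and Fmeas[measurable]: "\<And>t::real. (\<lambda>x. F x t) \<in> borel_measurable M"
    and FP: "\<And>t A. A \<in> sets M \<Longrightarrow> measure P (A \<times> {..t}) = (\<integral>x. indicator A x * (F x t :: real) \<partial>distr P M fst)"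
    by (rule regular_conditional_cdf[OF assms], rule that)
  note FP = FP[folded \<rho>_def]
  interpret P: prob_space P by fact
  have "fst \<in> P \<rightarrow>\<^sub>M M" by (simp add: measurable_cong_sets[OF setsP refl])
  then interpret \<rho>: prob_space \<rho> unfolding \<rho>_def by (rule P.prob_space_distr)
  have sets\<rho>[measurable_cong]: "sets \<rho> = sets M" by (simp add: \<rho>_def)
  have bot: "(F x \<longlongrightarrow> 0) at_bot" for x
    by (rule tendsto_eventually) (auto simp: Flow eventually_at_bot_dense intro!: exI[of _ 0])
  have top: "(F x \<longlongrightarrow> 1) at_top" for x
    by (rule tendsto_eventually) (auto simp: Fhigh eventually_at_top_linorder intro!: exI[of _ 2])
  define \<kappa> where "\<kappa> x = interval_measure (F x)" for x
  have \<kappa>: "real_distribution (\<kappa> x)" for x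
    unfolding \<kappa>_def by (rule real_distribution_interval_measure[OF F bot top])
  have em: "emeasure (\<kappa> x) {..t} = F x t" for x t
    unfolding \<kappa>_def by (rule emeasure_interval_measure_Iic[OF F bot])
  have atMost: "(borel :: real measure) = sigma UNIV (range atMost)"
    by (rule borel_eq_atMost)
  have \<kappa>meas: "\<kappa> \<in> M \<rightarrow>\<^sub>M prob_algebra borel"
  proof (rule measurable_prob_algebra_generated[where \<Omega>=UNIV and G="range atMost"])
    show "sets borel = sigma_sets UNIV (range atMost :: real set set)"
      by (subst atMost) simp
    show "prob_space (\<kappa> x)" "sets (\<kappa> x) = sets borel" for x
      using \<kappa>[of x] by (simp_all add: real_distribution_iff_prob_measures prob_measures_def)
  qed (auto simp: Int_stable_def em)
  show ?thesis
  proof (rule that[OF \<kappa>meas])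
    fix A :: "'a set" and B :: "real set"
    assume A[measurable]: "A \<in> sets M" and B: "B \<in> sets borel"
    have \<kappa>s[measurable]: "\<kappa> \<in> M \<rightarrow>\<^sub>M subprob_algebra borel" by (rule measurable_prob_algebraD[OF \<kappa>meas])
    have AP: "A \<times> C \<in> sets P" if "A \<in> sets M" "C \<in> sets borel" for A C using that by (simp add: setsP)
    have spP: "space P = space M \<times> UNIV"
      using sets_eq_imp_space_eq[OF setsP] by (simp add: space_pair_measure)
    define K where "K = density \<rho> (indicator A) \<bind> \<kappa>"
    define L where "L = distr (density P (indicator (A \<times> UNIV))) borel snd"
    have "space M \<noteq> {}" using \<rho>.not_empty by (simp add: \<rho>_def)
    have K: "emeasure K C = (\<integral>\<^sup>+x\<in>A. emeasure (\<kappa> x) C \<partial>\<rho>)" if "C \<in> sets borel" for C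
    proof -
      have [measurable]: "(\<lambda>x. emeasure (\<kappa> x) C) \<in> borel_measurable M"
        using that by measurable
      have "emeasure K C = (\<integral>\<^sup>+x. emeasure (\<kappa> x) C \<partial>density \<rho> (indicator A))"
        unfolding K_def using that \<open>space M \<noteq> {}\<close>
        by (intro emeasure_bind[where N=borel]) (auto simp: \<rho>_def)
      then show ?thesis by (simp add: nn_integral_density mult.commute)
    qed
    have L: "emeasure L C = emeasure P (A \<times> C)" if "C \<in> sets borel" for C
    proof -
      have "snd -` C \<inter> space P = space M \<times> C" by (auto simp: spP)
      moreover have "snd \<in> borel_measurable P" by (simp add: measurable_cong_sets[OF setsP refl])
      ultimately have "emeasure L C = emeasure (density P (indicator (A \<times> UNIV))) (space M \<times> C)"
        unfolding L_def using that by (subst emeasure_distr) auto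
      also have "\<dots> = (\<integral>\<^sup>+z. indicator (A \<times> UNIV) z * indicator (space M \<times> C) z \<partial>P)"
        using AP[OF A that] AP[OF A, of UNIV] AP[OF sets.top that]
        by (subst emeasure_density) (auto intro!: borel_measurable_indicator simp: setsP)
      also have "\<dots> = (\<integral>\<^sup>+z. indicator (A \<times> C) z \<partial>P)"
        using sets.sets_into_space[OF A] by (intro nn_integral_cong) (auto split: split_indicator)
      finally show ?thesis using AP[OF A that] by simp
    qed
    have KL: "emeasure K {..t} = emeasure L {..t}" for t
    proof -
      have "emeasure K {..t} = (\<integral>\<^sup>+x. ennreal (indicator A x * F x t) \<partial>\<rho>)"
        unfolding K[OF atMost_borel]
        by (intro nn_integral_cong) (simp add: em split: split_indicator)
      also have "\<dots> = ennreal (\<integral>x. indicator A x * F x t \<partial>\<rho>)"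
        using F01 by (intro nn_integral_eq_integral \<rho>.integrable_const_bound[where B=1])
          (auto split: split_indicator)
      also have "\<dots> = emeasure L {..t}"
        by (simp add: L FP P.emeasure_eq_measure)
      finally show ?thesis .
    qed
    have "K = L"
    proof (rule measure_eqI_generator_eq[where E="range atMost" and A="\<lambda>n. {..real n}" and \<Omega>=UNIV])
      have "sets K = sets borel" unfolding K_def
        using \<open>space M \<noteq> {}\<close> by (intro sets_bind sets_kernel[OF \<kappa>s]) (simp_all add: \<rho>_def)
      then show "sets K = sigma_sets UNIV (range atMost)" by (subst (asm) atMost) simp
      have "sets L = sets borel" by (simp add: L_def)
      then show "sets L = sigma_sets UNIV (range atMost)" by (subst (asm) atMost) simp
      show "(\<Union>i. {..real i}) = UNIV" by (auto simp: real_arch_simple)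
      show "emeasure K {..real i} \<noteq> \<infinity>" for i by (simp add: KL L P.emeasure_eq_measure)
    qed (auto simp: Int_stable_def KL)
    then show "emeasure P (A \<times> B) = (\<integral>\<^sup>+x\<in>A. emeasure (\<kappa> x) B \<partial>(distr P M fst))"
      using K[OF B] L[OF B] by (simp add: \<rho>_def)
  qed
qed

text \<open>The second coordinate is coded by reals, the coded plan is disintegrated on the line,
  and the resulting conditional laws are decoded. Existence is all that is needed, since
  \<open>disintegration\<close> is a choice among the disintegrations.\<close>

theorem is_disintegration_disintegration:
  fixes \<pi> :: "('x::polish_space \<times> 'y::polish_space) measure"
  assumes "compact (UNIV :: 'y set)" "\<pi> \<in> prob_measures"
  shows "is_disintegration \<pi> (disintegration \<pi>)"
proof -
  have sp: "sets \<pi> = sets borel" and "prob_space \<pi>" using assms by (auto simp: prob_measures_def)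
  have [measurable_cong]: "sets \<pi> = sets (borel \<Otimes>\<^sub>M borel)" unfolding sp borel_prod ..
  interpret prob_space \<pi> by fact
  obtain s :: "'y \<Rightarrow> real" and C \<phi> where s[measurable]: "s \<in> borel_measurable borel" and s02: "\<And>x. 0 \<le> s x \<and> s x \<le> 2"
    and C: "closed C" "range s \<subseteq> C" and \<phi>: "continuous_on C \<phi>" "\<And>x. \<phi> (s x) = x"
    by (rule real_coding[OF assms(1)], rule that)
  define \<psi> where "\<psi> x = (if x \<in> C then \<phi> x else undefined)" for x
  have [measurable]: "C \<in> sets borel" using C by (simp add: borel_closed)
  have \<psi>[measurable]: "\<psi> \<in> borel \<rightarrow>\<^sub>M borel"
    unfolding \<psi>_def using \<phi>(1) by (intro borel_measurable_continuous_on_if C) auto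
  have \<psi>s: "\<psi> (s y) = y" for y using C \<phi> by (auto simp: \<psi>_def)
  define T where "T z = (fst z :: 'x, s (snd z))" for z
  have T[measurable]: "T \<in> \<pi> \<rightarrow>\<^sub>M borel \<Otimes>\<^sub>M borel"
    unfolding T_def by measurable
  define P where "P = distr \<pi> (borel \<Otimes>\<^sub>M borel) T"
  have P: "prob_space P" unfolding P_def by (rule prob_space_distr) measurable
  have bnd: "AE z in P. 0 \<le> snd z \<and> snd z \<le> 2"
    unfolding P_def by (subst AE_distr_iff) (auto simp: T_def s02)
  obtain \<kappa> where \<kappa>: "\<kappa> \<in> borel \<rightarrow>\<^sub>M prob_algebra borel"
    and em: "\<And>A B. A \<in> sets borel \<Longrightarrow> B \<in> sets borel \<Longrightarrow>
       emeasure P (A \<times> B) = (\<integral>\<^sup>+x\<in>A. emeasure (\<kappa> x) B \<partial>(distr P borel fst))"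
    by (rule regular_conditional_distribution[OF P _ bnd, of borel]) (simp add: P_def, rule that)
  have marg: "distr P borel fst = marg1 \<pi>"
    unfolding P_def marg1_def by (subst distr_distr) (auto simp: T_def comp_def)
  have "is_disintegration \<pi> (\<lambda>x. distr (\<kappa> x) borel \<psi>)"
    unfolding is_disintegration_def
  proof (intro conjI ballI)
    show "(\<lambda>x. distr (\<kappa> x) borel \<psi>) \<in> borel \<rightarrow>\<^sub>M prob_algebra borel"
      by (rule measurable_compose[OF \<kappa> measurable_distr_prob_space]) measurable
    fix A :: "'x set" and B :: "'y set" assume [measurable]: "A \<in> sets borel" "B \<in> sets borel"
    have pB: "\<psi> -` B \<in> sets borel" using measurable_sets[OF \<psi>, of B] by simp
    have "emeasure P (A \<times> \<psi> -` B) = emeasure \<pi> (T -` (A \<times> \<psi> -` B) \<inter> space \<pi>)"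
      unfolding P_def using pB by (subst emeasure_distr) auto
    \<comment> \<open>The values of \<open>\<psi>\<close> off \<open>C\<close> do not matter here:
      \<open>T\<close> produces only genuine codes, and these are decoded exactly.\<close>
    also have "T -` (A \<times> \<psi> -` B) \<inter> space \<pi> = A \<times> B"
      using sets_eq_imp_space_eq[OF sp] by (auto simp: T_def \<psi>s)
    finally have "emeasure \<pi> (A \<times> B) = (\<integral>\<^sup>+x\<in>A. emeasure (\<kappa> x) (\<psi> -` B) \<partial>marg1 \<pi>)"
      using em[of A "\<psi> -` B"] pB by (simp add: marg)
    moreover have "emeasure (\<kappa> x) (\<psi> -` B) = emeasure (distr (\<kappa> x) borel \<psi>) B" for x
    proof -
      have "sets (\<kappa> x) = sets borel" using measurable_space[OF \<kappa>, of x] by (simp add: space_prob_algebra)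
      then show ?thesis
        using sets_eq_imp_space_eq[of "\<kappa> x" borel]
        by (subst emeasure_distr) (auto simp: measurable_cong_sets[of "\<kappa> x" borel])
    qed
    ultimately show "emeasure \<pi> (A \<times> B) = (\<integral>\<^sup>+x\<in>A. emeasure (distr (\<kappa> x) borel \<psi>) B \<partial>marg1 \<pi>)"
      by simp
  qed
  then show ?thesis unfolding disintegration_def by (rule someI[where P="is_disintegration \<pi>"])
qed

subsection \<open>Extended integrals\<close>

lemma ext_integral_real:
  assumes "integrable M f"
  shows "ext_integral M (\<lambda>x. ereal (f x)) = ereal (\<integral>x. f x \<partial>M)"
proof -
  have P: "(\<integral>\<^sup>+x. ennreal (f x) \<partial>M) \<noteq> \<infinity>" and N: "(\<integral>\<^sup>+x. ennreal (- f x) \<partial>M) \<noteq> \<infinity>"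
    using assms by (auto simp: real_integrable_def)
  have "enn2ereal p = ereal (enn2real p)" if "p \<noteq> \<infinity>" for p
    using that by (cases p) auto
  then show ?thesis
    using P N by (simp add: ext_integral_def Let_def real_lebesgue_integral_def[OF assms])
qed

text \<open>Monotonicity survives the convention for \<infinity> - \<infinity>: if the negative part
  of \<open>g\<close> has infinite integral, so does that of \<open>f\<close>, and then the integral
  of \<open>f\<close> is - \<infinity> whether or not its positive part is finite. Measurability is
  not assumed, so the lemma applies to \<open>Kc c f\<close>.\<close>

lemma ext_integral_mono_AE:
  assumes "AE x in M. f x \<le> g x"
  shows "ext_integral M f \<le> ext_integral M g"
proof -
  let ?P = "\<lambda>f. \<integral>\<^sup>+x. e2ennreal (f x) \<partial>M" and ?N = "\<lambda>f. \<integral>\<^sup>+x. e2ennreal (- f x) \<partial>M"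
  have P: "?P f \<le> ?P g"
    using assms by (intro nn_integral_mono_AE, eventually_elim) (rule e2ennreal_mono)
  have N: "?N g \<le> ?N f"
    using assms by (intro nn_integral_mono_AE, eventually_elim) (simp add: e2ennreal_mono)
  have "enn2ereal (?P f) - enn2ereal (?N f) \<le> enn2ereal (?P g) - enn2ereal (?N g)"
    using P N by (intro ereal_minus_mono) (simp_all add: less_eq_ennreal.rep_eq)
  moreover have "?N f = \<infinity>" if "?N g = \<infinity>" using N that by (simp add: top_unique)
  ultimately show ?thesis
    by (cases "?P f") (auto simp: ext_integral_def Let_def)
qed

lemma ext_integral_cong_AE:
  assumes "AE x in M. f x = g x"
  shows "ext_integral M f = ext_integral M g"
  using assms by (intro antisym ext_integral_mono_AE) (auto elim: eventually_mono)

text \<open>The integrable minorant makes the negative part finite, so a value below \<infinity> can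
  only mean that the positive part is finite too.\<close>

lemma integrable_if_ext_integral_less_PInf:
  assumes f [measurable]: "f \<in> borel_measurable M" and g: "integrable M g" "AE x in M. g x \<le> f x"
    and less: "ext_integral M (\<lambda>x. ereal (f x)) < \<infinity>"
  shows "integrable M f"
proof -
  have "(\<integral>\<^sup>+x. ennreal (- f x) \<partial>M) \<le> (\<integral>\<^sup>+x. ennreal (- g x) \<partial>M)"
    using g(2) by (intro nn_integral_mono_AE, eventually_elim) (simp add: ennreal_leI)
  also have "\<dots> < \<infinity>" using g(1) by (simp add: real_integrable_def less_top)
  finally have N: "(\<integral>\<^sup>+x. ennreal (- f x) \<partial>M) < \<infinity>" .
  then have "(\<integral>\<^sup>+x. ennreal (f x) \<partial>M) \<noteq> \<infinity>"
    using less by (cases "\<integral>\<^sup>+x. ennreal (- f x) \<partial>M") (auto simp: ext_integral_def Let_def)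
  with N show ?thesis by (simp add: real_integrable_def less_top)
qed

text \<open>Positive parts converge monotonically, negative parts by domination with the integrable
  negative part of \<open>U 0\<close>. The limit of the negative parts is thus finite and no
  \<infinity> - \<infinity> arises.\<close>

lemma ext_integral_monotone_convergence:
  assumes U: "\<And>n. integrable M (U n)" and mono: "\<And>n x. U n x \<le> U (Suc n) x"
  shows "(\<lambda>n. ereal (\<integral>x. U n x \<partial>M)) \<longlonglongrightarrow> ext_integral M (\<lambda>x. SUP n. ereal (U n x))"
proof -
  have [measurable]: "U n \<in> borel_measurable M" for n using U by auto
  have inc: "incseq (\<lambda>n. ereal (U n x))" for x
    by (rule incseq_SucI) (simp add: mono)
  then have lim: "(\<lambda>n. ereal (U n x)) \<longlonglongrightarrow> (SUP n. ereal (U n x))" for x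
    by (rule LIMSEQ_SUP)
  have limP: "(\<lambda>n. ennreal (U n x)) \<longlonglongrightarrow> e2ennreal (SUP n. ereal (U n x))" for x
    using tendsto_e2ennrealI[OF lim[of x]] by simp
  have limN: "(\<lambda>n. ennreal (- U n x)) \<longlonglongrightarrow> e2ennreal (- (SUP n. ereal (U n x)))" for x
    using tendsto_e2ennrealI[OF tendsto_uminus_ereal[OF lim[of x]]] by simp
  define P where "P = (\<integral>\<^sup>+x. e2ennreal (SUP n. ereal (U n x)) \<partial>M)"
  define N where "N = (\<integral>\<^sup>+x. e2ennreal (- (SUP n. ereal (U n x))) \<partial>M)"
  have P: "(\<lambda>n. \<integral>\<^sup>+x. ennreal (U n x) \<partial>M) \<longlonglongrightarrow> P"
    unfolding P_def
    by (rule nn_integral_LIMSEQ) (use inc limP in \<open>auto simp: incseq_def le_fun_def intro!: ennreal_leI\<close>)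
  have 0: "(\<integral>\<^sup>+x. ennreal (- U 0 x) \<partial>M) < \<infinity>"
    using U[of 0] by (simp add: real_integrable_def less_top)
  have le0: "ennreal (- U n x) \<le> ennreal (- U 0 x)" for n x
    using inc[of x] by (intro ennreal_leI) (simp add: incseq_def)
  have N: "(\<lambda>n. \<integral>\<^sup>+x. ennreal (- U n x) \<partial>M) \<longlonglongrightarrow> N"
    unfolding N_def
    by (rule nn_integral_dominated_convergence[where w="\<lambda>x. ennreal (- U 0 x)"])
       (use 0 le0 limN in auto)
  have "N \<le> (\<integral>\<^sup>+x. ennreal (- U 0 x) \<partial>M)"
    using le0 by (intro LIMSEQ_le_const2[OF N]) (auto intro!: nn_integral_mono)
  then have Nfin: "N < \<infinity>" using 0 by (rule le_less_trans)
  have "(\<lambda>n. enn2ereal (\<integral>\<^sup>+x. ennreal (U n x) \<partial>M) - enn2ereal (\<integral>\<^sup>+x. ennreal (- U n x) \<partial>M))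
      \<longlonglongrightarrow> enn2ereal P - enn2ereal N"
    unfolding minus_ereal_def using P N Nfin
    by (intro tendsto_add_ereal_general tendsto_uminus_ereal tendsto_enn2erealI) (auto simp: enn2ereal_eq_top_iff)
  moreover have "ereal (\<integral>x. U n x \<partial>M) =
      enn2ereal (\<integral>\<^sup>+x. ennreal (U n x) \<partial>M) - enn2ereal (\<integral>\<^sup>+x. ennreal (- U n x) \<partial>M)" for n
    using U[of n] ext_integral_real[OF U[of n]] by (simp add: ext_integral_def Let_def real_integrable_def)
  ultimately show ?thesis
    using less_imp_neq[OF Nfin] by (simp add: ext_integral_def Let_def P_def[symmetric] N_def[symmetric])
qed

subsection \<open>Lebesgue decomposition\<close>

text \<open>Take the density \<open>f\<close> of \<open>\<mu>\<close> with respect to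
  \<open>\<mu> + \<rho>\<close>. The singular part is \<open>\<rho>\<close> on the zero set
  \<open>N\<close> of \<open>f\<close>: this set is \<open>\<mu>\<close>-null, and off
  \<open>N\<close>, where \<open>f\<close> is positive, every \<open>\<mu>\<close>-null set is null
  for the sum and hence for \<open>\<rho>\<close>.\<close>

lemma lebesgue_decomposition_exists:
  assumes \<mu>: "finite_measure \<mu>" and \<rho>: "finite_measure \<rho>" and s [measurable_cong]: "sets \<rho> = sets \<mu>"
  shows "\<exists>\<alpha> \<sigma>. is_lebesgue_decomposition \<mu> \<rho> \<alpha> \<sigma>"
proof -
  interpret \<mu>: finite_measure \<mu> by fact
  define M where "M = add_measure \<mu> \<rho>"
  have M: "emeasure M A = emeasure \<mu> A + emeasure \<rho> A" if "A \<in> sets \<mu>" for A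
    unfolding M_def using that s by (simp add: emeasure_add_measure)
  have sM[measurable_cong]: "sets M = sets \<mu>" by (simp add: M_def)
  interpret M: finite_measure M unfolding M_def by (rule finite_measure_add_measure[OF \<mu> \<rho> s])
  have "absolutely_continuous M \<mu>"
    using M by (auto simp: absolutely_continuous_def null_sets_def sM)
  from M.Radon_Nikodym_finite_measure[OF \<mu> sM[symmetric] this]
  obtain f where f[measurable]: "f \<in> borel_measurable M" and d: "density M f = \<mu>" by blast
  have spM: "space M = space \<mu>" by (simp add: M_def)
  define N where "N = {x \<in> space \<mu>. f x = 0}"
  have N[measurable]: "N \<in> sets \<mu>" unfolding N_def by measurable
  have em\<mu>: "emeasure \<mu> A = (\<integral>\<^sup>+x. f x * indicator A x \<partial>M)" if [measurable]: "A \<in> sets \<mu>" for A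
    by (subst d[symmetric]) (simp add: emeasure_density)
  have "emeasure \<mu> N = 0"
    unfolding em\<mu>[OF N] by (subst nn_integral_0_iff_AE) (auto simp: N_def indicator_def)
  moreover have "absolutely_continuous \<mu> (density \<rho> (indicator (space \<mu> - N)))"
    unfolding absolutely_continuous_def
  proof
    fix A assume A: "A \<in> null_sets \<mu>"
    then have [measurable]: "A \<in> sets \<mu>" by auto
    have "(\<integral>\<^sup>+x. f x * indicator A x \<partial>M) = 0" using A by (simp add: em\<mu>[symmetric] null_setsD1)
    then have "AE x in M. f x * indicator A x = 0" by (subst (asm) nn_integral_0_iff_AE) auto
    then have "AE x in M. x \<notin> A - N"
      using AE_space by eventually_elim (auto simp: N_def spM split: split_indicator_asm)
    then have "emeasure M (A - N) = 0" by (subst AE_iff_measurable[symmetric]) (use sets.sets_into_space[OF \<open>A \<in> sets \<mu>\<close>] in \<open>auto simp: spM\<close>)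
    then have "emeasure \<rho> (A - N) = 0" by (simp add: M)
    moreover have "emeasure (density \<rho> (indicator (space \<mu> - N))) A = emeasure \<rho> (A - N)"
    proof -
      have "emeasure (density \<rho> (indicator (space \<mu> - N))) A = (\<integral>\<^sup>+x. indicator (A - N) x \<partial>\<rho>)"
        using sets.sets_into_space[OF \<open>A \<in> sets \<mu>\<close>]
        by (subst emeasure_density, measurable, intro nn_integral_cong) (auto split: split_indicator)
      then show ?thesis by simp
    qed
    ultimately show "A \<in> null_sets (density \<rho> (indicator (space \<mu> - N)))" by (auto simp: s)
  qed
  moreover have "emeasure (density \<rho> (indicator N)) (space \<mu> - N) = 0"
    by (subst emeasure_density) (auto intro!: nn_integral_zero' split: split_indicator)
  moreover have "emeasure \<rho> A = emeasure (density \<rho> (indicator (space \<mu> - N))) A + emeasure (density \<rho> (indicator N)) A"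
    if [measurable]: "A \<in> sets \<mu>" for A
  proof -
    have "emeasure \<rho> A = (\<integral>\<^sup>+x. indicator A x \<partial>\<rho>)" by simp
    also have "\<dots> = (\<integral>\<^sup>+x. indicator (space \<mu> - N) x * indicator A x + indicator N x * indicator A x \<partial>\<rho>)"
      using sets_eq_imp_space_eq[OF s] by (intro nn_integral_cong) (auto split: split_indicator)
    finally show ?thesis by (simp add: nn_integral_add emeasure_density)
  qed
  ultimately show ?thesis unfolding is_lebesgue_decomposition_def
    by (intro exI[of _ "density \<rho> (indicator (space \<mu> - N))"] exI[of _ "density \<rho> (indicator N)"])
       (auto simp: s)
qed

text \<open>With \<open>N\<close> and \<open>N'\<close> the null sets carrying the two singular
  parts, either decomposition has to be \<open>\<rho>\<close> restricted to the complement of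
  \<open>N \<union> N'\<close> and to \<open>N \<union> N'\<close>, so the two coincide.\<close>

lemma lebesgue_decomposition_unique:
  assumes 1: "is_lebesgue_decomposition \<mu> \<rho> \<alpha> \<sigma>" and 2: "is_lebesgue_decomposition \<mu> \<rho> \<alpha>' \<sigma>'"
  shows "\<alpha> = \<alpha>' \<and> \<sigma> = \<sigma>'"
proof -
  obtain N where N[measurable]: "N \<in> sets \<mu>" "emeasure \<mu> N = 0" "emeasure \<sigma> (space \<mu> - N) = 0"
    using 1 by (auto simp: is_lebesgue_decomposition_def)
  obtain N' where N'[measurable]: "N' \<in> sets \<mu>" "emeasure \<mu> N' = 0" "emeasure \<sigma>' (space \<mu> - N') = 0"
    using 2 by (auto simp: is_lebesgue_decomposition_def)
  have *: "emeasure \<beta> A = emeasure \<rho> (A - (N \<union> N')) \<and> emeasure \<tau> A = emeasure \<rho> (A \<inter> (N \<union> N'))"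
    if d: "is_lebesgue_decomposition \<mu> \<rho> \<beta> \<tau>" and K: "K \<in> sets \<mu>" "emeasure \<tau> (space \<mu> - K) = 0" "K \<subseteq> N \<union> N'"
      and A: "A \<in> sets \<mu>" for \<beta> \<tau> K A
  proof -
    have s: "sets \<beta> = sets \<mu>" "sets \<tau> = sets \<mu>" using d by (auto simp: is_lebesgue_decomposition_def)
    have sum: "emeasure \<rho> B = emeasure \<beta> B + emeasure \<tau> B" if "B \<in> sets \<mu>" for B
      using d that by (auto simp: is_lebesgue_decomposition_def)
    have "N \<union> N' \<in> null_sets \<mu>" using N N' by (intro null_sets.Un) auto
    then have "N \<union> N' \<in> null_sets \<beta>" using d by (auto simp: is_lebesgue_decomposition_def absolutely_continuous_def)
    then have b0: "A \<inter> (N \<union> N') \<in> null_sets \<beta>" using A s by (intro null_set_Int1) auto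
    have "space \<mu> - K \<in> null_sets \<tau>" using K s by auto
    then have t0: "A - (N \<union> N') \<in> null_sets \<tau>"
    proof (rule null_sets_subset)
      show "A - (N \<union> N') \<in> sets \<tau>" unfolding s(2) using A N N' by (intro sets.Diff sets.Un)
      show "A - (N \<union> N') \<subseteq> space \<mu> - K" using K(3) sets.sets_into_space[OF A] by blast
    qed
    have "emeasure \<beta> (A - (N \<union> N')) = emeasure \<beta> (A - (A \<inter> (N \<union> N')))" by (rule arg_cong[where f="emeasure \<beta>"]) auto
    also have "\<dots> = emeasure \<beta> A" using b0 A s by (intro emeasure_Diff_null_set) auto
    finally have b: "emeasure \<beta> (A - (N \<union> N')) = emeasure \<beta> A" .
    have "emeasure \<tau> (A \<inter> (N \<union> N')) = emeasure \<tau> (A - (A - (N \<union> N')))" by (rule arg_cong[where f="emeasure \<tau>"]) auto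
    also have "\<dots> = emeasure \<tau> A" using t0 A s by (intro emeasure_Diff_null_set) auto
    finally have t: "emeasure \<tau> (A \<inter> (N \<union> N')) = emeasure \<tau> A" .
    show ?thesis using A N N' b t b0 t0 by (simp add: sum null_setsD1)
  qed
  have s: "sets \<alpha> = sets \<mu>" "sets \<sigma> = sets \<mu>" "sets \<alpha>' = sets \<mu>" "sets \<sigma>' = sets \<mu>"
    using 1 2 by (auto simp: is_lebesgue_decomposition_def)
  note *[OF 1 N(1,3) Un_upper1] *[OF 2 N'(1,3) Un_upper2]
  then show ?thesis by (intro conjI measure_eqI) (simp_all only: s)
qed

lemma is_lebesgue_decomposition_parts:
  assumes "finite_measure \<mu>" "finite_measure \<rho>" "sets \<rho> = sets \<mu>"
  shows "is_lebesgue_decomposition \<mu> \<rho> (ac_part \<mu> \<rho>) (sing_part \<mu> \<rho>)"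
proof -
  obtain \<alpha> \<sigma> where d: "is_lebesgue_decomposition \<mu> \<rho> \<alpha> \<sigma>"
    using lebesgue_decomposition_exists[OF assms] by blast
  have "ac_part \<mu> \<rho> = \<alpha>" "sing_part \<mu> \<rho> = \<sigma>"
    unfolding ac_part_def sing_part_def
    using d by (auto intro!: the_equality dest: lebesgue_decomposition_unique[OF d])
  with d show ?thesis by simp
qed

subsection \<open>Integrals of plans\<close>

text \<open>The defining identity on rectangles says that \<open>\<pi>\<close> is the mixture, over
  its first marginal, of the images \<open>k x\<close> of \<open>\<kappa> x\<close> under
  \<open>Pair x\<close>; the integral formula is then the one for mixtures.\<close>

lemma disintegration_integral:
  fixes \<pi> :: "('x::second_countable_topology \<times> 'y::second_countable_topology) measure"
    and g :: "'x \<times> 'y \<Rightarrow> real"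
  assumes d: "is_disintegration \<pi> \<kappa>" and \<pi>: "\<pi> \<in> prob_measures"
    and g: "g \<in> borel_measurable borel" "\<And>z. \<bar>g z\<bar> \<le> B"
  shows "(\<integral>z. g z \<partial>\<pi>) = (\<integral>x. (\<integral>y. g (x, y) \<partial>\<kappa> x) \<partial>marg1 \<pi>)"
proof -
  have \<kappa>: "\<kappa> \<in> borel \<rightarrow>\<^sub>M prob_algebra borel" using d by (simp add: is_disintegration_def)
  have \<kappa>s[measurable]: "\<kappa> \<in> borel \<rightarrow>\<^sub>M subprob_algebra borel" by (rule measurable_prob_algebraD[OF \<kappa>])
  have s\<pi>: "sets \<pi> = sets borel" and "prob_space \<pi>" using \<pi> by (auto simp: prob_measures_def)
  interpret prob_space \<pi> by fact
  have fst[measurable]: "fst \<in> borel_measurable \<pi>"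
    using borel_measurable_continuous_onI[OF continuous_on_fst[OF continuous_on_id]]
    by (simp add: measurable_cong_sets[OF s\<pi> refl])
  interpret m: prob_space "marg1 \<pi>" unfolding marg1_def by (rule prob_space_distr) measurable
  have sm[measurable_cong]: "sets (marg1 \<pi>) = sets borel" by (simp add: marg1_def)
  have \<kappa>x: "sets (\<kappa> x) = sets borel" "prob_space (\<kappa> x)" for x
    using measurable_space[OF \<kappa>, of x] by (simp_all add: space_prob_algebra)
  define k where "k x = distr (\<kappa> x) (borel \<Otimes>\<^sub>M borel) (Pair x)" for x
  have Pair[measurable]: "Pair x \<in> \<kappa> x \<rightarrow>\<^sub>M borel \<Otimes>\<^sub>M borel" for x
    by (simp add: measurable_cong_sets[OF \<kappa>x(1) refl])
  have k[measurable]: "k \<in> marg1 \<pi> \<rightarrow>\<^sub>M subprob_algebra (borel \<Otimes>\<^sub>M borel)"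
    unfolding k_def by (rule measurable_distr2[where M=borel]) measurable
  have ne: "space (marg1 \<pi>) \<noteq> {}" by (rule m.not_empty)
  have \<pi>_eq: "\<pi> = marg1 \<pi> \<bind> k"
  proof (rule measure_eqI_generator_eq)
    let ?E = "{A \<times> B | A B. A \<in> sets (borel :: 'x measure) \<and> B \<in> sets (borel :: 'y measure)}"
    show "Int_stable ?E" by (rule Int_stable_pair_measure_generator)
    show "sets \<pi> = sigma_sets UNIV ?E"
      unfolding s\<pi> borel_prod[symmetric] by (simp add: sets_pair_measure)
    have "sets (marg1 \<pi> \<bind> k) = sets (borel \<Otimes>\<^sub>M borel)"
      by (rule sets_bind[OF _ ne]) (simp add: k_def)
    then show "sets (marg1 \<pi> \<bind> k) = sigma_sets UNIV ?E" by (simp add: sets_pair_measure)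
    show "range (\<lambda>_::nat. UNIV) \<subseteq> ?E" by (auto intro!: exI[of _ UNIV])
    show "emeasure \<pi> UNIV \<noteq> \<infinity>" for i :: nat by (simp add: emeasure_eq_measure)
    fix X assume "X \<in> ?E"
    then obtain A B where X: "X = A \<times> B" "A \<in> sets borel" "B \<in> sets borel" by auto
    have "emeasure (marg1 \<pi> \<bind> k) X = (\<integral>\<^sup>+x. emeasure (k x) X \<partial>marg1 \<pi>)"
      using X by (intro emeasure_bind[OF ne k]) auto
    also have "\<dots> = (\<integral>\<^sup>+x\<in>A. emeasure (\<kappa> x) B \<partial>marg1 \<pi>)"
    proof (rule nn_integral_cong)
      fix x
      have "emeasure (k x) X = emeasure (\<kappa> x) (Pair x -` (A \<times> B) \<inter> space (\<kappa> x))"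
        unfolding k_def X using X by (intro emeasure_distr) auto
      also have "Pair x -` (A \<times> B) \<inter> space (\<kappa> x) = (if x \<in> A then B else {})"
        using sets_eq_imp_space_eq[OF \<kappa>x(1)] by auto
      finally show "emeasure (k x) X = emeasure (\<kappa> x) B * indicator A x" by simp
    qed
    finally show "emeasure \<pi> X = emeasure (marg1 \<pi> \<bind> k) X"
      using d X by (simp add: is_disintegration_def)
  qed auto
  have g': "g \<in> borel_measurable (borel \<Otimes>\<^sub>M borel)" using g by (simp add: borel_prod)
  have "AE x in marg1 \<pi>. emeasure (k x) (space (k x)) \<le> ennreal 1"
    using prob_space.emeasure_space_1[OF prob_space.prob_space_distr[OF \<kappa>x(2) Pair]] by (simp add: k_def)
  then have "(\<integral>z. g z \<partial>(marg1 \<pi> \<bind> k)) = (\<integral>x. (\<integral>z. g z \<partial>k x) \<partial>marg1 \<pi>)"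
    using g by (intro integral_bind[OF g' _ k m.finite_measure_axioms, where B'=1]) auto
  also have "\<dots> = (\<integral>x. (\<integral>y. g (x, y) \<partial>\<kappa> x) \<partial>marg1 \<pi>)"
    unfolding k_def using g' by (subst integral_distr) auto
  finally show ?thesis using \<pi>_eq by simp
qed

lemma integral_scale_measure:
  fixes f :: "'a \<Rightarrow> real"
  assumes f [measurable]: "f \<in> borel_measurable M" and "0 \<le> r"
  shows "(\<integral>x. f x \<partial>scale_measure (ennreal r) M) = r * (\<integral>x. f x \<partial>M)"
proof -
  have "scale_measure (ennreal r) M = density M (\<lambda>_. ennreal r)"
    by (rule measure_eqI) (simp_all add: emeasure_density nn_integral_cmult_indicator)
  then show ?thesis using assms by (simp add: integral_density)
qed

subsection \<open>A finite minimax theorem\<close>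

text \<open>If the claim fails, the convex set \<open>S\<close> of value pairs misses the quadrant
  \<open>Q\<close>, and a hyperplane separates them. Normalizing its normal vector to a convex
  combination gives a mixture of \<open>g\<close> and \<open>h\<close> whose value on all of
  \<open>K\<close> is at least \<open>u\<close>, against hypothesis \<open>t\<close>. Convexity of
  \<open>K\<close> and \<open>G\<close> is expressed through values of \<open>L\<close> alone, so
  neither plans nor minorants have to form a vector space.\<close>

lemma two_function_minimax:
  fixes L :: "'p \<Rightarrow> 'g \<Rightarrow> real"
  assumes K: "\<And>p q s. p \<in> K \<Longrightarrow> q \<in> K \<Longrightarrow> 0 \<le> s \<Longrightarrow> s \<le> 1 \<Longrightarrow>
      \<exists>r\<in>K. \<forall>g\<in>G. L r g = (1 - s) * L p g + s * L q g"
    and G: "\<And>g h s. g \<in> G \<Longrightarrow> h \<in> G \<Longrightarrow> 0 \<le> s \<Longrightarrow> s \<le> 1 \<Longrightarrow>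
      \<exists>k\<in>G. \<forall>p\<in>K. L p k = (1 - s) * L p g + s * L p h"
    and t: "\<And>g. g \<in> G \<Longrightarrow> \<exists>p\<in>K. L p g \<le> t" and gh: "g \<in> G" "h \<in> G" and "t < u"
  shows "\<exists>p\<in>K. L p g \<le> u \<and> L p h \<le> u"
proof (rule ccontr)
  assume neg: "\<not> (\<exists>p\<in>K. L p g \<le> u \<and> L p h \<le> u)"
  define S where "S = (\<lambda>p. (L p g, L p h)) ` K"
  define Q where "Q = {..u} \<times> {..u}"
  have "convex S"
    unfolding convex_alt
  proof (intro ballI allI impI)
    fix x y :: "real \<times> real" and s :: real assume "x \<in> S" "y \<in> S" and s: "0 \<le> s \<and> s \<le> 1"
    then obtain p q where p: "p \<in> K" "x = (L p g, L p h)" and q: "q \<in> K" "y = (L q g, L q h)"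
      by (auto simp: S_def)
    obtain r where "r \<in> K" "\<forall>g\<in>G. L r g = (1 - s) * L p g + s * L q g"
      using K[OF p(1) q(1)] s by blast
    then show "(1 - s) *\<^sub>R x + s *\<^sub>R y \<in> S"
      using gh by (auto simp: S_def p q intro!: image_eqI[of _ _ r])
  qed
  moreover have "convex Q" unfolding Q_def by (intro convex_Times) auto
  moreover have "S \<noteq> {}" using t[OF gh(1)] by (auto simp: S_def)
  moreover have "Q \<noteq> {}" by (auto simp: Q_def)
  moreover have "Q \<inter> S = {}" using neg by (auto simp: Q_def S_def)
  ultimately obtain a b where "a \<noteq> 0" and a: "\<And>x. x \<in> Q \<Longrightarrow> inner a x \<le> b" "\<And>x. x \<in> S \<Longrightarrow> b \<le> inner a x"
    using separating_hyperplane_sets[of Q S] by blast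
  obtain \<alpha> \<beta> where ab: "a = (\<alpha>, \<beta>)" by (cases a)
  have Q: "\<alpha> * v + \<beta> * w \<le> b" if "v \<le> u" "w \<le> u" for v w
    using a(1)[of "(v, w)"] that by (simp add: Q_def ab)
  \<comment> \<open>The quadrant is unbounded below in each coordinate, so a functional bounded
    above on it has nonnegative coefficients. For negative \<open>x\<close> the chosen
    \<open>v\<close> makes \<open>x * v\<close> at least \<open>d + 1\<close>.\<close>
  have nonneg: "0 \<le> x" if le: "\<And>v. v \<le> u \<Longrightarrow> x * v \<le> d" for x d :: real
  proof (rule ccontr)
    assume "\<not> 0 \<le> x"
    then have x: "x < 0" by simp
    define v where "v = min u ((d + 1) / x)"
    have "d + 1 \<le> x * v"
    proof -
      have "v \<le> (d + 1) / x" by (simp add: v_def)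
      then have "x * ((d + 1) / x) \<le> x * v" using x by (intro mult_left_mono_neg) auto
      then show ?thesis using x by simp
    qed
    moreover have "x * v \<le> d" by (rule le) (simp add: v_def)
    ultimately show False by simp
  qed
  have "0 \<le> \<alpha>" by (rule nonneg[of _ "b - \<beta> * u"]) (use Q[of _ u] in \<open>simp add: algebra_simps\<close>)
  moreover have "0 \<le> \<beta>" by (rule nonneg[of _ "b - \<alpha> * u"]) (use Q[of u] in \<open>simp add: algebra_simps\<close>)
  ultimately have pos: "0 < \<alpha> + \<beta>" using \<open>a \<noteq> 0\<close> ab by (auto simp: zero_prod_def)
  define s where "s = \<beta> / (\<alpha> + \<beta>)"
  have s: "0 \<le> s" "s \<le> 1" "1 - s = \<alpha> / (\<alpha> + \<beta>)"
    using pos \<open>0 \<le> \<alpha>\<close> \<open>0 \<le> \<beta>\<close> by (auto simp: s_def field_simps)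
  obtain k where k: "k \<in> G" "\<forall>p\<in>K. L p k = (1 - s) * L p g + s * L p h"
    using G[OF gh s(1,2)] by blast
  obtain p where p: "p \<in> K" "L p k \<le> t" using t[OF k(1)] by blast
  have "(\<alpha> + \<beta>) * u \<le> b" using Q[of u u] by (simp add: algebra_simps)
  also have "b \<le> \<alpha> * L p g + \<beta> * L p h"
    using a(2)[of "(L p g, L p h)"] p by (auto simp: S_def ab)
  also have "\<dots> = (\<alpha> + \<beta>) * L p k"
  proof -
    have "(\<alpha> + \<beta>) * (1 - s) = \<alpha>" "(\<alpha> + \<beta>) * s = \<beta>" using pos unfolding s(3) by (auto simp: s_def)
    then have "\<alpha> * L p g + \<beta> * L p h = (\<alpha> + \<beta>) * ((1 - s) * L p g + s * L p h)"
      by (simp only: distrib_left mult.assoc[symmetric])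
    then show ?thesis using k(2) p(1) by simp
  qed
  also have "\<dots> \<le> (\<alpha> + \<beta>) * t" using p pos by (intro mult_left_mono) auto
  finally show False using pos \<open>t < u\<close> by simp
qed

text \<open>Each inserted function is absorbed by shrinking \<open>K\<close> to the sublevel set
  \<open>K'\<close> where it is at most \<open>v\<close>. The two-function case shows that every
  \<open>g\<close> still has a point of \<open>K'\<close> with value at most \<open>v\<close>, so
  the induction hypothesis applies to \<open>K'\<close> and \<open>v\<close>. Hence \<open>K\<close>
  and \<open>t\<close> are generalized, and \<open>v\<close> is the midpoint of \<open>t\<close> and
  \<open>u\<close> so that strict slack remains at every stage.\<close>

theorem finite_minimax:
  fixes L :: "'p \<Rightarrow> 'g \<Rightarrow> real"
  assumes "finite F" "F \<subseteq> G" "G \<noteq> {}"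
    and K: "\<And>p q s. p \<in> K \<Longrightarrow> q \<in> K \<Longrightarrow> 0 \<le> s \<Longrightarrow> s \<le> 1 \<Longrightarrow>
      \<exists>r\<in>K. \<forall>g\<in>G. L r g = (1 - s) * L p g + s * L q g"
    and G: "\<And>g h s. g \<in> G \<Longrightarrow> h \<in> G \<Longrightarrow> 0 \<le> s \<Longrightarrow> s \<le> 1 \<Longrightarrow>
      \<exists>k\<in>G. \<forall>p\<in>K. L p k = (1 - s) * L p g + s * L p h"
    and t: "\<And>g. g \<in> G \<Longrightarrow> \<exists>p\<in>K. L p g \<le> t" and "t < u"
  shows "\<exists>p\<in>K. \<forall>g\<in>F. L p g \<le> u"
  using assms
proof (induction F arbitrary: K t rule: finite_induct)
  case empty
  then show ?case by blast
next
  case (insert h F)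
  define v where "v = (t + u) / 2"
  have v: "t < v" "v < u" using \<open>t < u\<close> by (auto simp: v_def)
  define K' where "K' = {p \<in> K. L p h \<le> v}"
  have "\<exists>p\<in>K'. \<forall>g\<in>F. L p g \<le> u"
  proof (rule insert.IH[OF _ _ _ _ _ \<open>v < u\<close>])
    fix p q s assume pq: "p \<in> K'" "q \<in> K'" and s: "0 \<le> s" "s \<le> (1::real)"
    then obtain r where r: "r \<in> K" "\<forall>g\<in>G. L r g = (1 - s) * L p g + s * L q g"
      using insert.prems(3)[of p q s] by (auto simp: K'_def)
    have "L r h \<le> (1 - s) * v + s * v"
      using r(2) pq s insert.prems(1) by (auto simp: K'_def intro!: add_mono mult_left_mono)
    then show "\<exists>r\<in>K'. \<forall>g\<in>G. L r g = (1 - s) * L p g + s * L q g"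
      using r by (auto simp: K'_def algebra_simps)
  next
    fix g h' s assume "g \<in> G" "h' \<in> G" "0 \<le> s" "s \<le> (1::real)"
    from insert.prems(4)[OF this] show "\<exists>k\<in>G. \<forall>p\<in>K'. L p k = (1 - s) * L p g + s * L p h'"
      by (auto simp: K'_def)
  next
    fix g assume g: "g \<in> G"
    have "h \<in> G" using insert.prems(1) by auto
    from two_function_minimax[OF insert.prems(3,4,5) g this v(1)]
    show "\<exists>p\<in>K'. L p g \<le> v" by (auto simp: K'_def)
  next
    show "F \<subseteq> G" "G \<noteq> {}" using insert.prems(1,2) by auto
  qed
  then obtain p where "p \<in> K'" "\<forall>g\<in>F. L p g \<le> u" by blast
  then show ?case using v by (intro bexI[of _ p]) (auto simp: K'_def)
qed

subsection \<open>Supports\<close>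

lemma closed_supp: "closed (supp \<mu>)"
proof -
  have "- supp \<mu> = \<Union>{U. open U \<and> emeasure \<mu> U = 0}"
    by (auto simp: supp_def)
  then show ?thesis by (simp add: closed_def open_Union)
qed

text \<open>The complement of the support is a union of null open sets; by the Lindelof property
  countably many of them suffice.\<close>

lemma AE_supp:
  fixes \<mu> :: "'a::second_countable_topology measure"
  assumes "sets \<mu> = sets borel"
  shows "AE x in \<mu>. x \<in> supp \<mu>"
proof -
  obtain \<F> where \<F>: "\<F> \<subseteq> {U. open U \<and> emeasure \<mu> U = 0}" "countable \<F>"
      "\<Union>\<F> = \<Union>{U. open U \<and> emeasure \<mu> U = 0}"
    using Lindelof[of "{U. open U \<and> emeasure \<mu> U = 0}"] by auto
  have "\<Union>\<F> \<in> null_sets \<mu>"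
    using \<F> assms by (intro null_sets_UN'[of \<F> "\<lambda>x. x", simplified]) (auto simp: null_sets_def)
  moreover have "- supp \<mu> = \<Union>\<F>"
    unfolding \<F>(3) by (auto simp: supp_def)
  ultimately have "- supp \<mu> \<in> null_sets \<mu>" by simp
  then show ?thesis by (rule AE_I') auto
qed

lemma emeasure_supp:
  fixes \<mu> :: "'a::second_countable_topology measure"
  assumes "\<mu> \<in> prob_measures"
  shows "emeasure \<mu> (supp \<mu>) = 1"
proof -
  interpret prob_space \<mu> using assms by (simp add: prob_measures_def)
  have "supp \<mu> \<in> sets \<mu>" using assms closed_supp[of \<mu>] by (simp add: prob_measures_def borel_closed)
  then show ?thesis
    using AE_supp[of \<mu>] assms prob_eq_1[of "supp \<mu>"] by (simp add: prob_measures_def emeasure_eq_measure)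
qed

subsection \<open>Convexity of the set of plans\<close>

lemma finite_measure_scale_measure:
  "finite_measure M \<Longrightarrow> finite_measure (scale_measure (ennreal r) M)"
  by (rule finite_measureI)
     (simp add: space_scale_measure ennreal_mult_eq_top_iff finite_measure.emeasure_finite)

lemma Pi_supp_convex:
  fixes p q :: "('x::second_countable_topology \<times> 'y::second_countable_topology) measure"
  assumes p: "p \<in> Pi_supp \<mu> \<nu>" and q: "q \<in> Pi_supp \<mu> \<nu>" and s: "0 \<le> s" "s \<le> 1"
  obtains r where "r \<in> Pi_supp \<mu> \<nu>"
    "\<And>f :: _ \<Rightarrow> real. f \<in> bcontfun \<Longrightarrow> (\<integral>z. f z \<partial>r) = (1 - s) * (\<integral>z. f z \<partial>p) + s * (\<integral>z. f z \<partial>q)"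
proof -
  have sp: "sets p = sets borel" "sets q = sets borel" and pq: "prob_space p" "prob_space q"
    using p q by (auto simp: Pi_supp_def prob_measures_def)
  interpret p: prob_space p by fact
  interpret q: prob_space q by fact
  have spU: "space p = UNIV" "space q = UNIV" using sp by (auto dest: sets_eq_imp_space_eq)
  define p' where "p' = scale_measure (ennreal (1 - s)) p"
  define q' where "q' = scale_measure (ennreal s) q"
  define r where "r = add_measure p' q'"
  have s': "sets q' = sets p'" "sets p' = sets borel" by (simp_all add: p'_def q'_def sp)
  have em: "emeasure r A = ennreal (1 - s) * emeasure p A + ennreal s * emeasure q A" if "A \<in> sets borel" for A
    unfolding r_def using that s' by (simp add: emeasure_add_measure) (simp add: p'_def q'_def)
  have sr: "sets r = sets borel" by (simp add: r_def s')
  have em1: "ennreal (1 - s) * x + ennreal s * x = x" for x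
    using s by (simp flip: distrib_right ennreal_plus)
  have "prob_space r"
    using em[of UNIV] p.emeasure_space_1 q.emeasure_space_1 sets_eq_imp_space_eq[OF sr] em1[of 1]
    by (intro prob_spaceI) (simp add: spU)
  have m: "fst \<in> M \<rightarrow>\<^sub>M borel" "snd \<in> M \<rightarrow>\<^sub>M borel" if "sets M = sets borel" for M :: "('x \<times> 'y) measure"
    by (simp_all add: measurable_cong_sets[OF that refl] borel_measurable_continuous_onI continuous_on_fst continuous_on_snd)
  have marg: "emeasure (distr r borel f) A = ennreal (1 - s) * emeasure (distr p borel f) A
      + ennreal s * emeasure (distr q borel f) A" if "A \<in> sets borel" "f \<in> borel \<rightarrow>\<^sub>M borel" for f :: "_ \<Rightarrow> 'z::topological_space" and A
  proof -
    have fm: "f \<in> M \<rightarrow>\<^sub>M borel" if "sets M = sets borel" for M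
      using \<open>f \<in> _\<close> by (simp add: measurable_cong_sets[OF that refl])
    have "f -` A \<in> sets borel" using measurable_sets[OF that(2,1)] by simp
    then show ?thesis
      using that fm[OF sr] fm[OF sp(1)] fm[OF sp(2)]
      by (simp add: emeasure_distr spU sets_eq_imp_space_eq[OF sr] em)
  qed
  have "emeasure (marg1 r) (supp \<mu>) = 1"
    using p q marg[of "supp \<mu>" fst] em1[of 1] m[of borel] closed_supp[of \<mu>]
    by (simp add: Pi_supp_def marg1_def borel_closed)
  moreover have "marg2 r = \<nu>"
  proof (rule measure_eqI)
    have \<nu>: "\<nu> = distr p borel snd" "\<nu> = distr q borel snd" using p q by (auto simp: Pi_supp_def marg2_def)
    then show "sets (marg2 r) = sets \<nu>" by (simp add: marg2_def)
    fix A assume "A \<in> sets (marg2 r)"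
    then show "emeasure (marg2 r) A = emeasure \<nu> A"
      using marg[of A snd] m[of borel] em1[of "emeasure \<nu> A"] \<nu> by (simp add: marg2_def)
  qed
  ultimately have "r \<in> Pi_supp \<mu> \<nu>"
    using \<open>prob_space r\<close> sr by (simp add: Pi_supp_def prob_measures_def)
  moreover have "(\<integral>z. f z \<partial>r) = (1 - s) * (\<integral>z. f z \<partial>p) + s * (\<integral>z. f z \<partial>q)" if f: "f \<in> bcontfun" for f :: "_ \<Rightarrow> real"
  proof -
    have fm: "f \<in> borel_measurable M" if "sets M = sets borel" for M
      using f by (simp add: measurable_cong_sets[OF that refl] bcontfun_def borel_measurable_continuous_onI)
    have "(\<integral>z. f z \<partial>r) = (\<integral>z. f z \<partial>p') + (\<integral>z. f z \<partial>q')"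
      unfolding r_def
      by (intro integral_add_measure s' integrable_bcontfun[OF _ _ f])
         (auto simp: p'_def q'_def sp intro!: finite_measure_scale_measure p.finite_measure_axioms q.finite_measure_axioms)
    then show ?thesis
      using s by (simp add: p'_def q'_def integral_scale_measure fm sp)
  qed
  ultimately show ?thesis using that by blast
qed

lemma continuous_on_Min_image:
  fixes f :: "'i \<Rightarrow> 'a::topological_space \<Rightarrow> real"
  assumes "finite T" "T \<noteq> {}" "\<And>i. i \<in> T \<Longrightarrow> continuous_on S (f i)"
  shows "continuous_on S (\<lambda>y. Min ((\<lambda>i. f i y) ` T))"
  using assms by (induction T rule: finite_ne_induct) (auto intro!: continuous_on_min)

subsection \<open>Integration against a kernel\<close>

text \<open>The masses of a nonnegative kernel need not be bounded, whereas the measurability and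
  mixture results are about subprobability kernels. Splitting off the mass as a scalar factor makes
  them applicable.\<close>

lemma kernel_normalization:
  assumes q: "nonneg_kernel q"
  obtains p where "p \<in> borel \<rightarrow>\<^sub>M subprob_algebra borel"
    "(\<lambda>x. measure (q x) UNIV) \<in> borel_measurable borel"
    "\<And>x A. A \<in> sets borel \<Longrightarrow> emeasure (q x) A = ennreal (measure (q x) UNIV) * emeasure (p x) A"
    "\<And>x f. f \<in> borel_measurable borel \<Longrightarrow> (\<integral>y. f y \<partial>q x) = measure (q x) UNIV * (\<integral>y. (f y :: real) \<partial>p x)"
proof -
  have fin: "finite_measure (q x)" and sq: "sets (q x) = sets borel" for x
    using q by (auto simp: nonneg_kernel_def fin_measures_def)
  have spq: "space (q x) = UNIV" for x using sets_eq_imp_space_eq[OF sq[of x]] by simp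
  have em[measurable]: "(\<lambda>x. emeasure (q x) A) \<in> borel_measurable borel" if "A \<in> sets borel" for A
    using q that by (auto simp: nonneg_kernel_def)
  define M where "M x = measure (q x) UNIV" for x
  have M_em: "emeasure (q x) UNIV = ennreal (M x)" for x
    unfolding M_def using finite_measure.emeasure_eq_measure[OF fin] .
  have M[measurable]: "M \<in> borel_measurable borel"
    unfolding M_def measure_def by measurable
  have M0: "0 \<le> M x" for x by (simp add: M_def)
  \<comment> \<open>Where the mass vanishes, \<open>1 / M x\<close> is 0 and \<open>p x\<close> has
    mass 0, which is still a subprobability.\<close>
  define p where "p x = scale_measure (ennreal (1 / M x)) (q x)" for x
  have sp: "sets (p x) = sets borel" for x by (simp add: p_def sq)
  have null: "emeasure (q x) A = 0" if "M x = 0" for x A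
  proof -
    have "emeasure (q x) A \<le> emeasure (q x) (space (q x))" by (rule emeasure_space)
    then show ?thesis using M_em[of x] that by (simp add: spq)
  qed
  have mult: "ennreal (M x) * (ennreal (1 / M x) * z) = z" if "M x \<noteq> 0" for x z
    using that M0[of x] by (simp add: mult.assoc[symmetric] ennreal_mult[symmetric])
  show ?thesis
  proof (rule that)
    show "p \<in> borel \<rightarrow>\<^sub>M subprob_algebra borel"
    proof (rule measurable_subprob_algebra)
      fix x
      have "emeasure (p x) UNIV \<le> 1"
      proof (cases "M x = 0")
        case False
        then show ?thesis using M0[of x] by (simp add: p_def M_em ennreal_mult[symmetric])
      qed (simp add: p_def)
      then show "subprob_space (p x)"
        by (intro subprob_spaceI) (simp_all add: p_def space_scale_measure spq)
    qed (use sp in \<open>auto simp: p_def\<close>)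
    show "(\<lambda>x. measure (q x) UNIV) \<in> borel_measurable borel" using M by (simp add: M_def[abs_def])
    show "emeasure (q x) A = ennreal (measure (q x) UNIV) * emeasure (p x) A" if "A \<in> sets borel" for x A
      using mult[of x "emeasure (q x) A"] null[of x A] by (cases "M x = 0") (simp_all add: p_def M_def[symmetric])
    show "(\<integral>y. f y \<partial>q x) = measure (q x) UNIV * (\<integral>y. (f y :: real) \<partial>p x)" if "f \<in> borel_measurable borel" for x f
    proof (cases "M x = 0")
      case True
      have "AE y in q x. False" using null[OF True, of UNIV] by (intro AE_I[of _ _ UNIV]) (auto simp: sq)
      then have "(\<integral>y. f y \<partial>q x) = 0" by (intro integral_eq_zero_AE) (elim eventually_mono, simp)
      then show ?thesis using True by (simp add: M_def)
    next
      case False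
      have "f \<in> borel_measurable (q x)" using that by (simp add: measurable_cong_sets[OF sq refl])
      then show ?thesis using False M0[of x]
        by (simp add: p_def integral_scale_measure M_def[symmetric])
    qed
  qed
qed

text \<open>Pushing \<open>p x\<close> forward by \<open>Pair x\<close> turns the integrand that
  varies with \<open>x\<close> into the fixed integrand \<open>b\<close>.\<close>

lemma integral_measurable_subprob_algebra2:
  fixes b :: "'a \<times> 'b \<Rightarrow> real"
  assumes p [measurable]: "p \<in> M \<rightarrow>\<^sub>M subprob_algebra N" and b [measurable]: "b \<in> borel_measurable (M \<Otimes>\<^sub>M N)"
  shows "(\<lambda>x. \<integral>y. b (x, y) \<partial>p x) \<in> borel_measurable M"
proof -
  have "(\<lambda>x. distr (p x) (M \<Otimes>\<^sub>M N) (Pair x)) \<in> M \<rightarrow>\<^sub>M subprob_algebra (M \<Otimes>\<^sub>M N)"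
    by (rule measurable_distr2[where M=N]) measurable
  then have "(\<lambda>x. \<integral>z. b z \<partial>distr (p x) (M \<Otimes>\<^sub>M N) (Pair x)) \<in> borel_measurable M"
    by (rule measurable_compose[OF _ integral_measurable_subprob_algebra]) (rule b)
  moreover have "(\<integral>z. b z \<partial>distr (p x) (M \<Otimes>\<^sub>M N) (Pair x)) = (\<integral>y. b (x, y) \<partial>p x)" if "x \<in> space M" for x
  proof -
    have "Pair x \<in> p x \<rightarrow>\<^sub>M M \<Otimes>\<^sub>M N"
      using that by (simp add: measurable_cong_sets[OF sets_kernel[OF p that] refl])
    then show ?thesis by (simp add: integral_distr)
  qed
  ultimately show ?thesis by (simp cong: measurable_cong)
qed

lemma kernel_integral_measurable:
  fixes b :: "'x::second_countable_topology \<times> 'y::second_countable_topology \<Rightarrow> real"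
  assumes q: "nonneg_kernel q" and b: "b \<in> borel_measurable borel"
  shows "(\<lambda>x. \<integral>y. b (x, y) \<partial>q x) \<in> borel_measurable borel"
proof -
  obtain p where p[measurable]: "p \<in> borel \<rightarrow>\<^sub>M subprob_algebra borel"
    and [measurable]: "(\<lambda>x. measure (q x) UNIV) \<in> borel_measurable borel"
    and int: "\<And>x f. f \<in> borel_measurable borel \<Longrightarrow> (\<integral>y. f y \<partial>q x) = measure (q x) UNIV * (\<integral>y. (f y :: real) \<partial>p x)"
    by (rule kernel_normalization[OF q], rule that)
  have b'[measurable]: "b \<in> borel_measurable (borel \<Otimes>\<^sub>M borel)" using b by (simp add: borel_prod)
  have "(\<lambda>y. b (x, y)) \<in> borel_measurable borel" for x by measurable
  then have "(\<lambda>x. \<integral>y. b (x, y) \<partial>q x) = (\<lambda>x. measure (q x) UNIV * (\<integral>y. b (x, y) \<partial>p x))"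
    by (simp add: int)
  also have "\<dots> \<in> borel_measurable borel"
    by (intro borel_measurable_times integral_measurable_subprob_algebra2[OF p b']) measurable
  finally show ?thesis .
qed

text \<open>After normalization, \<open>\<nu>\<close> is the mixture of the subprobabilities
  \<open>p x\<close> with respect to \<open>D\<close>, the measure \<open>\<mu>\<close> weighted by
  the masses of the kernel. The total mass of \<open>D\<close> is that of \<open>\<nu>\<close>,
  hence finite, and bounded functions can be integrated through the mixture.\<close>

lemma
  assumes q: "q \<in> kernels \<mu> \<nu>" and \<mu>: "\<mu> \<in> prob_measures" and \<nu>: "\<nu> \<in> prob_measures"
    and f: "f \<in> borel_measurable borel" "\<And>y. \<bar>f y\<bar> \<le> B"
  shows integrable_kernel: "integrable \<mu> (\<lambda>x. \<integral>y. (f y :: real) \<partial>q x)" (is ?i)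
    and integral_kernel: "(\<integral>x. (\<integral>y. f y \<partial>q x) \<partial>\<mu>) = (\<integral>y. f y \<partial>\<nu>)" (is ?e)
proof -
  have nk: "nonneg_kernel q"
    and mar: "\<And>A. A \<in> sets borel \<Longrightarrow> (\<integral>\<^sup>+x. emeasure (q x) A \<partial>\<mu>) = emeasure \<nu> A"
    using q by (auto simp: kernels_def)
  interpret \<mu>: prob_space \<mu> using \<mu> by (simp add: prob_measures_def)
  interpret \<nu>: prob_space \<nu> using \<nu> by (simp add: prob_measures_def)
  have s\<mu>[measurable_cong]: "sets \<mu> = sets borel" and s\<nu>: "sets \<nu> = sets borel"
    using \<mu> \<nu> by (auto simp: prob_measures_def)
  obtain p where p[measurable]: "p \<in> borel \<rightarrow>\<^sub>M subprob_algebra borel"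
    and M[measurable]: "(\<lambda>x. measure (q x) UNIV) \<in> borel_measurable borel"
    and em: "\<And>x A. A \<in> sets borel \<Longrightarrow> emeasure (q x) A = ennreal (measure (q x) UNIV) * emeasure (p x) A"
    and int: "\<And>x f. f \<in> borel_measurable borel \<Longrightarrow> (\<integral>y. f y \<partial>q x) = measure (q x) UNIV * (\<integral>y. (f y :: real) \<partial>p x)"
    by (rule kernel_normalization[OF nk], rule that)
  define D where "D = density \<mu> (\<lambda>x. ennreal (measure (q x) UNIV))"
  have neD: "space D \<noteq> {}" using \<mu>.not_empty by (simp add: D_def)
  have pD: "p \<in> D \<rightarrow>\<^sub>M subprob_algebra borel" unfolding D_def by measurable
  have D_em: "(\<integral>\<^sup>+x. h x \<partial>D) = (\<integral>\<^sup>+x. ennreal (measure (q x) UNIV) * h x \<partial>\<mu>)" if [measurable]: "h \<in> borel_measurable borel" for h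
    unfolding D_def by (subst nn_integral_density) auto
  have emq: "emeasure (q x) UNIV = ennreal (measure (q x) UNIV)" for x
    using nk by (intro finite_measure.emeasure_eq_measure) (simp add: nonneg_kernel_def fin_measures_def)
  have "emeasure D (space D) = (\<integral>\<^sup>+x. emeasure (q x) UNIV \<partial>\<mu>)"
    unfolding emq using D_em[of "\<lambda>_. 1"] by simp
  also have "\<dots> = emeasure \<nu> UNIV" by (rule mar) simp
  finally have finD: "finite_measure D" by (intro finite_measureI) (simp add: \<nu>.emeasure_eq_measure)
  have \<nu>_eq: "\<nu> = D \<bind> p"
  proof (rule measure_eqI)
    have "sets (D \<bind> p) = sets borel" by (rule sets_bind[OF sets_kernel[OF pD] neD])
    then show "sets \<nu> = sets (D \<bind> p)" by (simp add: s\<nu>)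
    fix A assume "A \<in> sets \<nu>"
    then have A: "A \<in> sets borel" by (simp add: s\<nu>)
    then have [measurable]: "(\<lambda>x. emeasure (p x) A) \<in> borel_measurable borel" by measurable
    have "emeasure (D \<bind> p) A = (\<integral>\<^sup>+x. emeasure (p x) A \<partial>D)" by (rule emeasure_bind[OF neD pD A])
    also have "\<dots> = (\<integral>\<^sup>+x. emeasure (q x) A \<partial>\<mu>)" by (subst D_em) (auto simp: em[OF A])
    finally show "emeasure \<nu> A = emeasure (D \<bind> p) A" by (simp add: mar[OF A])
  qed
  have [measurable]: "(\<lambda>x. \<integral>y. f y \<partial>p x) \<in> borel_measurable borel"
    using f by measurable
  have sub: "subprob_space (p x)" "sets (p x) = sets borel" for x
    using measurable_space[OF p, of x] by (auto simp: space_subprob_algebra)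
  have fp: "\<bar>\<integral>y. f y \<partial>p x\<bar> \<le> B" for x
  proof -
    interpret subprob_space "p x" by (rule sub)
    have B: "0 \<le> B" using f(2)[of undefined] by linarith
    have "\<bar>\<integral>y. f y \<partial>p x\<bar> \<le> (\<integral>y. B \<partial>p x)"
      using f B sub(2)[of x] by (intro order_trans[OF integral_abs_bound] integral_mono integrable_abs integrable_const_bound[where B=B])
        (auto simp: measurable_cong_sets[OF sub(2) refl])
    also have "\<dots> \<le> B" using subprob_measure_le_1[of "space (p x)"] B by (simp add: mult_left_le_one_le)
    finally show ?thesis .
  qed
  have iD: "integrable D (\<lambda>x. \<integral>y. f y \<partial>p x)"
    using fp by (intro finite_measure.integrable_const_bound[OF finD, where B=B]) (auto simp: D_def)
  then have "integrable \<mu> (\<lambda>x. measure (q x) UNIV * (\<integral>y. f y \<partial>p x))"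
    unfolding D_def by (subst (asm) integrable_density) auto
  then show ?i by (simp add: int[OF f(1)])
  have "(\<integral>y. f y \<partial>\<nu>) = (\<integral>x. (\<integral>y. f y \<partial>p x) \<partial>D)"
    unfolding \<nu>_eq
    by (rule integral_bind[OF f(1) f(2) pD finD, where B'=1]) (auto simp: sub(1) subprob_space.subprob_emeasure_le_1)
  also have "\<dots> = (\<integral>x. measure (q x) UNIV * (\<integral>y. f y \<partial>p x) \<partial>\<mu>)"
    unfolding D_def by (subst integral_density) auto
  finally show ?e by (simp add: int[OF f(1)])
qed

subsection \<open>Weak duality\<close>

definition minorants :: "('x::topological_space \<Rightarrow> 'y::topological_space measure \<Rightarrow> real)
    \<Rightarrow> (('x \<Rightarrow> real) \<times> ('x \<times> 'y \<Rightarrow> real)) set" where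
  "minorants c = {(A, B). continuous_on UNIV A \<and> continuous_on UNIV B \<and>
     (\<forall>x. \<forall>m\<in>fin_measures. (\<integral>y. B (x, y) \<partial>m) + A x \<le> c x m)}"

locale sup_cost =
  fixes c :: "'x::polish_space \<Rightarrow> 'y::polish_space measure \<Rightarrow> real"
    and a :: "nat \<Rightarrow> 'x \<Rightarrow> real" and b :: "nat \<Rightarrow> 'x \<times> 'y \<Rightarrow> real"
  assumes compact_X: "compact (UNIV :: 'x set)" and compact_Y: "compact (UNIV :: 'y set)"
    and cont_a: "\<And>k. continuous_on UNIV (a k)" and cont_b: "\<And>k. continuous_on UNIV (b k)"
    and c_eq: "\<And>x m. m \<in> fin_measures \<Longrightarrow> ereal (c x m) = (SUP k. ereal ((\<integral>y. b k (x, y) \<partial>m) + a k x))"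
begin

lemma compact_XY: "compact (UNIV :: ('x \<times> 'y) set)"
  using compact_Times[OF compact_X compact_Y] by simp

lemma a_meas [measurable]: "a k \<in> borel_measurable borel"
  by (rule borel_measurable_continuous_onI[OF cont_a])

lemma b_meas: "b k \<in> borel_measurable borel"
  by (rule borel_measurable_continuous_onI[OF cont_b])

lemma b_meas_pair [measurable]: "b k \<in> borel_measurable (borel \<Otimes>\<^sub>M borel)"
  using b_meas by (simp add: borel_prod)

lemma bounded_continuous_XY:
  fixes f :: "'x \<times> 'y \<Rightarrow> real"
  assumes "continuous_on UNIV f"
  obtains C where "0 \<le> C" "\<And>z. \<bar>f z\<bar> \<le> C"
  using bcontfunI_compact[OF compact_XY assms]
  by (auto simp: bcontfun_def bounded_pos_less) (meson less_imp_le)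

lemma integrable_continuous_X:
  fixes f :: "'x \<Rightarrow> real"
  assumes "finite_measure M" "sets M = sets borel" "continuous_on UNIV f"
  shows "integrable M f"
  by (rule integrable_bcontfun[OF assms(1,2) bcontfunI_compact[OF compact_X assms(3)]])

lemma continuous_section:
  "continuous_on UNIV f \<Longrightarrow> continuous_on UNIV (\<lambda>y. f (x, y))"
  by (rule continuous_on_compose2[of UNIV f]) (auto intro!: continuous_intros)

lemma integrable_section:
  fixes f :: "'x \<times> 'y \<Rightarrow> real"
  assumes "m \<in> fin_measures" "continuous_on UNIV f"
  shows "integrable m (\<lambda>y. f (x, y))"
  using assms by (intro integrable_bcontfun bcontfunI_compact compact_Y continuous_section)
    (auto simp: fin_measures_def)

lemma c_ge:
  assumes "m \<in> fin_measures"
  shows "(\<integral>y. b k (x, y) \<partial>m) + a k x \<le> c x m"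
proof -
  have "ereal ((\<integral>y. b k (x, y) \<partial>m) + a k x) \<le> (SUP k. ereal ((\<integral>y. b k (x, y) \<partial>m) + a k x))"
    by (rule SUP_upper) simp
  then show ?thesis unfolding c_eq[OF assms, symmetric] by simp
qed

lemma c_le:
  assumes "m \<in> fin_measures" "\<And>k. (\<integral>y. b k (x, y) \<partial>m) + a k x \<le> t"
  shows "c x m \<le> t"
proof -
  have "(SUP k. ereal ((\<integral>y. b k (x, y) \<partial>m) + a k x)) \<le> ereal t"
    using assms(2) by (intro SUP_least) simp
  then show ?thesis unfolding c_eq[OF assms(1), symmetric] by simp
qed

lemma minorant_ab: "(a k, b k) \<in> minorants c"
  using cont_a cont_b c_ge by (auto simp: minorants_def)

lemma cost_kernel_measurable:
  assumes "nonneg_kernel q"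
  shows "(\<lambda>x. c x (q x)) \<in> borel_measurable borel"
proof -
  have [measurable]: "(\<lambda>x. \<integral>y. b k (x, y) \<partial>q x) \<in> borel_measurable borel" for k
    by (rule kernel_integral_measurable[OF assms b_meas])
  have "q x \<in> fin_measures" for x using assms by (simp add: nonneg_kernel_def)
  then have "(\<lambda>x. ereal (c x (q x))) = (\<lambda>x. SUP k. ereal ((\<integral>y. b k (x, y) \<partial>q x) + a k x))"
    using c_eq by simp
  also have "\<dots> \<in> borel_measurable borel" by measurable
  finally have "(\<lambda>x. real_of_ereal (ereal (c x (q x)))) \<in> borel_measurable borel" by measurable
  then show ?thesis by simp
qed

lemma weak_duality:
  assumes \<mu>: "\<mu> \<in> prob_measures" and \<nu>: "\<nu> \<in> prob_measures"
  shows "dual_value c \<mu> \<nu> \<le> transport_cost c \<mu> \<nu>"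
  unfolding dual_value_def transport_cost_def
proof (rule SUP_least, rule INF_greatest)
  fix f :: "'y \<Rightarrow> real" and q assume f: "f \<in> bcontfun" and q: "q \<in> kernels \<mu> \<nu>"
  interpret \<mu>: prob_space \<mu> using \<mu> by (simp add: prob_measures_def)
  have s\<mu>: "sets \<mu> = sets borel" using \<mu> by (simp add: prob_measures_def)
  have nq: "nonneg_kernel q" and qf: "\<And>x. q x \<in> fin_measures"
    using q by (auto simp: kernels_def nonneg_kernel_def)
  have fm: "f \<in> borel_measurable borel" using f by (simp add: bcontfun_def borel_measurable_continuous_onI)
  obtain Bf where Bf: "\<And>y. \<bar>f y\<bar> \<le> Bf" using f by (auto simp: bcontfun_def bounded_iff)
  note fq = integrable_kernel[OF q \<mu> \<nu> fm Bf] integral_kernel[OF q \<mu> \<nu> fm Bf]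
  obtain C where C: "0 \<le> C" "\<And>z. \<bar>b 0 z\<bar> \<le> C" by (rule bounded_continuous_XY[OF cont_b[of 0]], rule that)
  \<comment> \<open>As the masses \<open>q x\<close> are unbounded in general, the lower bound for
    the cost contains the mass. It is nevertheless integrable, because the masses integrate to the
    mass of \<open>\<nu>\<close>.\<close>
  have low: "(\<integral>y. - C \<partial>q x) + a 0 x \<le> c x (q x)" for x
  proof -
    have "finite_measure (q x)" using qf by (simp add: fin_measures_def)
    then have "(\<integral>y. - C \<partial>q x) \<le> (\<integral>y. b 0 (x, y) \<partial>q x)"
      using C(2) by (intro integral_mono integrable_section qf cont_b) (auto simp: abs_le_iff minus_le_iff finite_measure.integrable_const)
    then show ?thesis using c_ge[OF qf[of x], where k=0 and x=x] by (meson add_right_mono order_trans)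
  qed
  have lowi: "integrable \<mu> (\<lambda>x. (\<integral>y. - C \<partial>q x) + a 0 x)"
    using C(1) by (intro Bochner_Integration.integrable_add integrable_kernel[OF q \<mu> \<nu>, where B=C] integrable_continuous_X s\<mu> cont_a \<mu>.finite_measure_axioms) auto
  show "ext_integral \<mu> (Kc c f) - ereal (\<integral>y. f y \<partial>\<nu>) \<le> ext_integral \<mu> (\<lambda>x. ereal (c x (q x)))"
  proof (cases "ext_integral \<mu> (\<lambda>x. ereal (c x (q x))) < \<infinity>")
    case True
    have ci: "integrable \<mu> (\<lambda>x. c x (q x))"
      using low cost_kernel_measurable[OF nq]
      by (intro integrable_if_ext_integral_less_PInf[OF _ lowi _ True]) (auto simp: measurable_cong_sets[OF s\<mu> refl])
    \<comment> \<open>The measure \<open>q x\<close> competes in the infimum that defines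
      \<open>Kc c f x\<close>; the kernel constraint then turns the integral of \<open>f\<close>
      into one against \<open>\<nu>\<close>.\<close>
    have "ext_integral \<mu> (Kc c f) \<le> ext_integral \<mu> (\<lambda>x. ereal ((\<integral>y. f y \<partial>q x) + c x (q x)))"
      unfolding Kc_def by (intro ext_integral_mono_AE AE_I2 INF_lower qf)
    also have "\<dots> = ereal ((\<integral>y. f y \<partial>\<nu>) + (\<integral>x. c x (q x) \<partial>\<mu>))"
      using ci fq by (simp add: ext_integral_real)
    finally show ?thesis by (simp add: ext_integral_real[OF ci] ereal_minus_le_iff add.commute)
  qed auto
qed

end

subsection \<open>Optimal plans for the relaxed problem\<close>

context sup_cost
begin

text \<open>The plan sends each \<open>y\<close> to a point of a finite net \<open>T\<close> of the
  support that minimizes \<open>B (\<sqdot>, y)\<close> over \<open>T\<close>. A finite net makes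
  the minimum \<open>h\<close> continuous and the selection Borel. The first marginal is carried by
  \<open>T\<close> and so is in general not absolutely continuous, which forces the larger class
  \<open>Pi_supp\<close> here.\<close>

lemma dual_minorant:
  assumes \<mu>: "\<mu> \<in> prob_measures" and \<nu>: "\<nu> \<in> prob_measures" and AB: "(A, B) \<in> minorants c" and "0 < e"
  shows "\<exists>\<pi>\<in>Pi_supp \<mu> \<nu>. ereal ((\<integral>z. B z \<partial>\<pi>) + (\<integral>x. A x \<partial>\<mu>)) \<le> dual_value c \<mu> \<nu> + ereal e"
proof -
  interpret \<mu>: prob_space \<mu> using \<mu> by (simp add: prob_measures_def)
  interpret \<nu>: prob_space \<nu> using \<nu> by (simp add: prob_measures_def)
  have s\<mu>: "sets \<mu> = sets borel" and s\<nu>[measurable_cong]: "sets \<nu> = sets borel"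
    using \<mu> \<nu> by (auto simp: prob_measures_def)
  have A: "continuous_on UNIV A" and B: "continuous_on UNIV B"
    and min: "\<And>x m. m \<in> fin_measures \<Longrightarrow> (\<integral>y. B (x, y) \<partial>m) + A x \<le> c x m"
    using AB by (auto simp: minorants_def)
  have [measurable]: "B \<in> borel_measurable (borel \<Otimes>\<^sub>M borel)"
    unfolding borel_prod by (rule borel_measurable_continuous_onI[OF B])
  have "uniformly_continuous_on UNIV B"
    by (rule compact_uniformly_continuous[OF B compact_XY])
  then obtain d where d: "0 < d" "\<And>z z'. dist z z' < d \<Longrightarrow> dist (B z) (B z') < e"
    unfolding uniformly_continuous_on_def using \<open>0 < e\<close> by (metis UNIV_I dist_commute)
  have "compact (supp \<mu>)" using closed_Int_compact[OF closed_supp compact_X, of \<mu>] by simp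
  then obtain T where T: "T \<subseteq> supp \<mu>" "finite T" "supp \<mu> \<subseteq> (\<Union>x\<in>T. ball x d)"
    by (rule compactE_image[of _ "supp \<mu>" "\<lambda>x. ball x d"]) (use d in auto)
  have "supp \<mu> \<noteq> {}" using emeasure_supp[OF \<mu>] by auto
  then have "T \<noteq> {}" using T by auto
  define h where "h y = Min ((\<lambda>x. B (x, y)) ` T)" for y
  have h: "continuous_on UNIV h" unfolding h_def
    by (intro continuous_on_Min_image T \<open>T \<noteq> {}\<close> continuous_section B)
  then have [measurable]: "h \<in> borel_measurable borel" by (rule borel_measurable_continuous_onI)
  obtain xs where xs: "set xs = T" using finite_list[OF T(2)] by blast
  \<comment> \<open>Taking the least index of a minimizer makes the selection measurable.\<close>
  define j where "j y = (LEAST i. i < length xs \<and> B (xs ! i, y) = h y)" for y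
  have j: "j y < length xs \<and> B (xs ! j y, y) = h y" for y
    unfolding j_def
  proof (rule LeastI_ex)
    have "h y \<in> (\<lambda>x. B (x, y)) ` T" unfolding h_def using T \<open>T \<noteq> {}\<close> by (intro Min_in) auto
    then obtain x where "x \<in> set xs" "B (x, y) = h y" using xs by auto
    then show "\<exists>i. i < length xs \<and> B (xs ! i, y) = h y" by (auto simp: in_set_conv_nth)
  qed
  have [measurable]: "j \<in> borel \<rightarrow>\<^sub>M count_space UNIV" unfolding j_def by measurable
  define \<sigma> where "\<sigma> y = xs ! j y" for y
  have \<sigma>[measurable]: "\<sigma> \<in> borel \<rightarrow>\<^sub>M borel"
    unfolding \<sigma>_def by (rule measurable_compose[OF \<open>j \<in> _\<close>]) simp
  have \<sigma>T: "\<sigma> y \<in> T" "B (\<sigma> y, y) = h y" for y using j[of y] xs by (auto simp: \<sigma>_def)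
  define \<pi> where "\<pi> = distr \<nu> borel (\<lambda>y. (\<sigma> y, y))"
  have graph[measurable]: "(\<lambda>y. (\<sigma> y, y)) \<in> \<nu> \<rightarrow>\<^sub>M borel"
    unfolding borel_prod[symmetric] by measurable
  have fs: "fst \<in> borel \<rightarrow>\<^sub>M (borel :: 'x measure)" "snd \<in> borel \<rightarrow>\<^sub>M (borel :: 'y measure)"
    by (intro borel_measurable_continuous_onI continuous_on_fst continuous_on_snd continuous_on_id)+
  have "marg2 \<pi> = distr \<nu> borel (\<lambda>y. y)"
    unfolding marg2_def \<pi>_def by (subst distr_distr) (auto simp: comp_def fs)
  also have "\<dots> = \<nu>" by (rule distr_id2) (simp add: s\<nu>)
  finally have "marg2 \<pi> = \<nu>" .
  moreover have "marg1 \<pi> = distr \<nu> borel \<sigma>"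
    unfolding marg1_def \<pi>_def by (subst distr_distr) (auto simp: comp_def fs)
  then have "emeasure (marg1 \<pi>) (supp \<mu>) = emeasure \<nu> (\<sigma> -` supp \<mu> \<inter> space \<nu>)"
    using closed_supp[of \<mu>] by (simp add: emeasure_distr borel_closed)
  then have "emeasure (marg1 \<pi>) (supp \<mu>) = 1"
    using \<sigma>T(1) T(1) \<nu>.emeasure_space_1 by (simp add: subset_eq Int_absorb1 vimage_def Collect_conj_eq)
  moreover have "\<pi> \<in> prob_measures"
    unfolding \<pi>_def using \<nu>.prob_space_distr[OF graph] by (simp add: prob_measures_def)
  ultimately have "\<pi> \<in> Pi_supp \<mu> \<nu>" by (simp add: Pi_supp_def)
  moreover have "ereal ((\<integral>z. B z \<partial>\<pi>) + (\<integral>x. A x \<partial>\<mu>)) \<le> dual_value c \<mu> \<nu> + ereal e"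
  proof -
    \<comment> \<open>The summand \<open>e\<close> pays for replacing the support by the net:
      \<open>f y + B (x, y)\<close> is nonnegative for every \<open>x\<close> in the support, so
      \<open>Kc c f\<close> is at least \<open>A\<close> there. The same \<open>e\<close> is the
      loss in the conclusion.\<close>
    define f where "f y = e - h y" for y
    have fc: "continuous_on UNIV f" unfolding f_def by (intro continuous_intros h)
    have fb: "f \<in> bcontfun" by (rule bcontfunI_compact[OF compact_Y fc])
    have hi: "integrable \<nu> h" by (intro integrable_bcontfun bcontfunI_compact compact_Y h s\<nu> \<nu>.finite_measure_axioms)
    have K: "ereal (A x) \<le> Kc c f x" if x: "x \<in> supp \<mu>" for x
      unfolding Kc_def
    proof (rule INF_greatest)
      fix m :: "'y measure" assume m: "m \<in> fin_measures"
      obtain x' where x': "x' \<in> T" "dist x' x < d" using T x by auto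
      have nonneg: "0 \<le> f y + B (x, y)" for y
      proof -
        have "h y \<le> B (x', y)" unfolding h_def using T x' by (intro Min_le) auto
        moreover have "dist (B (x', y)) (B (x, y)) < e" using x' by (intro d) (simp add: dist_Pair_Pair)
        ultimately show ?thesis unfolding f_def dist_real_def by linarith
      qed
      have mf: "finite_measure m" "sets m = sets borel" using m by (auto simp: fin_measures_def)
      have "0 \<le> (\<integral>y. f y + B (x, y) \<partial>m)" using nonneg by (intro integral_nonneg_AE) auto
      also have "\<dots> = (\<integral>y. f y \<partial>m) + (\<integral>y. B (x, y) \<partial>m)"
        by (intro Bochner_Integration.integral_add integrable_bcontfun mf fb integrable_section m B)
      finally show "ereal (A x) \<le> ereal ((\<integral>y. f y \<partial>m) + c x m)" using min[OF m, of x] by simp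
    qed
    have "ereal (\<integral>x. A x \<partial>\<mu>) = ext_integral \<mu> (\<lambda>x. ereal (A x))"
      by (intro ext_integral_real[symmetric] integrable_continuous_X A s\<mu> \<mu>.finite_measure_axioms)
    also have "\<dots> \<le> ext_integral \<mu> (Kc c f)"
      using AE_supp[OF s\<mu>] by (intro ext_integral_mono_AE, eventually_elim) (rule K)
    finally have "ereal (\<integral>x. A x \<partial>\<mu>) - ereal (\<integral>y. f y \<partial>\<nu>) \<le> ext_integral \<mu> (Kc c f) - ereal (\<integral>y. f y \<partial>\<nu>)"
      by (intro ereal_minus_mono) auto
    also have "\<dots> \<le> dual_value c \<mu> \<nu>" unfolding dual_value_def by (rule SUP_upper[OF fb])
    finally have "ereal (\<integral>x. A x \<partial>\<mu>) - ereal (\<integral>y. f y \<partial>\<nu>) \<le> dual_value c \<mu> \<nu>" .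
    moreover have "(\<integral>y. f y \<partial>\<nu>) = e - (\<integral>y. h y \<partial>\<nu>)"
      unfolding f_def using hi by (simp add: \<nu>.prob_space)
    moreover have "(\<integral>z. B z \<partial>\<pi>) = (\<integral>y. h y \<partial>\<nu>)"
      unfolding \<pi>_def by (subst integral_distr) (auto simp: \<sigma>T intro: borel_measurable_continuous_onI[OF B])
    ultimately show ?thesis
      by (cases "dual_value c \<mu> \<nu>") auto
  qed
  ultimately show ?thesis by blast
qed

text \<open>The weight is a function of \<open>x\<close> alone, so it factors out of the integral
  over \<open>y\<close>, and at each \<open>x\<close> the inequality is a convex combination of the
  two given ones.\<close>

lemma minorants_mix:
  assumes "(A, B) \<in> minorants c" "(A', B') \<in> minorants c"
    and l: "continuous_on UNIV l" "\<And>x. 0 \<le> l x" "\<And>x. l x \<le> 1"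
  shows "(\<lambda>x. l x * A x + (1 - l x) * A' x, \<lambda>z. l (fst z) * B z + (1 - l (fst z)) * B' z) \<in> minorants c"
proof -
  have cont: "continuous_on UNIV A" "continuous_on UNIV B" "continuous_on UNIV A'" "continuous_on UNIV B'"
    using assms by (auto simp: minorants_def)
  have lf: "continuous_on UNIV (\<lambda>z :: 'x \<times> 'y. l (fst z))"
    by (rule continuous_on_compose2[OF l(1)]) (auto intro: continuous_intros)
  have "(\<integral>y. l x * B (x, y) + (1 - l x) * B' (x, y) \<partial>m) + (l x * A x + (1 - l x) * A' x) \<le> c x m"
    if m: "m \<in> fin_measures" for x m
  proof -
    have "(\<integral>y. l x * B (x, y) + (1 - l x) * B' (x, y) \<partial>m) + (l x * A x + (1 - l x) * A' x)
        = l x * ((\<integral>y. B (x, y) \<partial>m) + A x) + (1 - l x) * ((\<integral>y. B' (x, y) \<partial>m) + A' x)"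
      using cont m by (subst Bochner_Integration.integral_add) (auto simp: integrable_section algebra_simps)
    also have "\<dots> \<le> l x * c x m + (1 - l x) * c x m"
      using assms m l(2,3)[of x] by (intro add_mono mult_left_mono) (auto simp: minorants_def)
    finally show ?thesis by (simp add: algebra_simps)
  qed
  then show ?thesis using cont l(1) lf by (auto simp: minorants_def intro!: continuous_intros)
qed

text \<open>The support constraint says that the closed set \<open>supp \<mu> \<times> UNIV\<close>
  has full mass, which passes to weak limits; absolute continuity of the first marginal would
  not.\<close>

lemma Pi_supp_weakly_closed:
  fixes \<mu> :: "'x measure" and \<nu> :: "'y measure"
  assumes \<mu>: "\<mu> \<in> prob_measures" and \<nu>: "\<nu> \<in> prob_measures"
    and p: "\<And>n. p n \<in> Pi_supp \<mu> \<nu>" and \<pi>: "\<pi> \<in> prob_measures" and w: "weakly_converges p \<pi>"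
  shows "\<pi> \<in> Pi_supp \<mu> \<nu>"
proof -
  have fs: "fst \<in> M \<rightarrow>\<^sub>M (borel :: 'x measure)" "snd \<in> M \<rightarrow>\<^sub>M (borel :: 'y measure)"
    if "sets M = sets borel" for M
    unfolding measurable_cong_sets[OF that refl]
    by (intro borel_measurable_continuous_onI continuous_on_fst continuous_on_snd continuous_on_id)+
  have marg: "emeasure (marg1 q) (supp \<mu>) = emeasure q (supp \<mu> \<times> UNIV)" if q: "q \<in> prob_measures" for q :: "('x \<times> 'y) measure"
  proof -
    have sq: "sets q = sets borel" using q by (simp add: prob_measures_def)
    have "fst -` supp \<mu> \<inter> space q = supp \<mu> \<times> UNIV" using sets_eq_imp_space_eq[OF sq] by auto
    then show ?thesis unfolding marg1_def using closed_supp[of \<mu>]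
      by (subst emeasure_distr) (auto simp: fs[OF sq] borel_closed)
  qed
  have pp: "p n \<in> prob_measures" for n using p by (simp add: Pi_supp_def)
  have "emeasure \<pi> (supp \<mu> \<times> UNIV) = 1"
  proof (intro weak_limit_closed_full[OF w pp \<pi>] closed_Times closed_supp)
    show "emeasure (p n) (supp \<mu> \<times> UNIV) = 1" for n
      using p[of n] marg[OF pp, of n] by (simp add: Pi_supp_def)
  qed auto
  moreover have "marg2 \<pi> = \<nu>"
  proof (rule finite_measure_eqI_bcontfun)
    have s: "sets \<pi> = sets borel" "prob_space \<pi>" using \<pi> by (auto simp: prob_measures_def)
    show "finite_measure (marg2 \<pi>)" unfolding marg2_def
      using prob_space.prob_space_distr[OF s(2) fs(2)[OF s(1)]] by (rule prob_space.finite_measure)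
    show "finite_measure \<nu>" "sets \<nu> = sets borel" "sets (marg2 \<pi>) = sets borel"
      using \<nu> by (auto simp: prob_measures_def prob_space.finite_measure marg2_def)
    fix f :: "'y \<Rightarrow> real" assume f: "f \<in> bcontfun"
    then have fc: "continuous_on UNIV f" by (simp add: bcontfun_def)
    have int: "(\<integral>y. f y \<partial>marg2 q) = (\<integral>z. f (snd z) \<partial>q)" if "sets q = sets borel" for q :: "('x \<times> 'y) measure"
      unfolding marg2_def by (rule integral_distr[OF fs(2)[OF that] borel_measurable_continuous_onI[OF fc]])
    have "(\<lambda>z :: 'x \<times> 'y. f (snd z)) \<in> bcontfun"
      by (intro bcontfunI_compact[OF compact_XY] continuous_on_compose2[OF fc]) (auto intro: continuous_intros)
    then have "(\<lambda>n. \<integral>z. f (snd z) \<partial>p n) \<longlonglongrightarrow> (\<integral>z. f (snd z) \<partial>\<pi>)"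
      using w by (auto simp: weakly_converges_def)
    moreover have "(\<integral>z. f (snd z) \<partial>p n) = (\<integral>y. f y \<partial>\<nu>)" for n
      using int[of "p n"] p[of n] by (simp add: Pi_supp_def prob_measures_def)
    ultimately show "(\<integral>y. f y \<partial>marg2 \<pi>) = (\<integral>y. f y \<partial>\<nu>)"
      by (simp add: int[OF s(1)] LIMSEQ_const_iff)
  qed
  ultimately show ?thesis using \<pi> by (simp add: Pi_supp_def marg)
qed

text \<open>Finite minimax treats the first minorants of an enumeration with vanishing slack. A weak
  limit of the resulting plans satisfies all the inequalities exactly, because the value of a
  minorant is weakly continuous in the plan.\<close>

lemma relaxed_solution:
  assumes \<mu>: "\<mu> \<in> prob_measures" and \<nu>: "\<nu> \<in> prob_measures"
    and G0: "countable G0" "G0 \<subseteq> minorants c" "G0 \<noteq> {}" and t: "dual_value c \<mu> \<nu> \<le> ereal t"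
  shows "\<exists>\<pi>\<in>Pi_supp \<mu> \<nu>. \<forall>g\<in>G0. (\<integral>z. snd g z \<partial>\<pi>) + (\<integral>x. fst g x \<partial>\<mu>) \<le> t"
proof -
  define L where "L p g = (\<integral>z. (snd g z :: real) \<partial>p) + (\<integral>x. fst g x \<partial>\<mu>)" for p :: "('x \<times> 'y) measure" and g
  define g where "g = from_nat_into G0"
  have gG: "g n \<in> minorants c" for n using G0 from_nat_into[OF G0(3)] by (auto simp: g_def)
  have \<mu>': "finite_measure \<mu>" "sets \<mu> = sets borel" using \<mu> by (auto simp: prob_measures_def prob_space.finite_measure)
  have gb: "snd h \<in> bcontfun" and ga: "integrable \<mu> (fst h)" if "h \<in> minorants c" for h
    using that integrable_continuous_X[OF \<mu>'] bcontfunI_compact[OF compact_XY] by (auto simp: minorants_def)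
  have conv: "\<exists>k\<in>minorants c. \<forall>p\<in>Pi_supp \<mu> \<nu>. L p k = (1 - s) * L p g + s * L p h"
    if gh: "g \<in> minorants c" "h \<in> minorants c" and s: "0 \<le> s" "s \<le> 1" for g h s
  proof (intro bexI ballI)
    let ?k = "(\<lambda>x. (1 - s) * fst g x + (1 - (1 - s)) * fst h x, \<lambda>z. (1 - s) * snd g z + (1 - (1 - s)) * snd h z)"
    show "?k \<in> minorants c"
      using gh s minorants_mix[of "fst g" "snd g" "fst h" "snd h" "\<lambda>_. 1 - s"] by simp
    fix p assume "p \<in> Pi_supp \<mu> \<nu>"
    then have "finite_measure p" "sets p = sets borel" by (auto simp: Pi_supp_def prob_measures_def prob_space.finite_measure)
    then have "integrable p (snd g)" "integrable p (snd h)" using gb gh integrable_bcontfun by blast+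
    then show "L p ?k = (1 - s) * L p g + s * L p h"
      using ga gh by (simp add: L_def algebra_simps)
  qed
  \<comment> \<open>Half of the slack \<open>1 / real (Suc n)\<close> covers the error in
    \<open>dual_minorant\<close>, the other half the strict inequality in the minimax
    theorem.\<close>
  have "\<exists>p\<in>Pi_supp \<mu> \<nu>. \<forall>h\<in>g ` {..n}. L p h \<le> t + 1 / real (Suc n)" for n
  proof (rule finite_minimax[where G="minorants c" and t="t + 1 / real (Suc n) / 2"])
    show "\<exists>r\<in>Pi_supp \<mu> \<nu>. \<forall>g\<in>minorants c. L r g = (1 - s) * L p g + s * L q g"
      if pq: "p \<in> Pi_supp \<mu> \<nu>" "q \<in> Pi_supp \<mu> \<nu>" and s: "0 \<le> s" "s \<le> 1" for p q s
    proof -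
      obtain r where "r \<in> Pi_supp \<mu> \<nu>"
        "\<And>f :: _ \<Rightarrow> real. f \<in> bcontfun \<Longrightarrow> (\<integral>z. f z \<partial>r) = (1 - s) * (\<integral>z. f z \<partial>p) + s * (\<integral>z. f z \<partial>q)"
        using Pi_supp_convex[OF pq s] by blast
      then show ?thesis using gb by (intro bexI[of _ r]) (auto simp: L_def algebra_simps)
    qed
    show "\<exists>p\<in>Pi_supp \<mu> \<nu>. L p h \<le> t + 1 / real (Suc n) / 2" if h: "h \<in> minorants c" for h
    proof -
      obtain p where p: "p \<in> Pi_supp \<mu> \<nu>" "ereal (L p h) \<le> dual_value c \<mu> \<nu> + ereal (1 / real (Suc n) / 2)"
        using dual_minorant[OF \<mu> \<nu>, of "fst h" "snd h" "1 / real (Suc n) / 2"] h by (auto simp: L_def)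
      note p(2)
      also have "\<dots> \<le> ereal t + ereal (1 / real (Suc n) / 2)" by (intro add_right_mono t)
      finally show ?thesis using p(1) by auto
    qed
    show "t + 1 / real (Suc n) / 2 < t + 1 / real (Suc n)" by (simp add: field_simps)
  qed (use gG conv in auto)
  then obtain p where p: "\<And>n. p n \<in> Pi_supp \<mu> \<nu>" "\<And>n h. h \<in> g ` {..n} \<Longrightarrow> L (p n) h \<le> t + 1 / real (Suc n)"
    by metis
  have pp: "p n \<in> prob_measures" for n using p(1) by (simp add: Pi_supp_def)
  obtain r \<pi> where r: "strict_mono r" and \<pi>: "\<pi> \<in> prob_measures" and w: "weakly_converges (p \<circ> r) \<pi>"
    by (rule weakly_convergent_subsequence[OF compact_XY pp], rule that)
  have "\<pi> \<in> Pi_supp \<mu> \<nu>"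
    using p(1) by (intro Pi_supp_weakly_closed[OF \<mu> \<nu> _ \<pi> w]) simp
  moreover have "L \<pi> h \<le> t" if "h \<in> G0" for h
  proof -
    obtain k where k: "h = g k" using from_nat_into_surj[OF G0(1) \<open>h \<in> G0\<close>] by (auto simp: g_def)
    have "(\<lambda>n. L ((p \<circ> r) n) h) \<longlonglongrightarrow> L \<pi> h"
      unfolding L_def using w gb[OF gG] by (intro tendsto_intros) (auto simp: weakly_converges_def k)
    moreover have "(\<lambda>n. t + 1 / real (Suc n)) \<longlonglongrightarrow> t + 0"
      by (intro tendsto_intros LIMSEQ_Suc[OF lim_1_over_n])
    moreover have "L ((p \<circ> r) n) h \<le> t + 1 / real (Suc n)" if "n \<ge> k" for n
    proof -
      \<comment> \<open>The subsequence runs ahead of \<open>n\<close>, so its constraints include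
        the \<open>k\<close>-th one and its slack is no larger.\<close>
      have "n \<le> r n" using r by (rule seq_suble)
      then have "L (p (r n)) h \<le> t + 1 / real (Suc (r n))" using that by (intro p(2)) (auto simp: k)
      also have "\<dots> \<le> t + 1 / real (Suc n)" using \<open>n \<le> r n\<close> by (simp add: frac_le)
      finally show ?thesis by simp
    qed
    ultimately have "L \<pi> h \<le> t + 0" by (intro LIMSEQ_le) auto
    then show ?thesis by simp
  qed
  ultimately show ?thesis by (intro bexI[of _ \<pi>]) (simp_all add: L_def)
qed

end

subsection \<open>Approximating Borel sets by continuous functions\<close>

text \<open>The order of quantifiers is the point: one family serves all measures and sets. A Borel
  set is approximated by an open set through outer regularity, this by a finite union of basic sets,
  and the union by a ramp, at a cost of \<open>e / 3\<close> each; finite unions from a countable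
  base leave only countably many ramps.\<close>

lemma countable_ramp_family:
  obtains \<Lambda> :: "('a::polish_space \<Rightarrow> real) set" where "countable \<Lambda>"
    "\<And>l. l \<in> \<Lambda> \<Longrightarrow> continuous_on UNIV l" "\<And>l x. l \<in> \<Lambda> \<Longrightarrow> 0 \<le> l x" "\<And>l x. l \<in> \<Lambda> \<Longrightarrow> l x \<le> 1"
    "\<And>\<theta> E e. finite_measure \<theta> \<Longrightarrow> sets \<theta> = sets borel \<Longrightarrow> E \<in> sets borel \<Longrightarrow> 0 < e \<Longrightarrow>
       \<exists>l\<in>\<Lambda>. (\<integral>x. \<bar>l x - indicator E x\<bar> \<partial>\<theta>) < e"
proof -
  obtain \<B> :: "'a set set" where \<B>: "countable \<B>" "topological_basis \<B>"
    using ex_countable_basis by auto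
  define \<Lambda> where "\<Lambda> = (\<lambda>(F, n). open_ramp (\<Union>F) n) ` ({F. finite F \<and> F \<subseteq> \<B>} \<times> (UNIV :: nat set))"
  show ?thesis
  proof (rule that[of \<Lambda>])
    have "countable {F. finite F \<and> F \<subseteq> \<B>}" by (rule countable_Collect_finite_subset[OF \<B>(1)])
    then show "countable \<Lambda>" unfolding \<Lambda>_def by (intro countable_image countable_SIGMA) auto
    show "continuous_on UNIV l" if "l \<in> \<Lambda>" for l using that by (auto simp: \<Lambda>_def continuous_open_ramp)
    show "0 \<le> l x" "l x \<le> 1" if "l \<in> \<Lambda>" for l x using that by (auto simp: \<Lambda>_def open_ramp_bounds)
    fix \<theta> :: "'a measure" and E :: "'a set" and e :: real
    assume \<theta>: "finite_measure \<theta>" and s\<theta>[measurable_cong]: "sets \<theta> = sets borel" and E[measurable]: "E \<in> sets borel" and "0 < e"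
    interpret finite_measure \<theta> by fact
    have "(INF U\<in>{U. E \<subseteq> U \<and> open U}. emeasure \<theta> U) < emeasure \<theta> E + ennreal (e/3)"
      using \<open>0 < e\<close> by (subst outer_regular[OF s\<theta> _ E, symmetric])
        (auto simp: emeasure_eq_measure simp flip: ennreal_plus intro!: ennreal_lessI add_nonneg_pos)
    then obtain U where U: "E \<subseteq> U" "open U" "emeasure \<theta> U < emeasure \<theta> E + ennreal (e/3)"
      by (auto simp: INF_less_iff)
    have Um: "measure \<theta> U < measure \<theta> E + e/3"
      using U(3) \<open>0 < e\<close> by (simp add: emeasure_eq_measure ennreal_less_iff flip: ennreal_plus)
    \<comment> \<open>The empty set is added so that the enumeration makes sense even if
      \<open>U\<close> contains no basic set; it is removed again when the ramp is shown to lie in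
      the family.\<close>
    define B where "B = from_nat_into (insert {} {b \<in> \<B>. b \<subseteq> U})"
    have cB: "countable (insert {} {b \<in> \<B>. b \<subseteq> U})" using \<B>(1) by auto
    have rB: "range B = insert {} {b \<in> \<B>. b \<subseteq> U}" unfolding B_def by (rule range_from_nat_into[OF _ cB]) simp
    define V where "V n = \<Union>(B ` {..n})" for n
    have Bi: "B i = {} \<or> B i \<in> \<B> \<and> B i \<subseteq> U" for i
      using rangeI[of B i] unfolding rB by simp
    have oB: "open (B i)" "B i \<subseteq> U" for i
      using topological_basis_open[OF \<B>(2), of "B i"] Bi[of i] by auto
    have oV: "open (V n)" for n unfolding V_def using oB by auto
    have [measurable]: "U \<in> sets borel" "V n \<in> sets borel" for n using U oV by auto
    have UV: "(\<Union>n. V n) = U"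
    proof
      show "(\<Union>n. V n) \<subseteq> U" using oB by (auto simp: V_def)
      show "U \<subseteq> (\<Union>n. V n)"
      proof
        fix x assume "x \<in> U"
        then obtain b where "b \<in> \<B>" "x \<in> b" "b \<subseteq> U" by (rule topological_basisE[OF \<B>(2) U(2)])
        then obtain i where "b = B i" using rB by blast
        then show "x \<in> (\<Union>n. V n)" using \<open>x \<in> b\<close> by (auto simp: V_def)
      qed
    qed
    have "(\<lambda>n. measure \<theta> (V n)) \<longlonglongrightarrow> measure \<theta> (\<Union>n. V n)"
    proof (rule finite_Lim_measure_incseq)
      show "range V \<subseteq> sets \<theta>" by (auto simp: s\<theta>)
      show "incseq V" unfolding incseq_def V_def by (intro allI impI Union_mono image_mono) auto
    qed
    then have "\<forall>\<^sub>F n in sequentially. measure \<theta> U - e/3 < measure \<theta> (V n)"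
      unfolding UV using \<open>0 < e\<close> by (intro order_tendstoD) auto
    then obtain n where n: "measure \<theta> U - e/3 < measure \<theta> (V n)" by (auto simp: eventually_sequentially)
    have "\<forall>\<^sub>F k in sequentially. measure \<theta> (V n) - e/3 < (\<integral>x. open_ramp (V n) k x \<partial>\<theta>)"
      using \<open>0 < e\<close> by (intro order_tendstoD(1)[OF integral_open_ramp_tendsto[OF \<theta> s\<theta> oV]]) auto
    then obtain k where k: "measure \<theta> (V n) - e/3 < (\<integral>x. open_ramp (V n) k x \<partial>\<theta>)" by (auto simp: eventually_sequentially)
    let ?l = "open_ramp (V n) k"
    have le1: "?l x \<le> indicator (V n) x" for x
      using open_ramp_bounds[of "V n" k x] open_ramp_outside[of x "V n" k] by (auto simp: indicator_def)
    have le2: "indicator (V n) x \<le> (indicator U x :: real)" "indicator E x \<le> (indicator U x :: real)" for x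
      using oB U(1) by (auto simp: V_def indicator_def)
    have li: "integrable \<theta> ?l" by (rule integrable_bcontfun[OF \<theta> s\<theta> open_ramp_bcontfun])
    have ii: "integrable \<theta> (indicator A :: 'a \<Rightarrow> real)" if "A \<in> sets borel" for A
      using that by (simp add: s\<theta> less_top[symmetric])
    then have ii: "integrable \<theta> (indicator E :: 'a \<Rightarrow> real)" "integrable \<theta> (indicator U :: 'a \<Rightarrow> real)"
        "integrable \<theta> (indicator (V n) :: 'a \<Rightarrow> real)" by auto
    have "(\<integral>x. \<bar>?l x - indicator E x\<bar> \<partial>\<theta>) \<le>
        (\<integral>x. (indicator (V n) x - ?l x) + (indicator U x - indicator (V n) x) + (indicator U x - indicator E x) \<partial>\<theta>)"
    proof (rule integral_mono)
      show "\<bar>?l x - indicator E x\<bar> \<le>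
        (indicator (V n) x - ?l x) + (indicator U x - indicator (V n) x) + (indicator U x - indicator E x)" for x
        using le1[of x] le2[of x] by linarith
    qed (intro integrable_abs Bochner_Integration.integrable_add Bochner_Integration.integrable_diff li ii)+
    also have "\<dots> = (measure \<theta> (V n) - (\<integral>x. ?l x \<partial>\<theta>)) + (measure \<theta> U - measure \<theta> (V n)) + (measure \<theta> U - measure \<theta> E)"
      using li ii by (simp add: s\<theta>)
    also have "\<dots> < e" using Um n k by linarith
    finally have "(\<integral>x. \<bar>?l x - indicator E x\<bar> \<partial>\<theta>) < e" .
    moreover have "?l \<in> \<Lambda>"
    proof -
      have "V n = \<Union>((B ` {..n}) - {{}})" by (auto simp: V_def)
      moreover have "(B ` {..n}) - {{}} \<subseteq> \<B>" using Bi by auto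
      ultimately show ?thesis unfolding \<Lambda>_def by (intro image_eqI[of _ _ "((B ` {..n}) - {{}}, k)"]) auto
    qed
    ultimately show "\<exists>l\<in>\<Lambda>. (\<integral>x. \<bar>l x - indicator E x\<bar> \<partial>\<theta>) < e" by blast
  qed
qed

text \<open>With \<open>E\<close> the set where \<open>v \<le> u\<close>, the error equals
  \<open>(u - v) * (l - indicator E)\<close>. Its L1 norm is therefore the distance of
  \<open>l\<close> from the indicator of \<open>E\<close> under the measure with density
  \<open>\<bar>u - v\<bar>\<close>, which is finite even if \<open>m\<close> is not.\<close>

lemma integral_mix_max_less:
  fixes u v :: "'a::polish_space \<Rightarrow> real"
  assumes \<Lambda>: "\<And>l. l \<in> \<Lambda> \<Longrightarrow> continuous_on UNIV l"
    and approx: "\<And>\<theta> E e. finite_measure \<theta> \<Longrightarrow> sets \<theta> = sets borel \<Longrightarrow> E \<in> sets borel \<Longrightarrow> 0 < e \<Longrightarrow>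
       \<exists>l\<in>\<Lambda>. (\<integral>x. \<bar>l x - indicator E x\<bar> \<partial>\<theta>) < e"
    and sm[measurable_cong]: "sets m = sets borel" and u: "integrable m u" and v: "integrable m v" and "0 < e"
  shows "\<exists>l\<in>\<Lambda>. (\<integral>x. \<bar>l x * u x + (1 - l x) * v x - max (v x) (u x)\<bar> \<partial>m) < e"
proof -
  define \<theta> where "\<theta> = density m (\<lambda>x. ennreal \<bar>u x - v x\<bar>)"
  have [measurable]: "u \<in> borel_measurable m" "v \<in> borel_measurable m" using u v by auto
  define E where "E = {x. v x \<le> u x}"
  have "space m = UNIV" using sets_eq_imp_space_eq[OF sm] by simp
  then have E[measurable]: "E \<in> sets borel"
    using measurable_sets[of "\<lambda>x. u x - v x" m borel "{0..}"] by (simp add: E_def vimage_def sm)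
  have "integrable m (\<lambda>x. \<bar>u x - v x\<bar>)" using u v by simp
  then have "(\<integral>\<^sup>+x. ennreal \<bar>u x - v x\<bar> \<partial>m) < \<infinity>" by (simp add: real_integrable_def less_top)
  then have "finite_measure \<theta>" unfolding \<theta>_def
    by (intro finite_measureI) (simp add: emeasure_density cong: nn_integral_cong)
  moreover have "sets \<theta> = sets borel" by (simp add: \<theta>_def sm)
  ultimately obtain l where l: "l \<in> \<Lambda>" "(\<integral>x. \<bar>l x - indicator E x\<bar> \<partial>\<theta>) < e"
    using approx E \<open>0 < e\<close> by blast
  have [measurable]: "l \<in> borel_measurable borel" using \<Lambda>[OF l(1)] by (rule borel_measurable_continuous_onI)
  have "(\<integral>x. \<bar>l x - indicator E x\<bar> \<partial>\<theta>) = (\<integral>x. \<bar>u x - v x\<bar> * \<bar>l x - indicator E x\<bar> \<partial>m)"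
    unfolding \<theta>_def by (subst integral_density) auto
  also have "\<dots> = (\<integral>x. \<bar>l x * u x + (1 - l x) * v x - max (v x) (u x)\<bar> \<partial>m)"
  proof (rule Bochner_Integration.integral_cong)
    fix x
    have "\<bar>u x - v x\<bar> * \<bar>l x - indicator E x\<bar> = \<bar>(u x - v x) * (l x - indicator E x)\<bar>" by (simp add: abs_mult)
    also have "(u x - v x) * (l x - indicator E x) = l x * u x + (1 - l x) * v x - max (v x) (u x)"
      by (cases "x \<in> E") (auto simp: E_def max_def algebra_simps)
    finally show "\<bar>u x - v x\<bar> * \<bar>l x - indicator E x\<bar> = \<bar>l x * u x + (1 - l x) * v x - max (v x) (u x)\<bar>" .
  qed simp
  finally show ?thesis using l by auto
qed

subsection \<open>Decomposition of a plan\<close>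

text \<open>\<open>RN_deriv\<close> takes extended values and is finite only almost everywhere. The
  real version \<open>h\<close> changes it on a \<open>\<mu>\<close>-null set, which no integral
  against \<open>\<mu>\<close> notices.\<close>

lemma marg1_decomposition:
  fixes \<rho> \<mu> :: "'x::topological_space measure"
  assumes \<mu>: "finite_measure \<mu>" "sets \<mu> = sets borel" and \<rho>: "finite_measure \<rho>" "sets \<rho> = sets borel"
  obtains h N where "h \<in> borel_measurable borel" "\<And>x. 0 \<le> h x" "integrable \<mu> h"
    "AE x in \<mu>. RN_deriv \<mu> (ac_part \<mu> \<rho>) x = ennreal (h x)"
    "sets (sing_part \<mu> \<rho>) = sets borel" "finite_measure (sing_part \<mu> \<rho>)"
    "N \<in> sets borel" "AE x in \<mu>. x \<notin> N" "AE x in sing_part \<mu> \<rho>. x \<in> N"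
    "\<rho> = add_measure (density \<mu> (\<lambda>x. ennreal (h x))) (sing_part \<mu> \<rho>)"
proof -
  define \<alpha> where "\<alpha> = ac_part \<mu> \<rho>"
  define \<sigma> where "\<sigma> = sing_part \<mu> \<rho>"
  interpret \<mu>: finite_measure \<mu> by fact
  interpret \<rho>: finite_measure \<rho> by fact
  have "is_lebesgue_decomposition \<mu> \<rho> \<alpha> \<sigma>"
    unfolding \<alpha>_def \<sigma>_def by (rule is_lebesgue_decomposition_parts) (simp_all add: assms)
  then obtain N where s: "sets \<alpha> = sets \<mu>" "sets \<sigma> = sets \<mu>"
    and sum: "\<And>A. A \<in> sets \<mu> \<Longrightarrow> emeasure \<rho> A = emeasure \<alpha> A + emeasure \<sigma> A"
    and ac: "absolutely_continuous \<mu> \<alpha>"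
    and N: "N \<in> sets \<mu>" "emeasure \<mu> N = 0" "emeasure \<sigma> (space \<mu> - N) = 0"
    by (auto simp: is_lebesgue_decomposition_def)
  have sp: "space \<alpha> = space \<mu>" "space \<sigma> = space \<mu>" using s by (auto dest: sets_eq_imp_space_eq)
  have "emeasure \<rho> (space \<mu>) \<noteq> \<infinity>" by simp
  then have "emeasure \<alpha> (space \<mu>) \<noteq> \<infinity>" "emeasure \<sigma> (space \<mu>) \<noteq> \<infinity>" using sum[of "space \<mu>"] by auto
  then have fin: "finite_measure \<alpha>" "finite_measure \<sigma>" by (auto intro!: finite_measureI simp: sp)
  define h where "h x = enn2real (RN_deriv \<mu> \<alpha> x)" for x
  have RN: "AE x in \<mu>. RN_deriv \<mu> \<alpha> x = ennreal (h x)"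
    using \<mu>.RN_deriv_finite[OF finite_measure.axioms(1)[OF fin(1)] ac s(1)]
    by eventually_elim (simp add: h_def less_top)
  have dh: "density \<mu> (\<lambda>x. ennreal (h x)) = \<alpha>"
    using RN by (subst \<mu>.density_RN_deriv[OF ac s(1), symmetric], intro density_cong) (auto simp: h_def)
  have hm: "h \<in> borel_measurable \<mu>" unfolding h_def by measurable
  have "(\<integral>\<^sup>+x. ennreal (h x) \<partial>\<mu>) = emeasure \<alpha> (space \<mu>)"
    using hm by (subst dh[symmetric]) (simp add: emeasure_density cong: nn_integral_cong)
  then have hi: "integrable \<mu> h" using \<open>emeasure \<alpha> (space \<mu>) \<noteq> \<infinity>\<close> hm
    by (intro integrableI_nonneg) (auto simp: h_def less_top)
  show ?thesis
  proof (rule that[of h N])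
    show "h \<in> borel_measurable borel" using hm by (simp add: measurable_cong_sets[OF \<mu>(2) refl])
    show "0 \<le> h x" for x by (simp add: h_def)
    show "AE x in \<mu>. x \<notin> N" using N by (intro AE_not_in) auto
    show "AE x in sing_part \<mu> \<rho>. x \<in> N"
      unfolding \<sigma>_def[symmetric] using N s by (intro AE_I[of _ _ "space \<mu> - N"]) (auto simp: sp)
    show "\<rho> = add_measure (density \<mu> (\<lambda>x. ennreal (h x))) (sing_part \<mu> \<rho>)"
      unfolding dh \<sigma>_def[symmetric]
      by (rule measure_eqI) (auto simp: emeasure_add_measure s sum assms)
  qed (use RN hi N fin s in \<open>simp_all add: \<alpha>_def[symmetric] \<sigma>_def[symmetric] \<mu>(2)\<close>)
qed

lemma SUP_Max_image:
  fixes f :: "nat \<Rightarrow> real"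
  shows "(SUP n. ereal (Max (f ` {..n}))) = (SUP k. ereal (f k))"
proof (rule antisym)
  show "(SUP n. ereal (Max (f ` {..n}))) \<le> (SUP k. ereal (f k))"
  proof (rule SUP_least)
    fix n
    have "Max (f ` {..n}) \<in> f ` {..n}" by (rule Max_in) auto
    then obtain k where "Max (f ` {..n}) = f k" by (rule imageE)
    then show "ereal (Max (f ` {..n})) \<le> (SUP k. ereal (f k))" by (auto intro: SUP_upper)
  qed
  show "(SUP k. ereal (f k)) \<le> (SUP n. ereal (Max (f ` {..n})))"
  proof (rule SUP_mono)
    show "\<exists>n\<in>UNIV. ereal (f k) \<le> ereal (Max (f ` {..n}))" for k
      by (intro bexI[of _ k]) auto
  qed
qed

lemma Max_image_Suc:
  fixes f :: "nat \<Rightarrow> real"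
  shows "Max (f ` {..Suc n}) = max (Max (f ` {..n})) (f (Suc n))"
  by (simp add: atMost_Suc max.commute)

lemma integrable_Max_image:
  fixes f :: "nat \<Rightarrow> 'a \<Rightarrow> real"
  assumes "\<And>k. integrable M (f k)"
  shows "integrable M (\<lambda>x. Max ((\<lambda>k. f k x) ` {..n}))"
  by (induction n) (simp_all add: assms Max_image_Suc)

context sup_cost
begin

subsection \<open>The recession function\<close>

lemma null_measure_fin: "null_measure borel \<in> fin_measures"
  by (auto simp: fin_measures_def intro!: finite_measureI)

lemma scale_fin:
  assumes "m \<in> fin_measures"
  shows "scale_measure (ennreal l) m \<in> fin_measures"
  using assms finite_measure_scale_measure by (auto simp: fin_measures_def)

lemma integral_scale_section:
  assumes "m \<in> fin_measures" "0 \<le> l"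
  shows "(\<integral>y. b k (x, y) \<partial>scale_measure (ennreal l) m) = l * (\<integral>y. b k (x, y) \<partial>m)"
  using integrable_section[OF assms(1) cont_b] assms by (intro integral_scale_measure) auto

text \<open>Along the ray through \<open>m\<close> the \<open>k\<close>-th affine function divided
  by \<open>l\<close> is its slope plus \<open>a k x / l\<close>. The lower bound needs one
  \<open>k\<close> at a time, the upper bound a bound on \<open>a k x\<close> uniform in
  \<open>k\<close>.\<close>

lemma recession_eq:
  assumes m: "m \<in> fin_measures"
  shows "recession c x m = (SUP k. ereal (\<integral>y. b k (x, y) \<partial>m))"
proof -
  define I where "I k = (\<integral>y. b k (x, y) \<partial>m)" for k
  \<comment> \<open>The value at the null measure is finite because costs are real, and it dominates
    every \<open>a k x\<close>; this is the uniform bound.\<close>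
  define s where "s = c x (null_measure borel)"
  have s: "a k x \<le> s" for k
  proof -
    have "(\<integral>y. b k (x, y) \<partial>null_measure borel) = 0"
      by (intro integral_eq_zero_AE AE_I[of _ _ UNIV]) auto
    then show ?thesis using c_ge[OF null_measure_fin, where k=k and x=x] by (simp add: s_def)
  qed
  have low: "I k + a k x / l \<le> c x (scale_measure (ennreal l) m) / l" if "0 < l" for k l
  proof -
    have "(l * I k + a k x) / l \<le> c x (scale_measure (ennreal l) m) / l"
      using c_ge[OF scale_fin[OF m, of l], where k=k and x=x] that m
      by (intro divide_right_mono) (simp_all add: integral_scale_section I_def)
    then show ?thesis using that by (simp add: add_divide_distrib)
  qed
  have up: "c x (scale_measure (ennreal l) m) / l \<le> r + s / l" if "0 < l" "\<And>k. I k \<le> r" for r l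
  proof -
    have "c x (scale_measure (ennreal l) m) \<le> l * r + s"
      using that s m by (intro c_le scale_fin) (auto simp: integral_scale_section I_def[symmetric] intro!: add_mono mult_left_mono)
    then have "c x (scale_measure (ennreal l) m) / l \<le> (l * r + s) / l"
      using that(1) by (intro divide_right_mono) auto
    then show ?thesis using that(1) by (simp add: add_divide_distrib)
  qed
  have lim0: "((\<lambda>l. r + d / l) \<longlongrightarrow> r) at_top" for r d :: real
    using tendsto_add[OF tendsto_const
        tendsto_divide_0[OF tendsto_const filterlim_at_top_imp_at_infinity[OF filterlim_ident]], of r d] by simp
  have "((\<lambda>l. ereal (c x (scale_measure (ennreal l) m) / l)) \<longlongrightarrow> (SUP k. ereal (I k))) at_top"
  proof (rule order_tendstoI)
    fix y assume "y < (SUP k. ereal (I k))"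
    then obtain k where k: "y < ereal (I k)" by (auto simp: less_SUP_iff)
    have "((\<lambda>l. ereal (I k + a k x / l)) \<longlongrightarrow> ereal (I k)) at_top" by (intro tendsto_intros lim0)
    from order_tendstoD(1)[OF this k] eventually_gt_at_top[of 0]
    show "\<forall>\<^sub>F l in at_top. y < ereal (c x (scale_measure (ennreal l) m) / l)"
      by eventually_elim (use low in \<open>auto intro: less_le_trans\<close>)
  next
    fix y assume y: "(SUP k. ereal (I k)) < y"
    then obtain r where r: "(SUP k. ereal (I k)) < ereal r" "ereal r < y"
      using ereal_dense2 by blast
    have Ir: "I k \<le> r" for k
      using le_less_trans[OF SUP_upper[of k UNIV "\<lambda>k. ereal (I k)"] r(1)] by simp
    have "((\<lambda>l. ereal (r + s / l)) \<longlongrightarrow> ereal r) at_top" by (intro tendsto_intros lim0)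
    from order_tendstoD(2)[OF this r(2)] eventually_gt_at_top[of 0]
    show "\<forall>\<^sub>F l in at_top. ereal (c x (scale_measure (ennreal l) m) / l) < y"
    proof eventually_elim
      case (elim l)
      have "ereal (c x (scale_measure (ennreal l) m) / l) \<le> ereal (r + s / l)"
        using up[OF elim(2) Ir] by simp
      then show ?case using elim(1) by (rule le_less_trans)
    qed
  qed
  then show ?thesis unfolding recession_def I_def by (intro tendsto_Lim) auto
qed

subsection \<open>Mixtures of the defining minorants\<close>

text \<open>The recursion copies that of the running maximum: a single weight decides between the
  new minorant and a mixture of the earlier ones, so that only two-fold choices ever have to be
  approximated.\<close>

primrec mixtures :: "('x \<Rightarrow> real) set \<Rightarrow> nat \<Rightarrow> (('x \<Rightarrow> real) \<times> ('x \<times> 'y \<Rightarrow> real)) set" where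
  "mixtures \<Lambda> 0 = {(a 0, b 0)}"
| "mixtures \<Lambda> (Suc n) = (\<lambda>(l, g). (\<lambda>x. l x * a (Suc n) x + (1 - l x) * fst g x,
     \<lambda>z. l (fst z) * b (Suc n) z + (1 - l (fst z)) * snd g z)) ` (\<Lambda> \<times> mixtures \<Lambda> n)"

lemma countable_mixtures: "countable \<Lambda> \<Longrightarrow> countable (mixtures \<Lambda> n)"
  by (induction n) auto

lemma mixtures_minorants:
  assumes "\<And>l. l \<in> \<Lambda> \<Longrightarrow> continuous_on UNIV l" "\<And>l x. l \<in> \<Lambda> \<Longrightarrow> 0 \<le> l x" "\<And>l x. l \<in> \<Lambda> \<Longrightarrow> l x \<le> 1"
  shows "mixtures \<Lambda> n \<subseteq> minorants c"
proof (induction n)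
  case 0
  then show ?case using minorant_ab by simp
next
  case (Suc n)
  show ?case
  proof
    fix k assume "k \<in> mixtures \<Lambda> (Suc n)"
    then obtain l g where l: "l \<in> \<Lambda>" and g: "g \<in> mixtures \<Lambda> n"
      and k: "k = (\<lambda>x. l x * a (Suc n) x + (1 - l x) * fst g x, \<lambda>z. l (fst z) * b (Suc n) z + (1 - l (fst z)) * snd g z)"
      by auto
    have "(fst g, snd g) \<in> minorants c" using g Suc by auto
    then show "k \<in> minorants c" unfolding k using assms l by (intro minorants_mix minorant_ab) auto
  qed
qed

text \<open>Any evaluation \<open>W\<close> that commutes with mixing turns a well-chosen mixture
  into nearly the maximum of the evaluated minorants. Half of the error goes to the mixture of the
  first \<open>n\<close>, half to the new weight.\<close>

lemma mixtures_approximate_Max: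
  fixes W :: "('x \<Rightarrow> real) \<times> ('x \<times> 'y \<Rightarrow> real) \<Rightarrow> 'x \<Rightarrow> real"
  assumes \<Lambda>: "\<And>l. l \<in> \<Lambda> \<Longrightarrow> continuous_on UNIV l" "\<And>l x. l \<in> \<Lambda> \<Longrightarrow> 0 \<le> l x" "\<And>l x. l \<in> \<Lambda> \<Longrightarrow> l x \<le> 1"
    and approx: "\<And>\<theta> E e. finite_measure \<theta> \<Longrightarrow> sets \<theta> = sets borel \<Longrightarrow> E \<in> sets borel \<Longrightarrow> 0 < e \<Longrightarrow>
       \<exists>l\<in>\<Lambda>. (\<integral>x. \<bar>l x - indicator E x\<bar> \<partial>\<theta>) < e"
    and sm: "sets m = sets borel" and W: "\<And>g. g \<in> minorants c \<Longrightarrow> integrable m (W g)"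
    and mix: "\<And>l g k x. l \<in> \<Lambda> \<Longrightarrow> g \<in> minorants c \<Longrightarrow>
       W (\<lambda>x. l x * a k x + (1 - l x) * fst g x, \<lambda>z. l (fst z) * b k z + (1 - l (fst z)) * snd g z) x
       = l x * W (a k, b k) x + (1 - l x) * W g x"
    and "0 < e"
  shows "\<exists>g\<in>mixtures \<Lambda> n. (\<integral>x. \<bar>W g x - Max ((\<lambda>k. W (a k, b k) x) ` {..n})\<bar> \<partial>m) < e"
  using \<open>0 < e\<close>
proof (induction n arbitrary: e)
  case 0
  then show ?case by simp
next
  case (Suc n)
  have mm: "mixtures \<Lambda> n \<subseteq> minorants c" for n
    using \<Lambda> by (rule mixtures_minorants)
  define M where "M n x = Max ((\<lambda>k. W (a k, b k) x) ` {..n})" for n x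
  have M: "integrable m (M n)" for n unfolding M_def by (intro integrable_Max_image W minorant_ab)
  have MSuc: "M (Suc n) x = max (M n x) (W (a (Suc n), b (Suc n)) x)" for x
    unfolding M_def by (rule Max_image_Suc)
  obtain g where g: "g \<in> mixtures \<Lambda> n" "(\<integral>x. \<bar>W g x - M n x\<bar> \<partial>m) < e / 2"
    using Suc.IH[of "e/2"] Suc.prems by (auto simp: M_def)
  have gm: "g \<in> minorants c" using g(1) mm by blast
  have "0 < e / 2" using Suc.prems by simp
  then have "\<exists>l\<in>\<Lambda>. (\<integral>x. \<bar>l x * W (a (Suc n), b (Suc n)) x + (1 - l x) * W g x
      - max (W g x) (W (a (Suc n), b (Suc n)) x)\<bar> \<partial>m) < e / 2"
    by (intro integral_mix_max_less[where \<Lambda>=\<Lambda>] sm W minorant_ab gm approx) (auto intro: \<Lambda>)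
  then obtain l where l: "l \<in> \<Lambda>" "(\<integral>x. \<bar>l x * W (a (Suc n), b (Suc n)) x + (1 - l x) * W g x
      - max (W g x) (W (a (Suc n), b (Suc n)) x)\<bar> \<partial>m) < e / 2"
    by (rule bexE)
  let ?k = "(\<lambda>x. l x * a (Suc n) x + (1 - l x) * fst g x, \<lambda>z. l (fst z) * b (Suc n) z + (1 - l (fst z)) * snd g z)"
  have k: "?k \<in> mixtures \<Lambda> (Suc n)" using l g by (auto intro!: image_eqI[of _ _ "(l, g)"])
  then have km: "?k \<in> minorants c" using mm by blast
  \<comment> \<open>The maximum with a fixed number is 1-Lipschitz, so replacing \<open>M n\<close>
    by \<open>W g\<close> inside it costs no more than their distance.\<close>
  have "(\<integral>x. \<bar>W ?k x - M (Suc n) x\<bar> \<partial>m) \<le> (\<integral>x. \<bar>W ?k x - max (W g x) (W (a (Suc n), b (Suc n)) x)\<bar> + \<bar>W g x - M n x\<bar> \<partial>m)"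
    unfolding MSuc using W[OF km] W[OF gm] W[OF minorant_ab] M
    by (intro integral_mono integrable_abs Bochner_Integration.integrable_add Bochner_Integration.integrable_diff integrable_max) auto
  also have "\<dots> = (\<integral>x. \<bar>W ?k x - max (W g x) (W (a (Suc n), b (Suc n)) x)\<bar> \<partial>m) + (\<integral>x. \<bar>W g x - M n x\<bar> \<partial>m)"
    using W[OF km] W[OF gm] W[OF minorant_ab] M
    by (intro Bochner_Integration.integral_add integrable_abs Bochner_Integration.integrable_diff integrable_max) auto
  also have "\<dots> < e" using l(2) g(2) unfolding mix[OF l(1) gm] by linarith
  finally show ?case using k unfolding M_def by blast
qed

end

context sup_cost
begin

subsection \<open>The relaxed cost is bounded by the values of the minorants\<close>

lemma disintegration_kernel:
  assumes "is_disintegration (\<pi> :: ('x \<times> 'y) measure) \<kappa>"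
  shows "\<kappa> \<in> borel \<rightarrow>\<^sub>M subprob_algebra borel" "prob_space (\<kappa> x)" "sets (\<kappa> x) = sets borel" "\<kappa> x \<in> fin_measures"
proof -
  have \<kappa>: "\<kappa> \<in> borel \<rightarrow>\<^sub>M prob_algebra borel" using assms by (simp add: is_disintegration_def)
  then show "\<kappa> \<in> borel \<rightarrow>\<^sub>M subprob_algebra borel" by (rule measurable_prob_algebraD)
  show p: "prob_space (\<kappa> x)" "sets (\<kappa> x) = sets borel"
    using measurable_space[OF \<kappa>, of x] by (simp_all add: space_prob_algebra)
  then show "\<kappa> x \<in> fin_measures" by (simp add: fin_measures_def prob_space.finite_measure)
qed

lemma section_integral_bounded:
  fixes B :: "'x \<times> 'y \<Rightarrow> real"
  assumes d: "is_disintegration (\<pi> :: ('x \<times> 'y) measure) \<kappa>" and B: "continuous_on UNIV B" "\<And>z. \<bar>B z\<bar> \<le> C"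
  shows "\<bar>\<integral>y. B (x, y) \<partial>\<kappa> z\<bar> \<le> C"
proof -
  interpret prob_space "\<kappa> z" by (rule disintegration_kernel[OF d])
  have i: "integrable (\<kappa> z) (\<lambda>y. B (x, y))" by (rule integrable_section[OF disintegration_kernel(4)[OF d] B(1)])
  have "\<bar>\<integral>y. B (x, y) \<partial>\<kappa> z\<bar> \<le> (\<integral>y. \<bar>B (x, y)\<bar> \<partial>\<kappa> z)" by (rule integral_abs_bound)
  also have "\<dots> \<le> (\<integral>y. C \<partial>\<kappa> z)" using i B(2) by (intro integral_mono) auto
  finally show ?thesis by (simp add: prob_space)
qed

lemma section_integral_measurable:
  fixes B :: "'x \<times> 'y \<Rightarrow> real"
  assumes d: "is_disintegration (\<pi> :: ('x \<times> 'y) measure) \<kappa>" and B: "continuous_on UNIV B"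
  shows "(\<lambda>x. \<integral>y. B (x, y) \<partial>\<kappa> x) \<in> borel_measurable borel"
  using borel_measurable_continuous_onI[OF B]
  by (intro integral_measurable_subprob_algebra2[where N=borel] disintegration_kernel(1)[OF d]) (simp add: borel_prod)

lemma plan_integral:
  fixes \<mu> \<sigma> :: "'x measure" and \<pi> :: "('x \<times> 'y) measure"
  assumes \<mu>: "finite_measure \<mu>" "sets \<mu> = sets borel" and \<sigma>: "finite_measure \<sigma>" "sets \<sigma> = sets borel"
    and h: "h \<in> borel_measurable borel" "\<And>x. 0 \<le> h x" "integrable \<mu> h"
    and m: "marg1 \<pi> = add_measure (density \<mu> (\<lambda>x. ennreal (h x))) \<sigma>"
    and \<pi>: "\<pi> \<in> prob_measures" and d: "is_disintegration \<pi> \<kappa>" and B: "continuous_on UNIV (B :: _ \<Rightarrow> real)"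
  shows "integrable \<mu> (\<lambda>x. h x * (\<integral>y. B (x, y) \<partial>\<kappa> x))" "integrable \<sigma> (\<lambda>x. \<integral>y. B (x, y) \<partial>\<kappa> x)"
    "(\<integral>z. B z \<partial>\<pi>) = (\<integral>x. h x * (\<integral>y. B (x, y) \<partial>\<kappa> x) \<partial>\<mu>) + (\<integral>x. (\<integral>y. B (x, y) \<partial>\<kappa> x) \<partial>\<sigma>)"
proof -
  obtain C where C: "0 \<le> C" "\<And>z. \<bar>B z\<bar> \<le> C" by (rule bounded_continuous_XY[OF B], rule that)
  define V where "V x = (\<integral>y. B (x, y) \<partial>\<kappa> x)" for x
  have V: "\<bar>V x\<bar> \<le> C" for x unfolding V_def by (rule section_integral_bounded[OF d B C(2)])
  have [measurable]: "V \<in> borel_measurable borel"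
    using section_integral_measurable[OF d B] by (simp add: V_def[abs_def])
  note [measurable_cong] = \<mu>(2) \<sigma>(2) and [measurable] = h(1)
  have "integrable \<mu> (\<lambda>x. h x * C)" using h(3) by simp
  then have i1: "integrable \<mu> (\<lambda>x. h x * V x)"
    by (rule Bochner_Integration.integrable_bound) (use h(2) V C(1) in \<open>auto simp: abs_mult intro!: mult_left_mono AE_I2\<close>)
  then have i1': "integrable (density \<mu> (\<lambda>x. ennreal (h x))) V"
    using h(2) by (subst integrable_density) auto
  have i2: "integrable \<sigma> V"
    using V by (intro finite_measure.integrable_const_bound[OF \<sigma>(1), where B=C]) auto
  show "integrable \<mu> (\<lambda>x. h x * (\<integral>y. B (x, y) \<partial>\<kappa> x))" "integrable \<sigma> (\<lambda>x. \<integral>y. B (x, y) \<partial>\<kappa> x)"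
    using i1 i2 by (simp_all add: V_def[abs_def])
  have "(\<integral>z. B z \<partial>\<pi>) = (\<integral>x. V x \<partial>marg1 \<pi>)"
    unfolding V_def by (rule disintegration_integral[OF d \<pi> borel_measurable_continuous_onI[OF B] C(2)])
  also have "\<dots> = (\<integral>x. V x \<partial>density \<mu> (\<lambda>x. ennreal (h x))) + (\<integral>x. V x \<partial>\<sigma>)"
    unfolding m by (rule integral_add_measure[OF _ i1' i2]) (simp add: \<mu> \<sigma>)
  also have "(\<integral>x. V x \<partial>density \<mu> (\<lambda>x. ennreal (h x))) = (\<integral>x. h x * V x \<partial>\<mu>)"
    using h(2) by (subst integral_density) auto
  finally show "(\<integral>z. B z \<partial>\<pi>) = (\<integral>x. h x * (\<integral>y. B (x, y) \<partial>\<kappa> x) \<partial>\<mu>) + (\<integral>x. (\<integral>y. B (x, y) \<partial>\<kappa> x) \<partial>\<sigma>)"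
    by (simp add: V_def)
qed

text \<open>Since \<open>\<mu>\<close> lives off \<open>N\<close> and \<open>\<sigma>\<close> on
  \<open>N\<close>, both integrands are glued into one function on the sum of the two measures. A
  single approximation there produces the maximum for \<open>\<mu>\<close> and the different maximum
  for \<open>\<sigma>\<close> simultaneously.\<close>

lemma relaxed_Max_le:
  fixes \<mu> \<sigma> :: "'x measure" and \<pi> :: "('x \<times> 'y) measure"
  assumes \<Lambda>: "\<And>l. l \<in> \<Lambda> \<Longrightarrow> continuous_on UNIV l" "\<And>l x. l \<in> \<Lambda> \<Longrightarrow> 0 \<le> l x" "\<And>l x. l \<in> \<Lambda> \<Longrightarrow> l x \<le> 1"
    and approx: "\<And>\<theta> E e. finite_measure \<theta> \<Longrightarrow> sets \<theta> = sets borel \<Longrightarrow> E \<in> sets borel \<Longrightarrow> 0 < e \<Longrightarrow>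
       \<exists>l\<in>\<Lambda>. (\<integral>x. \<bar>l x - indicator E x\<bar> \<partial>\<theta>) < e"
    and \<mu>: "finite_measure \<mu>" "sets \<mu> = sets borel" and \<sigma>: "finite_measure \<sigma>" "sets \<sigma> = sets borel"
    and h: "h \<in> borel_measurable borel" "\<And>x. 0 \<le> h x" "integrable \<mu> h"
    and m: "marg1 \<pi> = add_measure (density \<mu> (\<lambda>x. ennreal (h x))) \<sigma>"
    and N: "N \<in> sets borel" "AE x in \<mu>. x \<notin> N" "AE x in \<sigma>. x \<in> N"
    and \<pi>: "\<pi> \<in> prob_measures" and d: "is_disintegration \<pi> \<kappa>"
    and t: "\<And>n g. g \<in> mixtures \<Lambda> n \<Longrightarrow> (\<integral>z. snd g z \<partial>\<pi>) + (\<integral>x. fst g x \<partial>\<mu>) \<le> t"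
  shows "(\<integral>x. Max ((\<lambda>k. h x * (\<integral>y. b k (x, y) \<partial>\<kappa> x) + a k x) ` {..n}) \<partial>\<mu>)
       + (\<integral>x. Max ((\<lambda>k. \<integral>y. b k (x, y) \<partial>\<kappa> x) ` {..n}) \<partial>\<sigma>) \<le> t"
proof -
  note pl = plan_integral[OF \<mu> \<sigma> h m \<pi> d]
  note [measurable_cong] = \<mu>(2) \<sigma>(2) and [measurable] = h(1) N(1)
  define m where "m = add_measure \<mu> \<sigma>"
  have sm: "sets m = sets borel" by (simp add: m_def \<mu>)
  define u where "u g x = h x * (\<integral>y. snd g (x, y) \<partial>\<kappa> x) + fst g x" for g :: "('x \<Rightarrow> real) \<times> ('x \<times> 'y \<Rightarrow> real)" and x
  define v where "v g x = (\<integral>y. snd g (x, y) \<partial>\<kappa> x)" for g :: "('x \<Rightarrow> real) \<times> ('x \<times> 'y \<Rightarrow> real)" and x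
  \<comment> \<open>On \<open>N\<close> the \<open>fst g\<close> term is absent, because that
    component of a minorant is integrated against \<open>\<mu>\<close> only; this is why the
    singular part ends up with the recession function.\<close>
  define W where "W g x = (if x \<in> N then v g x else u g x)" for g x
  have cont: "continuous_on UNIV (fst g)" "continuous_on UNIV (snd g)" if "g \<in> minorants c" for g
    using that by (auto simp: minorants_def)
  have iu: "integrable \<mu> (u g)" if "g \<in> minorants c" for g
    unfolding u_def using pl(1)[OF cont(2)[OF that]] integrable_continuous_X[OF \<mu> cont(1)[OF that]] by simp
  have iv: "integrable \<sigma> (v g)" if "g \<in> minorants c" for g
    unfolding v_def by (rule pl(2)[OF cont(2)[OF that]])
  have glue: "integrable m (\<lambda>x. if x \<in> N then q x else p x) \<and>
      (\<integral>x. (if x \<in> N then q x else p x) \<partial>m) = (\<integral>x. p x \<partial>\<mu>) + (\<integral>x. q x \<partial>\<sigma>)"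
    if "integrable \<mu> p" "integrable \<sigma> q" for p q :: "'x \<Rightarrow> real"
  proof -
    have [measurable]: "p \<in> borel_measurable borel" "q \<in> borel_measurable borel"
      using that[THEN borel_measurable_integrable]
      by (simp_all add: measurable_cong_sets[OF \<mu>(2) refl] measurable_cong_sets[OF \<sigma>(2) refl])
    have "AE x in \<mu>. (if x \<in> N then q x else p x) = p x"
      using N(2) by eventually_elim simp
    note ae = this
    have "integrable \<mu> (\<lambda>x. if x \<in> N then q x else p x)"
      by (rule integrable_cong_AE[THEN iffD2, OF _ _ ae that(1)]) measurable
    moreover have "(\<integral>x. (if x \<in> N then q x else p x) \<partial>\<mu>) = (\<integral>x. p x \<partial>\<mu>)"
      by (rule integral_cong_AE[OF _ _ ae]) measurable
    moreover have "AE x in \<sigma>. (if x \<in> N then q x else p x) = q x"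
      using N(3) by eventually_elim simp
    note ae = this
    have "integrable \<sigma> (\<lambda>x. if x \<in> N then q x else p x)"
      by (rule integrable_cong_AE[THEN iffD2, OF _ _ ae that(2)]) measurable
    moreover have "(\<integral>x. (if x \<in> N then q x else p x) \<partial>\<sigma>) = (\<integral>x. q x \<partial>\<sigma>)"
      by (rule integral_cong_AE[OF _ _ ae]) measurable
    moreover have "sets \<sigma> = sets \<mu>" by (simp add: \<mu> \<sigma>)
    ultimately show ?thesis unfolding m_def by (simp add: integrable_add_measure integral_add_measure)
  qed
  have mixv: "v (\<lambda>x. l x * a k x + (1 - l x) * fst g x, \<lambda>z. l (fst z) * b k z + (1 - l (fst z)) * snd g z) x
      = l x * v (a k, b k) x + (1 - l x) * v g x" if "g \<in> minorants c" for l g k x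
    unfolding v_def using integrable_section[OF disintegration_kernel(4)[OF d] cont(2)[OF that]]
      integrable_section[OF disintegration_kernel(4)[OF d] cont_b] by simp
  have uv: "u g x = h x * v g x + fst g x" for g x by (simp add: u_def v_def)
  have mix: "W (\<lambda>x. l x * a k x + (1 - l x) * fst g x, \<lambda>z. l (fst z) * b k z + (1 - l (fst z)) * snd g z) x
       = l x * W (a k, b k) x + (1 - l x) * W g x" if "g \<in> minorants c" for l g k x
    unfolding W_def uv mixv[OF that] by (simp add: algebra_simps)
  have iW: "integrable m (W g)" if "g \<in> minorants c" for g
    unfolding W_def using glue[OF iu[OF that] iv[OF that]] by simp
  have Wint: "(\<integral>x. W g x \<partial>m) = (\<integral>z. snd g z \<partial>\<pi>) + (\<integral>x. fst g x \<partial>\<mu>)" if g: "g \<in> minorants c" for g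
  proof -
    have "(\<integral>x. W g x \<partial>m) = (\<integral>x. u g x \<partial>\<mu>) + (\<integral>x. v g x \<partial>\<sigma>)"
      unfolding W_def using glue[OF iu[OF g] iv[OF g]] by simp
    also have "(\<integral>x. u g x \<partial>\<mu>) = (\<integral>x. h x * (\<integral>y. snd g (x, y) \<partial>\<kappa> x) \<partial>\<mu>) + (\<integral>x. fst g x \<partial>\<mu>)"
      unfolding u_def using pl(1)[OF cont(2)[OF g]] integrable_continuous_X[OF \<mu> cont(1)[OF g]] by simp
    finally show ?thesis using pl(3)[OF cont(2)[OF g]] by (simp add: v_def)
  qed
  define M where "M x = Max ((\<lambda>k. W (a k, b k) x) ` {..n})" for x
  have iM: "integrable m M" unfolding M_def by (intro integrable_Max_image iW minorant_ab)
  have "(\<integral>x. M x \<partial>m) \<le> t + e" if "0 < e" for e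
  proof -
    have "\<exists>g\<in>mixtures \<Lambda> n. (\<integral>x. \<bar>W g x - M x\<bar> \<partial>m) < e"
      unfolding M_def using \<open>0 < e\<close> by (intro mixtures_approximate_Max sm iW mix approx) (auto intro: \<Lambda>)
    then obtain g where g: "g \<in> mixtures \<Lambda> n" "(\<integral>x. \<bar>W g x - M x\<bar> \<partial>m) < e" by (rule bexE)
    have gm: "g \<in> minorants c"
    proof -
      have "mixtures \<Lambda> n \<subseteq> minorants c" using \<Lambda> by (rule mixtures_minorants)
      then show ?thesis using g(1) by blast
    qed
    have "(\<integral>x. M x \<partial>m) \<le> (\<integral>x. W g x + \<bar>W g x - M x\<bar> \<partial>m)"
      using iM iW[OF gm] by (intro integral_mono) auto
    also have "\<dots> = (\<integral>x. W g x \<partial>m) + (\<integral>x. \<bar>W g x - M x\<bar> \<partial>m)"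
      using iM iW[OF gm] by (intro Bochner_Integration.integral_add) auto
    finally show ?thesis using g(2) t[OF g(1)] Wint[OF gm] by linarith
  qed
  then have "(\<integral>x. M x \<partial>m) \<le> t" by (rule field_le_epsilon)
  moreover have "M x = (if x \<in> N then Max ((\<lambda>k. v (a k, b k) x) ` {..n}) else Max ((\<lambda>k. u (a k, b k) x) ` {..n}))" for x
    by (simp add: M_def W_def)
  then have "(\<integral>x. M x \<partial>m) = (\<integral>x. Max ((\<lambda>k. u (a k, b k) x) ` {..n}) \<partial>\<mu>) + (\<integral>x. Max ((\<lambda>k. v (a k, b k) x) ` {..n}) \<partial>\<sigma>)"
    using glue[OF integrable_Max_image[of \<mu> "\<lambda>k. u (a k, b k)" n] integrable_Max_image[of \<sigma> "\<lambda>k. v (a k, b k)" n]]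
    by (simp add: iu iv minorant_ab)
  ultimately show ?thesis by (simp add: u_def v_def)
qed

lemma marg1_prob:
  assumes "\<pi> \<in> prob_measures"
  shows "marg1 (\<pi> :: ('x \<times> 'y) measure) \<in> prob_measures"
  unfolding marg1_def
  by (intro prob_measures_distr assms borel_measurable_continuous_onI continuous_on_fst continuous_on_id)

lemma cost_bar_decomposition:
  assumes \<mu>: "\<mu> \<in> prob_measures" and \<pi>: "(\<pi> :: ('x \<times> 'y) measure) \<in> prob_measures"
  obtains h N \<sigma> where "h \<in> borel_measurable borel" "\<And>x. 0 \<le> h x" "integrable \<mu> h"
    "sets \<sigma> = sets borel" "finite_measure \<sigma>"
    "N \<in> sets borel" "AE x in \<mu>. x \<notin> N" "AE x in \<sigma>. x \<in> N"
    "marg1 \<pi> = add_measure (density \<mu> (\<lambda>x. ennreal (h x))) \<sigma>"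
    "cost_bar c \<mu> \<pi> = ext_integral \<mu> (\<lambda>x. ereal (c x (scale_measure (ennreal (h x)) (disintegration \<pi> x))))
      + ext_integral \<sigma> (\<lambda>x. recession c x (disintegration \<pi> x))"
proof -
  have \<mu>': "finite_measure \<mu>" "sets \<mu> = sets borel" using \<mu> by (auto simp: prob_measures_def prob_space.finite_measure)
  have \<rho>: "finite_measure (marg1 \<pi>)" "sets (marg1 \<pi>) = sets borel"
    using marg1_prob[OF \<pi>] by (auto simp: prob_measures_def prob_space.finite_measure)
  define \<sigma> where "\<sigma> = sing_part \<mu> (marg1 \<pi>)"
  obtain h N where h: "h \<in> borel_measurable borel" "\<And>x. 0 \<le> h x" "integrable \<mu> h"
    and RN: "AE x in \<mu>. RN_deriv \<mu> (ac_part \<mu> (marg1 \<pi>)) x = ennreal (h x)"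
    and \<sigma>: "sets \<sigma> = sets borel" "finite_measure \<sigma>"
    and N: "N \<in> sets borel" "AE x in \<mu>. x \<notin> N" "AE x in \<sigma>. x \<in> N"
    and m: "marg1 \<pi> = add_measure (density \<mu> (\<lambda>x. ennreal (h x))) \<sigma>"
    by (rule marg1_decomposition[OF \<mu>' \<rho>, folded \<sigma>_def], rule that)
  have "cost_bar c \<mu> \<pi> = ext_integral \<mu> (\<lambda>x. ereal (c x (scale_measure (ennreal (h x)) (disintegration \<pi> x))))
      + ext_integral \<sigma> (\<lambda>x. recession c x (disintegration \<pi> x))"
    unfolding cost_bar_def \<sigma>_def
    using RN by (intro arg_cong2[where f="(+)"] ext_integral_cong_AE refl) (auto elim: eventually_mono)
  then show ?thesis by (rule that[OF h \<sigma> N m])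
qed

text \<open>Used with \<open>k = 0\<close>, this bounds the cost of the absolutely continuous part
  from below by an integrable function.\<close>

lemma density_cost_lower:
  assumes d: "is_disintegration (\<pi> :: ('x \<times> 'y) measure) \<kappa>" and h: "\<And>x. 0 \<le> h x"
  shows "h x * (\<integral>y. b k (x, y) \<partial>\<kappa> x) + a k x \<le> c x (scale_measure (ennreal (h x)) (\<kappa> x))"
  using c_ge[OF scale_fin[OF disintegration_kernel(4)[OF d, of x], of "h x"], where k=k and x=x] h[of x]
    disintegration_kernel(4)[OF d, of x] by (simp add: integral_scale_section)

text \<open>The plan is chosen for the mixtures of all levels at once. As the level grows, the
  maxima increase to the cost on the absolutely continuous part and to the recession function on the
  singular part, and monotone convergence gives \<open>cost_bar\<close>.\<close>

lemma relaxed_optimum: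
  assumes \<mu>: "\<mu> \<in> prob_measures" and \<nu>: "\<nu> \<in> prob_measures" and t: "dual_value c \<mu> \<nu> \<le> ereal t"
  obtains \<pi> where "\<pi> \<in> Pi_supp \<mu> \<nu>" "cost_bar c \<mu> \<pi> \<le> ereal t"
proof -
  obtain \<Lambda> :: "('x \<Rightarrow> real) set" where "countable \<Lambda>"
    and \<Lambda>: "\<And>l. l \<in> \<Lambda> \<Longrightarrow> continuous_on UNIV l" "\<And>l x. l \<in> \<Lambda> \<Longrightarrow> 0 \<le> l x" "\<And>l x. l \<in> \<Lambda> \<Longrightarrow> l x \<le> 1"
    and approx: "\<And>\<theta> E e. finite_measure \<theta> \<Longrightarrow> sets \<theta> = sets borel \<Longrightarrow> E \<in> sets borel \<Longrightarrow> 0 < e \<Longrightarrow>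
       \<exists>l\<in>\<Lambda>. (\<integral>x. \<bar>l x - indicator E x\<bar> \<partial>\<theta>) < e"
    by (rule countable_ramp_family, rule that)
  have "mixtures \<Lambda> n \<subseteq> minorants c" for n using \<Lambda> by (rule mixtures_minorants)
  then have "(\<Union>n. mixtures \<Lambda> n) \<subseteq> minorants c" by blast
  moreover have "countable (\<Union>n. mixtures \<Lambda> n)"
    by (intro countable_UN countable_mixtures \<open>countable \<Lambda>\<close>) auto
  moreover have "(a 0, b 0) \<in> (\<Union>n. mixtures \<Lambda> n)" by (rule UN_I[of 0]) auto
  ultimately obtain \<pi> where \<pi>S: "\<pi> \<in> Pi_supp \<mu> \<nu>"
    and le: "\<forall>g\<in>(\<Union>n. mixtures \<Lambda> n). (\<integral>z. snd g z \<partial>\<pi>) + (\<integral>x. fst g x \<partial>\<mu>) \<le> t"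
    using relaxed_solution[OF \<mu> \<nu> _ _ _ t] by blast
  have le: "(\<integral>z. snd g z \<partial>\<pi>) + (\<integral>x. fst g x \<partial>\<mu>) \<le> t" if "g \<in> mixtures \<Lambda> n" for n g
    using le that by blast
  have \<pi>: "\<pi> \<in> prob_measures" using \<pi>S by (simp add: Pi_supp_def)
  define \<kappa> where "\<kappa> = disintegration \<pi>"
  have d: "is_disintegration \<pi> \<kappa>" unfolding \<kappa>_def by (rule is_disintegration_disintegration[OF compact_Y \<pi>])
  have \<mu>': "finite_measure \<mu>" "sets \<mu> = sets borel" using \<mu> by (auto simp: prob_measures_def prob_space.finite_measure)
  obtain h N \<sigma> where h: "h \<in> borel_measurable borel" "\<And>x. 0 \<le> h x" "integrable \<mu> h"
    and \<sigma>: "sets \<sigma> = sets borel" "finite_measure \<sigma>"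
    and N: "N \<in> sets borel" "AE x in \<mu>. x \<notin> N" "AE x in \<sigma>. x \<in> N"
    and m: "marg1 \<pi> = add_measure (density \<mu> (\<lambda>x. ennreal (h x))) \<sigma>"
    and eq: "cost_bar c \<mu> \<pi> = ext_integral \<mu> (\<lambda>x. ereal (c x (scale_measure (ennreal (h x)) (\<kappa> x))))
      + ext_integral \<sigma> (\<lambda>x. recession c x (\<kappa> x))"
    by (rule cost_bar_decomposition[OF \<mu> \<pi>, folded \<kappa>_def], rule that)
  note pl = plan_integral[OF \<mu>' \<sigma>(2,1) h m \<pi> d]
  define U where "U n x = Max ((\<lambda>k. h x * (\<integral>y. b k (x, y) \<partial>\<kappa> x) + a k x) ` {..n})" for n x
  define V where "V n x = Max ((\<lambda>k. \<integral>y. b k (x, y) \<partial>\<kappa> x) ` {..n})" for n x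
  have UV: "(\<integral>x. U n x \<partial>\<mu>) + (\<integral>x. V n x \<partial>\<sigma>) \<le> t" for n
    unfolding U_def V_def
    by (rule relaxed_Max_le[where \<Lambda>=\<Lambda> and N=N and h=h]; fact)
  have iU: "integrable \<mu> (U n)" for n
    unfolding U_def by (intro integrable_Max_image Bochner_Integration.integrable_add pl cont_b integrable_continuous_X \<mu>' cont_a)
  have iV: "integrable \<sigma> (V n)" for n
    unfolding V_def by (intro integrable_Max_image pl cont_b)
  have incU: "U n x \<le> U (Suc n) x" and incV: "V n x \<le> V (Suc n) x" for n x
    by (simp_all add: U_def V_def Max_image_Suc)
  have supU: "(SUP n. ereal (U n x)) = ereal (c x (scale_measure (ennreal (h x)) (\<kappa> x)))" for x
  proof -
    have "(SUP n. ereal (U n x)) = (SUP k. ereal (h x * (\<integral>y. b k (x, y) \<partial>\<kappa> x) + a k x))"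
      unfolding U_def by (rule SUP_Max_image)
    also have "\<dots> = ereal (c x (scale_measure (ennreal (h x)) (\<kappa> x)))"
      using disintegration_kernel(4)[OF d, of x] h(2)[of x] by (simp add: c_eq scale_fin integral_scale_section)
    finally show ?thesis .
  qed
  have supV: "(SUP n. ereal (V n x)) = recession c x (\<kappa> x)" for x
    unfolding V_def recession_eq[OF disintegration_kernel(4)[OF d]] by (rule SUP_Max_image)
  define X where "X = ext_integral \<mu> (\<lambda>x. ereal (c x (scale_measure (ennreal (h x)) (\<kappa> x))))"
  define Y where "Y = ext_integral \<sigma> (\<lambda>x. recession c x (\<kappa> x))"
  have limU: "(\<lambda>n. ereal (\<integral>x. U n x \<partial>\<mu>)) \<longlonglongrightarrow> X"
    using ext_integral_monotone_convergence[where U=U, OF iU incU] by (simp add: supU X_def)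
  have limV: "(\<lambda>n. ereal (\<integral>x. V n x \<partial>\<sigma>)) \<longlonglongrightarrow> Y"
    using ext_integral_monotone_convergence[where U=V, OF iV incV] by (simp add: supV Y_def)
  \<comment> \<open>Together with the bound for \<open>Y\<close> this excludes - \<infinity>, so the
    limit of the sums is the sum of the limits.\<close>
  have geX: "ereal (\<integral>x. U 0 x \<partial>\<mu>) \<le> X"
    by (rule LIMSEQ_le_const[OF limU]) (auto intro!: exI[of _ 0] integral_mono iU lift_Suc_mono_le[of "\<lambda>n. U n _"] incU)
  have geY: "ereal (\<integral>x. V 0 x \<partial>\<sigma>) \<le> Y"
    by (rule LIMSEQ_le_const[OF limV]) (auto intro!: exI[of _ 0] integral_mono iV lift_Suc_mono_le[of "\<lambda>n. V n _"] incV)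
  have "(\<lambda>n. ereal (\<integral>x. U n x \<partial>\<mu>) + ereal (\<integral>x. V n x \<partial>\<sigma>)) \<longlonglongrightarrow> X + Y"
    using geX geY by (intro tendsto_add_ereal_general limU limV) auto
  then have "X + Y \<le> ereal t"
    using UV by (intro LIMSEQ_le_const2) auto
  then have "cost_bar c \<mu> \<pi> \<le> ereal t" by (simp add: eq X_def Y_def)
  then show ?thesis by (rule that[OF \<pi>S])
qed

end

section \<open>Joint measurability and spreading densities for condition (C)\<close>

lemma joint_kernel_measurable:
  fixes b :: "'x::second_countable_topology \<times> 'y::second_countable_topology \<Rightarrow> real"
  assumes [measurable]: "\<kappa> \<in> borel \<rightarrow>\<^sub>M subprob_algebra borel" "b \<in> borel_measurable (borel \<Otimes>\<^sub>M borel)"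
  shows "(\<lambda>(x, z). \<integral>y. b (x, y) \<partial>\<kappa> z) \<in> borel_measurable (borel \<Otimes>\<^sub>M (borel :: 'z::topological_space measure))"
proof -
  have "(\<lambda>p. \<integral>y. (\<lambda>q. b (fst (fst q), snd q)) (p, y) \<partial>\<kappa> (snd p)) \<in> borel_measurable (borel \<Otimes>\<^sub>M (borel :: 'z measure))"
    by (rule integral_measurable_subprob_algebra2[where N=borel]) measurable
  then show ?thesis by (simp add: case_prod_beta')
qed

text \<open>The support is covered by finitely many balls of radius \<open>d / 2\<close> centred in
  it, each of positive \<open>\<mu>\<close>-mass by the definition of the support. A point
  \<open>z\<close> is spread uniformly over the first ball containing it, so source and target are
  less than \<open>d\<close> apart. Finiteness of the cover gives the uniform bound
  \<open>K\<close>.\<close>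

lemma spreading_density:
  fixes \<mu> :: "'x::polish_space measure"
  assumes c: "compact (UNIV :: 'x set)" and \<mu>: "\<mu> \<in> prob_measures" and "0 < d"
  obtains s :: "'x \<Rightarrow> 'x \<Rightarrow> real" and K where "(\<lambda>(x, z). s x z) \<in> borel_measurable (borel \<Otimes>\<^sub>M borel)"
    "\<And>x z. 0 \<le> s x z" "\<And>x z. s x z \<le> K" "\<And>z. (\<integral>x. s x z \<partial>\<mu>) = 1"
    "\<And>x z. z \<in> supp \<mu> \<Longrightarrow> s x z \<noteq> 0 \<Longrightarrow> dist x z < d"
proof -
  interpret prob_space \<mu> using \<mu> by (simp add: prob_measures_def)
  have s\<mu>[measurable_cong]: "sets \<mu> = sets borel" using \<mu> by (simp add: prob_measures_def)
  have "compact (supp \<mu>)" using closed_Int_compact[OF closed_supp c, of \<mu>] by simp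
  then obtain T where T: "T \<subseteq> supp \<mu>" "finite T" "supp \<mu> \<subseteq> (\<Union>x\<in>T. ball x (d/2))"
    by (rule compactE_image[of _ "supp \<mu>" "\<lambda>x. ball x (d/2)"]) (use \<open>0 < d\<close> in auto)
  obtain xs where xs: "set xs = T" using finite_list[OF T(2)] by blast
  define B where "B i = ball (xs ! i) (d/2)" for i
  define w where "w i = measure \<mu> (B i)" for i
  have [measurable]: "B i \<in> sets borel" for i by (simp add: B_def)
  have w: "0 < w i" if "i < length xs" for i
  proof -
    have "xs ! i \<in> supp \<mu>" using that xs T(1) by auto
    then have "0 < emeasure \<mu> (B i)" using \<open>0 < d\<close> by (auto simp: supp_def B_def)
    then show ?thesis by (simp add: w_def emeasure_eq_measure)
  qed
  define P where "P i z \<longleftrightarrow> z \<in> B i \<and> (\<forall>j<i. z \<notin> B j)" for i z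
  have [measurable]: "Measurable.pred borel (P i)" for i unfolding P_def by measurable
  define I where "I = {..<length xs}"
  have ex: "\<exists>i\<in>I. P i z" if "\<exists>i\<in>I. z \<in> B i" for z
  proof -
    define j where "j = (LEAST i. i < length xs \<and> z \<in> B i)"
    have "j < length xs \<and> z \<in> B j" unfolding j_def by (rule LeastI_ex) (use that in \<open>auto simp: I_def\<close>)
    moreover have "z \<notin> B i" if "i < j" for i
      using not_less_Least[of i "\<lambda>i. i < length xs \<and> z \<in> B i"] that \<open>j < length xs \<and> _\<close> by (auto simp: j_def[symmetric])
    ultimately show ?thesis by (auto simp: P_def I_def)
  qed
  have uniq: "i = j" if "P i z" "P j z" for i j z using that unfolding P_def by (metis linorder_neqE_nat)
  \<comment> \<open>Points outside all balls are spread over the whole space with density 1. They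
    lie outside the support; the default keeps the normalization valid for every
    \<open>z\<close>.\<close>
  define s where "s x z = (\<Sum>i\<in>I. of_bool (P i z) * (indicator (B i) x / w i)) + of_bool (\<forall>i\<in>I. z \<notin> B i)" for x z :: 'x
  have s_P: "s x z = indicator (B i) x / w i" if i: "i \<in> I" "P i z" for i x z
  proof -
    have "(\<Sum>i\<in>I. of_bool (P i z) * (indicator (B i) x / w i)) = of_bool (P i z) * (indicator (B i) x / w i)"
      by (rule sum.remove[of I i, THEN trans]) (use i uniq in \<open>auto simp: I_def intro!: sum.neutral\<close>)
    moreover have "\<not> (\<forall>i\<in>I. z \<notin> B i)" using i by (auto simp: P_def)
    ultimately show ?thesis using i by (simp add: s_def)
  qed
  have s_no: "s x z = 1" if "\<forall>i\<in>I. z \<notin> B i" for x z using that by (auto simp: s_def P_def)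
  define K where "K = 1 + (\<Sum>i\<in>I. 1 / w i)"
  have Knn: "0 \<le> (\<Sum>i\<in>I. 1 / w i)" using w by (intro sum_nonneg) (auto simp: I_def less_imp_le)
  have cases: "(\<exists>i\<in>I. P i z) \<or> (\<forall>i\<in>I. z \<notin> B i)" for z using ex by blast
  show ?thesis
  proof (rule that[of s K])
    show "(\<lambda>(x, z). s x z) \<in> borel_measurable (borel \<Otimes>\<^sub>M borel)" unfolding s_def by measurable
    show "0 \<le> s x z" for x z unfolding s_def using w by (intro add_nonneg_nonneg sum_nonneg) (auto simp: I_def less_imp_le)
    show "s x z \<le> K" for x z
      using cases[of z]
    proof
      assume "\<exists>i\<in>I. P i z"
      then obtain i where i: "i \<in> I" "P i z" by blast
      have "s x z \<le> 1 / w i" unfolding s_P[OF i] using w[of i] i by (auto simp: indicator_def I_def)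
      also have "\<dots> \<le> (\<Sum>i\<in>I. 1 / w i)" using w i by (intro member_le_sum) (auto simp: I_def less_imp_le)
      finally show ?thesis by (simp add: K_def)
    qed (use Knn s_no K_def in auto)
    show "(\<integral>x. s x z \<partial>\<mu>) = 1" for z
      using cases[of z]
    proof
      assume "\<exists>i\<in>I. P i z"
      then obtain i where i: "i \<in> I" "P i z" by blast
      show ?thesis unfolding s_P[OF i] using w[of i] i by (simp add: I_def w_def[symmetric] s\<mu>)
    qed (simp add: s_no prob_space)
    show "dist x z < d" if z: "z \<in> supp \<mu>" "s x z \<noteq> 0" for x z
    proof -
      have "\<exists>i\<in>I. z \<in> B i" using z(1) T(3) xs by (force simp: I_def B_def in_set_conv_nth)
      then obtain i where i: "i \<in> I" "P i z" using ex by blast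
      then have "x \<in> B i" "z \<in> B i" using z(2) s_P[OF i, of x] by (auto simp: P_def indicator_def split: if_splits)
      then show ?thesis unfolding B_def mem_ball by metric
    qed
  qed
qed

context sup_cost
begin

subsection \<open>From plans to kernels\<close>

lemma transport_cost_le: "q \<in> kernels \<mu> \<nu> \<Longrightarrow> transport_cost c \<mu> \<nu> \<le> ext_integral \<mu> (\<lambda>x. ereal (c x (q x)))"
  unfolding transport_cost_def by (rule INF_lower)

lemma marg2_emeasure:
  assumes d: "is_disintegration (\<pi> :: ('x \<times> 'y) measure) \<kappa>" and \<pi>: "\<pi> \<in> prob_measures" and A: "A \<in> sets borel"
  shows "emeasure (marg2 \<pi>) A = (\<integral>\<^sup>+x. emeasure (\<kappa> x) A \<partial>marg1 \<pi>)"
proof -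
  have s\<pi>: "sets \<pi> = sets borel" using \<pi> by (simp add: prob_measures_def)
  have snd: "snd \<in> \<pi> \<rightarrow>\<^sub>M (borel :: 'y measure)"
    unfolding measurable_cong_sets[OF s\<pi> refl]
    by (intro borel_measurable_continuous_onI continuous_on_snd continuous_on_id)
  have "snd -` A \<inter> space \<pi> = UNIV \<times> A" using sets_eq_imp_space_eq[OF s\<pi>] by auto
  then have "emeasure (marg2 \<pi>) A = emeasure \<pi> (UNIV \<times> A)"
    unfolding marg2_def using A by (simp add: emeasure_distr[OF snd])
  also have "\<dots> = (\<integral>\<^sup>+x\<in>UNIV. emeasure (\<kappa> x) A \<partial>marg1 \<pi>)"
  proof -
    have "emeasure \<pi> (A' \<times> B) = (\<integral>\<^sup>+x\<in>A'. emeasure (\<kappa> x) B \<partial>marg1 \<pi>)" if "A' \<in> sets borel" "B \<in> sets borel" for A' B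
      using d that by (simp add: is_disintegration_def)
    then show ?thesis using A by simp
  qed
  finally show ?thesis by simp
qed

text \<open>The competitor is the kernel \<open>h x\<close> times \<open>\<kappa> x\<close>:
  integrating it against \<open>\<mu>\<close> means integrating \<open>\<kappa>\<close> against the
  first marginal, which yields the second marginal.\<close>

lemma transport_cost_le_density:
  assumes \<mu>: "\<mu> \<in> prob_measures" and \<pi>: "\<pi> \<in> prob_measures" and d: "is_disintegration \<pi> \<kappa>"
    and h[measurable]: "h \<in> borel_measurable borel" and m: "marg1 \<pi> = density \<mu> (\<lambda>x. ennreal (h x))"
  shows "transport_cost c \<mu> (marg2 \<pi>) \<le> ext_integral \<mu> (\<lambda>x. ereal (c x (scale_measure (ennreal (h x)) (\<kappa> x))))"
proof (rule transport_cost_le)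
  have [measurable_cong]: "sets \<mu> = sets borel" using \<mu> by (simp add: prob_measures_def)
  have [measurable]: "\<kappa> \<in> borel \<rightarrow>\<^sub>M subprob_algebra borel" by (rule disintegration_kernel[OF d])
  have [measurable]: "(\<lambda>x. emeasure (\<kappa> x) A) \<in> borel_measurable borel" if "A \<in> sets borel" for A
    using that by measurable
  show "(\<lambda>x. scale_measure (ennreal (h x)) (\<kappa> x)) \<in> kernels \<mu> (marg2 \<pi>)"
    unfolding kernels_def nonneg_kernel_def
    using scale_fin disintegration_kernel(4)[OF d] marg2_emeasure[OF d \<pi>]
    by (auto simp: m nn_integral_density)
qed

lemma transport_cost_le_cost_ac:
  assumes \<mu>: "\<mu> \<in> prob_measures" and \<pi>: "\<pi> \<in> Pi_ac \<mu> \<nu>"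
  shows "transport_cost c \<mu> \<nu> \<le> cost_ac c \<mu> \<pi>"
proof -
  have \<pi>': "\<pi> \<in> prob_measures" and ac: "absolutely_continuous \<mu> (marg1 \<pi>)" and \<nu>: "marg2 \<pi> = \<nu>"
    using \<pi> by (auto simp: Pi_ac_def)
  interpret \<mu>: prob_space \<mu> using \<mu> by (simp add: prob_measures_def)
  have s\<mu>: "sets \<mu> = sets borel" using \<mu> by (simp add: prob_measures_def)
  have m: "prob_space (marg1 \<pi>)" "sets (marg1 \<pi>) = sets \<mu>"
    using marg1_prob[OF \<pi>'] s\<mu> by (auto simp: prob_measures_def)
  have d: "is_disintegration \<pi> (disintegration \<pi>)" by (rule is_disintegration_disintegration[OF compact_Y \<pi>'])
  define h where "h x = enn2real (RN_deriv \<mu> (marg1 \<pi>) x)" for x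
  have RN: "AE x in \<mu>. RN_deriv \<mu> (marg1 \<pi>) x = ennreal (h x)"
    using \<mu>.RN_deriv_finite[OF finite_measure.axioms(1)[OF prob_space.finite_measure[OF m(1)]] ac m(2)]
    by eventually_elim (simp add: h_def less_top)
  have "h \<in> borel_measurable \<mu>" unfolding h_def by measurable
  then have h: "h \<in> borel_measurable borel" by (simp add: measurable_cong_sets[OF s\<mu> refl])
  have "marg1 \<pi> = density \<mu> (\<lambda>x. ennreal (h x))"
    using RN by (subst \<mu>.density_RN_deriv[OF ac m(2), symmetric], intro density_cong) (auto simp: h_def)
  from transport_cost_le_density[OF \<mu> \<pi>' d h this]
  have "transport_cost c \<mu> \<nu> \<le> ext_integral \<mu> (\<lambda>x. ereal (c x (scale_measure (ennreal (h x)) (disintegration \<pi> x))))"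
    by (simp add: \<nu>)
  also have "\<dots> = cost_ac c \<mu> \<pi>"
    unfolding cost_ac_def using RN by (intro ext_integral_cong_AE) (auto elim: eventually_mono)
  finally show ?thesis .
qed

lemma transport_cost_le_dual_Approx:
  assumes "cond_Approx c" and \<mu>: "\<mu> \<in> prob_measures" and \<nu>: "\<nu> \<in> prob_measures"
    and t: "dual_value c \<mu> \<nu> \<le> ereal t"
  shows "transport_cost c \<mu> \<nu> \<le> ereal t"
proof -
  obtain \<pi> where \<pi>: "\<pi> \<in> Pi_supp \<mu> \<nu>" "cost_bar c \<mu> \<pi> \<le> ereal t"
    by (rule relaxed_optimum[OF \<mu> \<nu> t], rule that)
  then obtain \<pi>s where \<pi>s: "\<And>n. \<pi>s n \<in> Pi_ac \<mu> \<nu>" "(\<lambda>n. cost_ac c \<mu> (\<pi>s n)) \<longlonglongrightarrow> cost_bar c \<mu> \<pi>"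
    using assms(1) \<mu> \<nu> unfolding cond_Approx_def by meson
  have "transport_cost c \<mu> \<nu> \<le> cost_bar c \<mu> \<pi>"
    using transport_cost_le_cost_ac[OF \<mu> \<pi>s(1)] by (intro LIMSEQ_le_const[OF \<pi>s(2)]) auto
  then show ?thesis using \<pi>(2) by (rule order_trans)
qed

lemma transport_cost_le_dual_B:
  assumes "cond_B c" and \<mu>: "\<mu> \<in> prob_measures" and \<nu>: "\<nu> \<in> prob_measures"
    and t: "dual_value c \<mu> \<nu> \<le> ereal t"
  shows "transport_cost c \<mu> \<nu> \<le> ereal t"
proof -
  obtain \<pi> where \<pi>S: "\<pi> \<in> Pi_supp \<mu> \<nu>" and le: "cost_bar c \<mu> \<pi> \<le> ereal t"
    by (rule relaxed_optimum[OF \<mu> \<nu> t], rule that)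
  have \<pi>: "\<pi> \<in> prob_measures" and \<nu>': "marg2 \<pi> = \<nu>" using \<pi>S by (auto simp: Pi_supp_def)
  define \<kappa> where "\<kappa> = disintegration \<pi>"
  have d: "is_disintegration \<pi> \<kappa>" unfolding \<kappa>_def by (rule is_disintegration_disintegration[OF compact_Y \<pi>])
  have \<mu>': "finite_measure \<mu>" "sets \<mu> = sets borel" using \<mu> by (auto simp: prob_measures_def prob_space.finite_measure)
  obtain h N \<sigma> where h: "h \<in> borel_measurable borel" "\<And>x. 0 \<le> h x" "integrable \<mu> h"
    and \<sigma>: "sets \<sigma> = sets borel" "finite_measure \<sigma>"
    and N: "N \<in> sets borel" "AE x in \<mu>. x \<notin> N" "AE x in \<sigma>. x \<in> N"
    and m: "marg1 \<pi> = add_measure (density \<mu> (\<lambda>x. ennreal (h x))) \<sigma>"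
    and eq: "cost_bar c \<mu> \<pi> = ext_integral \<mu> (\<lambda>x. ereal (c x (scale_measure (ennreal (h x)) (\<kappa> x))))
      + ext_integral \<sigma> (\<lambda>x. recession c x (\<kappa> x))"
    by (rule cost_bar_decomposition[OF \<mu> \<pi>, folded \<kappa>_def], rule that)
  define X where "X = ext_integral \<mu> (\<lambda>x. ereal (c x (scale_measure (ennreal (h x)) (\<kappa> x))))"
  have low: "integrable \<mu> (\<lambda>x. h x * (\<integral>y. b 0 (x, y) \<partial>\<kappa> x) + a 0 x)"
    by (intro Bochner_Integration.integrable_add plan_integral(1)[OF \<mu>' \<sigma>(2,1) h m \<pi> d cont_b]
        integrable_continuous_X \<mu>' cont_a)
  have "ereal (\<integral>x. h x * (\<integral>y. b 0 (x, y) \<partial>\<kappa> x) + a 0 x \<partial>\<mu>) \<le> X"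
    unfolding X_def ext_integral_real[OF low, symmetric]
    by (intro ext_integral_mono_AE AE_I2) (simp add: density_cost_lower[where h=h, OF d h(2)])
  then have X: "X \<noteq> - \<infinity>" by auto
  have rec: "recession c x (\<kappa> x) = \<infinity>" for x
  proof -
    interpret prob_space "\<kappa> x" by (rule disintegration_kernel[OF d])
    have "\<kappa> x \<noteq> null_measure borel"
      using emeasure_space_1 by auto
    then have "filterlim (\<lambda>l::real. c x (scale_measure (ennreal l) (\<kappa> x)) / l) at_top at_top"
      using assms(1) disintegration_kernel(4)[OF d, of x] by (auto simp: cond_B_def)
    then have "((\<lambda>l::real. ereal (c x (scale_measure (ennreal l) (\<kappa> x)) / l)) \<longlongrightarrow> \<infinity>) at_top"
      by (simp add: tendsto_PInfty_eq_at_top)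
    then show ?thesis unfolding recession_def by (intro tendsto_Lim) auto
  qed
  \<comment> \<open>The recession function is infinite at every conditional law, so a singular part
    of positive mass would make \<open>cost_bar\<close> infinite, although it is bounded by the real
    number \<open>t\<close>.\<close>
  have \<sigma>0: "emeasure \<sigma> (space \<sigma>) = 0"
  proof (rule ccontr)
    assume "emeasure \<sigma> (space \<sigma>) \<noteq> 0"
    then have "ext_integral \<sigma> (\<lambda>x. recession c x (\<kappa> x)) = \<infinity>"
      by (simp add: rec ext_integral_def e2ennreal_neg ennreal_top_mult)
    then show False using le X by (simp add: eq X_def[symmetric])
  qed
  then have 0: "emeasure \<sigma> A = 0" for A using emeasure_space[of \<sigma> A] by simp
  have m': "marg1 \<pi> = density \<mu> (\<lambda>x. ennreal (h x))"
    unfolding m by (rule measure_eqI) (simp_all add: emeasure_add_measure \<sigma> \<mu>' 0)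
  have "ext_integral \<sigma> (\<lambda>x. recession c x (\<kappa> x)) = 0"
    using \<sigma>0 by (simp add: rec ext_integral_def e2ennreal_neg)
  then have "X \<le> ereal t" using le by (simp add: eq X_def)
  moreover have "transport_cost c \<mu> \<nu> \<le> X"
    unfolding X_def \<nu>'[symmetric] by (rule transport_cost_le_density[OF \<mu> \<pi> d h(1) m'])
  ultimately show ?thesis by (rule order_trans[rotated])
qed

text \<open>
  Condition (C): the singular part of the first marginal is smeared out along the density \<open>s x z\<close>, which
  as a function of \<open>x\<close> is a probability density for \<open>\<mu>\<close>.  By sublinearity of the recession function
  this costs at most the average of \<open>recession c x (\<kappa> z)\<close>.
\<close>

lemma transport_cost_le_spread:
  fixes \<mu> \<sigma> :: "'x measure" and \<pi> :: "('x \<times> 'y) measure" and s r :: "'x \<Rightarrow> 'x \<Rightarrow> real"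
  assumes \<mu>: "\<mu> \<in> prob_measures" and \<sigma>: "finite_measure \<sigma>" "sets \<sigma> = sets borel"
    and h: "h \<in> borel_measurable borel" "\<And>x. 0 \<le> h x" "integrable \<mu> h"
    and m: "marg1 \<pi> = add_measure (density \<mu> (\<lambda>x. ennreal (h x))) \<sigma>"
    and \<pi>: "\<pi> \<in> prob_measures" and d: "is_disintegration \<pi> \<kappa>"
    and s: "(\<lambda>(x, z). s x z) \<in> borel_measurable (borel \<Otimes>\<^sub>M borel)"
      "\<And>x z. 0 \<le> s x z" "\<And>x z. s x z \<le> K" "\<And>z. (\<integral>x. s x z \<partial>\<mu>) = 1"
    and r: "(\<lambda>(x, z). r x z) \<in> borel_measurable (borel \<Otimes>\<^sub>M borel)" "\<And>x z. \<bar>r x z\<bar> \<le> R"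
      "\<And>x z. recession c x (\<kappa> z) = ereal (r x z)"
    and D: "integrable \<mu> (\<lambda>x. c x (scale_measure (ennreal (h x)) (\<kappa> x)))"
  shows "transport_cost c \<mu> (marg2 \<pi>) \<le>
    ereal ((\<integral>x. c x (scale_measure (ennreal (h x)) (\<kappa> x)) \<partial>\<mu>) + (\<integral>z. (\<integral>x. s x z * r x z \<partial>\<mu>) \<partial>\<sigma>))"
proof -
  interpret \<mu>: prob_space \<mu> using \<mu> by (simp add: prob_measures_def)
  interpret \<sigma>: finite_measure \<sigma> by fact
  interpret P: pair_sigma_finite \<mu> \<sigma> ..
  have s\<mu>[measurable_cong]: "sets \<mu> = sets borel" using \<mu> by (simp add: prob_measures_def)
  note [measurable_cong] = \<sigma>(2) and [measurable] = h(1) s(1) r(1)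
  have \<kappa>[measurable]: "\<kappa> \<in> borel \<rightarrow>\<^sub>M subprob_algebra borel" by (rule disintegration_kernel[OF d])
  have [measurable]: "(\<lambda>x. emeasure (\<kappa> x) A) \<in> borel_measurable borel" if "A \<in> sets borel" for A
    using that by measurable
  have sx[measurable]: "s x \<in> borel_measurable borel" "(\<lambda>x. s x z) \<in> borel_measurable borel" for x z by measurable
  have fin: "finite_measure (density \<sigma> (\<lambda>z. ennreal (s x z)))" for x
  proof (rule finite_measureI)
    have "(\<integral>\<^sup>+z. ennreal (s x z) \<partial>\<sigma>) \<le> (\<integral>\<^sup>+z. ennreal K \<partial>\<sigma>)" using s(3) by (intro nn_integral_mono ennreal_leI)
    also have "\<dots> < \<infinity>" by (simp add: ennreal_mult_less_top \<sigma>.emeasure_eq_measure)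
    finally show "emeasure (density \<sigma> (\<lambda>z. ennreal (s x z))) (space (density \<sigma> (\<lambda>z. ennreal (s x z)))) \<noteq> \<infinity>"
      by (simp add: emeasure_density cong: nn_integral_cong)
  qed
  have ne: "space (density \<sigma> (\<lambda>z. ennreal (s x z))) \<noteq> {}" for x
    using sets_eq_imp_space_eq[OF \<sigma>(2)] by simp
  have \<kappa>d: "\<kappa> \<in> density \<sigma> (\<lambda>z. ennreal (s x z)) \<rightarrow>\<^sub>M subprob_algebra borel" for x by measurable
  \<comment> \<open>At \<open>x\<close> this collects the conditional laws \<open>\<kappa> z\<close>
    of the singular part, each weighted by the share \<open>s x z\<close> that \<open>z\<close>
    sends to \<open>x\<close>.\<close>
  define p where "p x = density \<sigma> (\<lambda>z. ennreal (s x z)) \<bind> \<kappa>" for x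
  have sp: "sets (p x) = sets borel" for x unfolding p_def by (rule sets_bind[OF sets_kernel[OF \<kappa>d] ne])
  have p_em: "emeasure (p x) A = (\<integral>\<^sup>+z. ennreal (s x z) * emeasure (\<kappa> z) A \<partial>\<sigma>)" if "A \<in> sets borel" for x A
    unfolding p_def using that by (simp add: emeasure_bind[OF ne \<kappa>d] nn_integral_density)
  have p_int: "(\<integral>y. b k (x, y) \<partial>p x) = (\<integral>z. s x z * (\<integral>y. b k (x, y) \<partial>\<kappa> z) \<partial>\<sigma>)" for k x
  proof -
    obtain C where C: "0 \<le> C" "\<And>z. \<bar>b k z\<bar> \<le> C" by (rule bounded_continuous_XY[OF cont_b[of k]], rule that)
    have bm[measurable]: "(\<lambda>y. b k (x, y)) \<in> borel_measurable borel" by measurable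
    have "(\<integral>y. b k (x, y) \<partial>p x) = (\<integral>z. (\<integral>y. b k (x, y) \<partial>\<kappa> z) \<partial>density \<sigma> (\<lambda>z. ennreal (s x z)))"
      unfolding p_def
    proof (rule integral_bind[OF bm _ \<kappa>d fin, where B=C and B'=1])
      show "AE z in density \<sigma> (\<lambda>z. ennreal (s x z)). emeasure (\<kappa> z) (space (\<kappa> z)) \<le> ennreal 1"
        using prob_space.emeasure_space_1[OF disintegration_kernel(2)[OF d]] by simp
    qed (use C in auto)
    also have "\<dots> = (\<integral>z. s x z * (\<integral>y. b k (x, y) \<partial>\<kappa> z) \<partial>\<sigma>)"
      using s(2) by (subst integral_density) auto
    finally show ?thesis .
  qed
  have pfin: "p x \<in> fin_measures" for x
  proof -
    have "emeasure (p x) UNIV = (\<integral>\<^sup>+z. ennreal (s x z) \<partial>\<sigma>)"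
      using prob_space.emeasure_space_1[OF disintegration_kernel(2)[OF d]]
        sets_eq_imp_space_eq[OF disintegration_kernel(3)[OF d]] by (simp add: p_em)
    also have "\<dots> = emeasure (density \<sigma> (\<lambda>z. ennreal (s x z))) (space \<sigma>)"
      by (simp add: emeasure_density cong: nn_integral_cong)
    also have "\<dots> \<noteq> \<infinity>" using finite_measure.emeasure_finite[OF fin] by simp
    finally show ?thesis
      using sp[of x] sets_eq_imp_space_eq[OF sp[of x]] by (auto simp: fin_measures_def intro!: finite_measureI)
  qed
  define q where "q x = add_measure (scale_measure (ennreal (h x)) (\<kappa> x)) (p x)" for x
  have hf: "scale_measure (ennreal (h x)) (\<kappa> x) \<in> fin_measures" for x by (intro scale_fin disintegration_kernel(4)[OF d])
  have q_em: "emeasure (q x) A = ennreal (h x) * emeasure (\<kappa> x) A + (\<integral>\<^sup>+z. ennreal (s x z) * emeasure (\<kappa> z) A \<partial>\<sigma>)"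
    if "A \<in> sets borel" for x A
    unfolding q_def using that by (simp add: emeasure_add_measure sp disintegration_kernel(3)[OF d] p_em)
  have q_fin: "q x \<in> fin_measures" for x
    using hf[of x] pfin[of x] by (auto simp: q_def fin_measures_def finite_measure_add_measure)
  have q: "q \<in> kernels \<mu> (marg2 \<pi>)"
    unfolding kernels_def nonneg_kernel_def mem_Collect_eq
  proof (intro conjI allI ballI q_fin)
    fix A :: "'y set" assume A[measurable]: "A \<in> sets borel"
    have mm[measurable]: "(\<lambda>x. \<integral>\<^sup>+z. ennreal (s x z) * emeasure (\<kappa> z) A \<partial>\<sigma>) \<in> borel_measurable borel"
      by measurable
    show "(\<lambda>x. emeasure (q x) A) \<in> borel_measurable borel" unfolding q_em[OF A] by measurable
    have "(\<integral>\<^sup>+x. emeasure (q x) A \<partial>\<mu>) = (\<integral>\<^sup>+x. ennreal (h x) * emeasure (\<kappa> x) A \<partial>\<mu>)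
        + (\<integral>\<^sup>+x. \<integral>\<^sup>+z. ennreal (s x z) * emeasure (\<kappa> z) A \<partial>\<sigma> \<partial>\<mu>)"
      unfolding q_em[OF A] by (rule nn_integral_add) auto
    \<comment> \<open>After exchanging the integrals the normalization of \<open>s\<close> in
      \<open>x\<close> removes the weight, so spreading changes the first marginal but preserves the
      second.\<close>
    also have "(\<integral>\<^sup>+x. \<integral>\<^sup>+z. ennreal (s x z) * emeasure (\<kappa> z) A \<partial>\<sigma> \<partial>\<mu>)
        = (\<integral>\<^sup>+z. \<integral>\<^sup>+x. ennreal (s x z) * emeasure (\<kappa> z) A \<partial>\<mu> \<partial>\<sigma>)"
      by (rule P.Fubini'[symmetric]) measurable
    also have "\<dots> = (\<integral>\<^sup>+z. emeasure (\<kappa> z) A \<partial>\<sigma>)"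
    proof (rule nn_integral_cong)
      fix z
      have "(\<integral>\<^sup>+x. ennreal (s x z) \<partial>\<mu>) = ennreal (\<integral>x. s x z \<partial>\<mu>)"
        using s(2,3) by (intro nn_integral_eq_integral \<mu>.integrable_const_bound[where B=K]) auto
      then show "(\<integral>\<^sup>+x. ennreal (s x z) * emeasure (\<kappa> z) A \<partial>\<mu>) = emeasure (\<kappa> z) A"
        by (simp add: nn_integral_multc s(4))
    qed
    also have "(\<integral>\<^sup>+x. ennreal (h x) * emeasure (\<kappa> x) A \<partial>\<mu>) = (\<integral>\<^sup>+x. emeasure (\<kappa> x) A \<partial>density \<mu> (\<lambda>x. ennreal (h x)))"
      by (rule nn_integral_density[symmetric]) auto
    also have "\<dots> + (\<integral>\<^sup>+z. emeasure (\<kappa> z) A \<partial>\<sigma>) = (\<integral>\<^sup>+x. emeasure (\<kappa> x) A \<partial>marg1 \<pi>)"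
      unfolding m by (rule nn_integral_add_measure[symmetric]) (auto simp: \<sigma> s\<mu>)
    also have "\<dots> = emeasure (marg2 \<pi>) A" by (rule marg2_emeasure[OF d \<pi> A, symmetric])
    finally show "(\<integral>\<^sup>+x. emeasure (q x) A \<partial>\<mu>) = emeasure (marg2 \<pi>) A" .
  qed
  have Pfin: "finite_measure (\<mu> \<Otimes>\<^sub>M \<sigma>)" by (rule finite_measure_pair_measure) unfold_locales
  have KR: "\<bar>s x z * u\<bar> \<le> K * R" if "\<bar>u\<bar> \<le> R" for x z u
    unfolding abs_mult using s(2,3)[of x z] that by (intro mult_mono) auto
  have sr: "integrable (\<mu> \<Otimes>\<^sub>M \<sigma>) (\<lambda>(x, z). s x z * r x z)"
    using KR[OF r(2)] by (intro finite_measure.integrable_const_bound[OF Pfin, where B="K * R"]) (auto simp: split_beta')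
  define S where "S x = (\<integral>z. s x z * r x z \<partial>\<sigma>)" for x
  have iS: "integrable \<mu> S" unfolding S_def using P.integrable_fst'[OF sr] by simp
  have srx: "integrable \<sigma> (\<lambda>z. s x z * u z)" if [measurable]: "u \<in> borel_measurable borel" and "\<And>z. \<bar>u z\<bar> \<le> C" for x u C
  proof -
    have "\<bar>s x z * u z\<bar> \<le> K * C" for z
      unfolding abs_mult using s(2,3)[of x z] that(2)[of z] by (intro mult_mono) auto
    then show ?thesis by (intro \<sigma>.integrable_const_bound[where B="K * C"]) auto
  qed
  have rx: "r x \<in> borel_measurable borel" for x by measurable
  \<comment> \<open>For each \<open>k\<close> the term \<open>a k x\<close> is used once, together
    with the part of \<open>q x\<close> coming from \<open>h\<close>; the spread part enters through
    the linear term alone, which the recession function at \<open>x\<close> dominates.\<close>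
  have cq: "c x (q x) \<le> c x (scale_measure (ennreal (h x)) (\<kappa> x)) + S x" for x
  proof (rule c_le[OF q_fin])
    fix k
    obtain C where C: "0 \<le> C" "\<And>z. \<bar>b k z\<bar> \<le> C" by (rule bounded_continuous_XY[OF cont_b[of k]], rule that)
    have "(\<integral>y. b k (x, y) \<partial>q x) = (\<integral>y. b k (x, y) \<partial>scale_measure (ennreal (h x)) (\<kappa> x)) + (\<integral>y. b k (x, y) \<partial>p x)"
      unfolding q_def by (rule integral_add_measure)
        (simp_all add: sp disintegration_kernel(3)[OF d] integrable_section hf pfin cont_b)
    moreover have "(\<integral>y. b k (x, y) \<partial>p x) \<le> S x"
      unfolding p_int S_def
    proof (rule integral_mono)
      have "(\<lambda>z. \<integral>y. b k (x, y) \<partial>\<kappa> z) \<in> borel_measurable borel" by measurable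
      then show "integrable \<sigma> (\<lambda>z. s x z * (\<integral>y. b k (x, y) \<partial>\<kappa> z))"
        by (rule srx) (rule section_integral_bounded[OF d cont_b C(2)])
      show "integrable \<sigma> (\<lambda>z. s x z * r x z)" by (rule srx[OF rx r(2)])
      fix z
      have "ereal (\<integral>y. b k (x, y) \<partial>\<kappa> z) \<le> recession c x (\<kappa> z)"
        unfolding recession_eq[OF disintegration_kernel(4)[OF d]] by (rule SUP_upper) simp
      then show "s x z * (\<integral>y. b k (x, y) \<partial>\<kappa> z) \<le> s x z * r x z"
        using s(2) by (intro mult_left_mono) (simp_all add: r(3))
    qed
    ultimately show "(\<integral>y. b k (x, y) \<partial>q x) + a k x \<le> c x (scale_measure (ennreal (h x)) (\<kappa> x)) + S x"
      using c_ge[OF hf[of x], where k=k and x=x] by linarith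
  qed
  have "transport_cost c \<mu> (marg2 \<pi>) \<le> ext_integral \<mu> (\<lambda>x. ereal (c x (q x)))"
    by (rule transport_cost_le[OF q])
  also have "\<dots> \<le> ext_integral \<mu> (\<lambda>x. ereal (c x (scale_measure (ennreal (h x)) (\<kappa> x)) + S x))"
    using cq by (intro ext_integral_mono_AE AE_I2) simp
  also have "\<dots> = ereal ((\<integral>x. c x (scale_measure (ennreal (h x)) (\<kappa> x)) \<partial>\<mu>) + (\<integral>x. S x \<partial>\<mu>))"
    using D iS by (simp add: ext_integral_real)
  also have "(\<integral>x. S x \<partial>\<mu>) = (\<integral>z. (\<integral>x. s x z * r x z \<partial>\<mu>) \<partial>\<sigma>)"
    unfolding S_def by (rule P.Fubini_integral[OF sr, symmetric])
  finally show ?thesis .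
qed

text \<open>Shrinking the spreading radius makes the averages of
  \<open>recession c x (\<kappa> z)\<close> over \<open>x\<close> tend to the value at
  \<open>x = z\<close>, by continuity in \<open>x\<close>. The bound from (C) above and the one from
  \<open>b 0\<close> below make the recession function bounded on probability measures, so dominated
  convergence applies.\<close>

lemma transport_cost_le_dual_C:
  assumes C: "cond_C c" and \<mu>: "\<mu> \<in> prob_measures" and \<nu>: "\<nu> \<in> prob_measures"
    and t: "dual_value c \<mu> \<nu> \<le> ereal t"
  shows "transport_cost c \<mu> \<nu> \<le> ereal t"
proof -
  obtain \<pi> where \<pi>S: "\<pi> \<in> Pi_supp \<mu> \<nu>" and le: "cost_bar c \<mu> \<pi> \<le> ereal t"
    by (rule relaxed_optimum[OF \<mu> \<nu> t], rule that)
  have \<pi>: "\<pi> \<in> prob_measures" and \<nu>': "marg2 \<pi> = \<nu>" and supp: "emeasure (marg1 \<pi>) (supp \<mu>) = 1"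
    using \<pi>S by (auto simp: Pi_supp_def)
  define \<kappa> where "\<kappa> = disintegration \<pi>"
  have d: "is_disintegration \<pi> \<kappa>" unfolding \<kappa>_def by (rule is_disintegration_disintegration[OF compact_Y \<pi>])
  interpret \<mu>: prob_space \<mu> using \<mu> by (simp add: prob_measures_def)
  have s\<mu>[measurable_cong]: "sets \<mu> = sets borel" using \<mu> by (simp add: prob_measures_def)
  note \<mu>' = \<mu>.finite_measure_axioms s\<mu>
  obtain h N \<sigma> where h: "h \<in> borel_measurable borel" "\<And>x. 0 \<le> h x" "integrable \<mu> h"
    and \<sigma>: "sets \<sigma> = sets borel" "finite_measure \<sigma>"
    and N: "N \<in> sets borel" "AE x in \<mu>. x \<notin> N" "AE x in \<sigma>. x \<in> N"
    and m: "marg1 \<pi> = add_measure (density \<mu> (\<lambda>x. ennreal (h x))) \<sigma>"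
    and eq: "cost_bar c \<mu> \<pi> = ext_integral \<mu> (\<lambda>x. ereal (c x (scale_measure (ennreal (h x)) (\<kappa> x))))
      + ext_integral \<sigma> (\<lambda>x. recession c x (\<kappa> x))"
    by (rule cost_bar_decomposition[OF \<mu> \<pi>, folded \<kappa>_def], rule that)
  note [measurable_cong] = \<sigma>(1) and [measurable] = h(1)
  interpret \<sigma>: finite_measure \<sigma> by fact
  have \<kappa>[measurable]: "\<kappa> \<in> borel \<rightarrow>\<^sub>M subprob_algebra borel" by (rule disintegration_kernel[OF d])
  have \<kappa>p: "\<kappa> z \<in> prob_measures" for z
    using disintegration_kernel(2,3)[OF d, of z] by (simp add: prob_measures_def)
  obtain a' where a': "0 \<le> a'" "\<And>x p. p \<in> prob_measures \<Longrightarrow> recession c x p \<le> ereal a'"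
    using C by (auto simp: cond_C_def)
  obtain C0 where C0: "0 \<le> C0" "\<And>z. \<bar>b 0 z\<bar> \<le> C0" by (rule bounded_continuous_XY[OF cont_b[of 0]], rule that)
  define r where "r x z = real_of_ereal (recession c x (\<kappa> z))" for x z
  have low: "ereal (- C0) \<le> recession c x (\<kappa> z)" for x z
  proof -
    have "- C0 \<le> (\<integral>y. b 0 (x, y) \<partial>\<kappa> z)"
      using section_integral_bounded[OF d cont_b C0(2), where x=x and z=z] by linarith
    then have "ereal (- C0) \<le> ereal (\<integral>y. b 0 (x, y) \<partial>\<kappa> z)" by simp
    also have "\<dots> \<le> recession c x (\<kappa> z)"
      unfolding recession_eq[OF disintegration_kernel(4)[OF d]] by (rule SUP_upper) simp
    finally show ?thesis .
  qed
  have r: "recession c x (\<kappa> z) = ereal (r x z)" for x z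
    using low[of x z] a'(2)[OF \<kappa>p[of z], of x] by (cases "recession c x (\<kappa> z)") (auto simp: r_def)
  define R where "R = a' + C0"
  have rR: "\<bar>r x z\<bar> \<le> R" for x z
    using low[of x z] a'(2)[OF \<kappa>p[of z], of x] a'(1) C0(1) by (auto simp: r R_def)
  have rm[measurable]: "(\<lambda>(x, z). r x z) \<in> borel_measurable (borel \<Otimes>\<^sub>M borel)"
  proof -
    have [measurable]: "(\<lambda>(x, z). \<integral>y. b k (x, y) \<partial>\<kappa> z) \<in> borel_measurable (borel \<Otimes>\<^sub>M borel)" for k
      by (rule joint_kernel_measurable[OF \<kappa> b_meas_pair])
    have "(\<lambda>(x, z). r x z) = (\<lambda>p. real_of_ereal (SUP k. ereal ((\<lambda>(x, z). \<integral>y. b k (x, y) \<partial>\<kappa> z) p)))"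
      by (auto simp: fun_eq_iff r_def recession_eq[OF disintegration_kernel(4)[OF d]])
    also have "\<dots> \<in> borel_measurable (borel \<Otimes>\<^sub>M borel)" by measurable
    finally show ?thesis .
  qed
  have rz[measurable]: "(\<lambda>z. r z z) \<in> borel_measurable borel"
    using measurable_compose[OF _ rm, of "\<lambda>z. (z, z)" borel] by simp
  define y where "y = (\<integral>z. r z z \<partial>\<sigma>)"
  have "integrable \<sigma> (\<lambda>z. r z z)"
    using rR by (intro \<sigma>.integrable_const_bound[where B=R]) auto
  then have Y: "ext_integral \<sigma> (\<lambda>x. recession c x (\<kappa> x)) = ereal y"
    by (simp add: r ext_integral_real y_def)
  define D where "D x = c x (scale_measure (ennreal (h x)) (\<kappa> x))" for x
  have XY: "ext_integral \<mu> (\<lambda>x. ereal (D x)) + ereal y \<le> ereal t" using le by (simp add: eq Y D_def)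
  \<comment> \<open>The singular contribution is the real number \<open>y\<close>, so the bound by
    \<open>t\<close> forces the other summand below \<infinity>.\<close>
  have "integrable \<mu> D"
  proof (rule integrable_if_ext_integral_less_PInf)
    have [measurable]: "(\<lambda>x. emeasure (\<kappa> x) A) \<in> borel_measurable borel" if "A \<in> sets borel" for A
      using that by measurable
    have "nonneg_kernel (\<lambda>x. scale_measure (ennreal (h x)) (\<kappa> x))"
      unfolding nonneg_kernel_def using scale_fin disintegration_kernel(4)[OF d] by auto
    from cost_kernel_measurable[OF this] show "D \<in> borel_measurable \<mu>"
      by (simp add: D_def[abs_def] measurable_cong_sets[OF s\<mu> refl])
    show "integrable \<mu> (\<lambda>x. h x * (\<integral>y. b 0 (x, y) \<partial>\<kappa> x) + a 0 x)"
      by (intro Bochner_Integration.integrable_add plan_integral(1)[OF \<mu>' \<sigma>(2,1) h m \<pi> d cont_b]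
        integrable_continuous_X \<mu>' cont_a)
    show "AE x in \<mu>. h x * (\<integral>y. b 0 (x, y) \<partial>\<kappa> x) + a 0 x \<le> D x"
      unfolding D_def by (intro AE_I2) (rule density_cost_lower[where h=h, OF d h(2)])
    show "ext_integral \<mu> (\<lambda>x. ereal (D x)) < \<infinity>" using XY by (cases "ext_integral \<mu> (\<lambda>x. ereal (D x))") auto
  qed
  note D = this
  then have Dy: "(\<integral>x. D x \<partial>\<mu>) + y \<le> t" using XY by (simp add: ext_integral_real)
  have "\<exists>s :: 'x \<Rightarrow> 'x \<Rightarrow> real. (\<lambda>(x, z). s x z) \<in> borel_measurable (borel \<Otimes>\<^sub>M borel) \<and> (\<forall>x z. 0 \<le> s x z) \<and>
      (\<exists>K. \<forall>x z. s x z \<le> K) \<and> (\<forall>z. (\<integral>x. s x z \<partial>\<mu>) = 1) \<and>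
      (\<forall>x z. z \<in> supp \<mu> \<longrightarrow> s x z \<noteq> 0 \<longrightarrow> dist x z < 1 / real (Suc n))" for n
    by (rule spreading_density[OF compact_X \<mu>, of "1 / real (Suc n)"]) (simp, blast)
  then obtain s :: "nat \<Rightarrow> 'x \<Rightarrow> 'x \<Rightarrow> real" where
    s[measurable]: "\<And>n. (\<lambda>(x, z). s n x z) \<in> borel_measurable (borel \<Otimes>\<^sub>M borel)" and s0: "\<And>n x z. 0 \<le> s n x z"
    and sK: "\<And>n. \<exists>K. \<forall>x z. s n x z \<le> K" and s1: "\<And>n z. (\<integral>x. s n x z \<partial>\<mu>) = 1"
    and sd: "\<And>n x z. z \<in> supp \<mu> \<Longrightarrow> s n x z \<noteq> 0 \<Longrightarrow> dist x z < 1 / real (Suc n)"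
    by metis
  define F where "F n z = (\<integral>x. s n x z * r x z \<partial>\<mu>)" for n z
  have bound: "transport_cost c \<mu> \<nu> \<le> ereal ((\<integral>x. D x \<partial>\<mu>) + (\<integral>z. F n z \<partial>\<sigma>))" for n
  proof -
    obtain K where "\<And>x z. s n x z \<le> K" using sK[of n] by blast
    from transport_cost_le_spread[OF \<mu> \<sigma>(2,1) h m \<pi> d s s0 this s1 rm rR r D[unfolded D_def]]
    show ?thesis by (simp add: \<nu>' D_def F_def)
  qed
  \<comment> \<open>A non-integrable function has Bochner integral 0, whereas this integral is
    1.\<close>
  have si: "integrable \<mu> (\<lambda>x. s n x z)" for n z
    using s1[of n z] not_integrable_integral_eq[of \<mu> "\<lambda>x. s n x z"] by fastforce
  have sri: "integrable \<mu> (\<lambda>x. s n x z * u x)" if [measurable]: "u \<in> borel_measurable borel" and "\<And>x. \<bar>u x\<bar> \<le> B" for u n z B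
  proof -
    have "integrable \<mu> (\<lambda>x. s n x z * B)" using si by simp
    then show ?thesis
    proof (rule Bochner_Integration.integrable_bound)
      have "s n x z * \<bar>u x\<bar> \<le> s n x z * \<bar>B\<bar>" for x
        using that(2)[of x] s0 by (intro mult_left_mono) auto
      then show "AE x in \<mu>. norm (s n x z * u x) \<le> norm (s n x z * B)"
        using s0 by (intro AE_I2) (simp add: abs_mult)
    qed measurable
  qed
  have rxm: "(\<lambda>x. r x z) \<in> borel_measurable borel" for z by measurable
  \<comment> \<open>The weights form a probability density in \<open>x\<close>, so an average is
    bounded by any bound on \<open>u\<close> that holds where they are nonzero; \<open>B\<close>
    serves integrability.\<close>
  have est: "\<bar>\<integral>x. s n x z * u x \<partial>\<mu>\<bar> \<le> e"
    if u: "u \<in> borel_measurable borel" "\<And>x. \<bar>u x\<bar> \<le> B" and e: "\<And>x. s n x z \<noteq> 0 \<Longrightarrow> \<bar>u x\<bar> \<le> e" for u n z e B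
  proof -
    have "\<bar>\<integral>x. s n x z * u x \<partial>\<mu>\<bar> \<le> (\<integral>x. \<bar>s n x z * u x\<bar> \<partial>\<mu>)" by (rule integral_abs_bound)
    also have "\<dots> \<le> (\<integral>x. s n x z * e \<partial>\<mu>)"
    proof (rule integral_mono)
      show "integrable \<mu> (\<lambda>x. \<bar>s n x z * u x\<bar>)" by (intro integrable_abs sri[OF u])
      show "integrable \<mu> (\<lambda>x. s n x z * e)" using si by simp
      show "\<bar>s n x z * u x\<bar> \<le> s n x z * e" for x
        using e[of x] s0[of n x z] by (cases "s n x z = 0") (auto simp: abs_mult intro: mult_left_mono)
    qed
    finally show ?thesis by (simp add: s1)
  qed
  have "(\<lambda>n. \<integral>z. F n z \<partial>\<sigma>) \<longlonglongrightarrow> y"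
    unfolding y_def
  proof (rule integral_dominated_convergence[where w="\<lambda>_. R"])
    show "F n \<in> borel_measurable \<sigma>" for n unfolding F_def by measurable
    show "AE z in \<sigma>. norm (F n z) \<le> R" for n
      unfolding F_def real_norm_def by (intro AE_I2 est[OF rxm rR] rR)
    \<comment> \<open>The weights are concentrated near \<open>z\<close> only for \<open>z\<close>
      in the support. The singular part lies below the first marginal, which the support carries
      because the plan is in \<open>Pi_supp\<close>.\<close>
    have "AE z in \<sigma>. z \<in> supp \<mu>"
    proof -
      have mp: "prob_space (marg1 \<pi>)" "sets (marg1 \<pi>) = sets borel"
        using marg1_prob[OF \<pi>] by (auto simp: prob_measures_def)
      interpret M: prob_space "marg1 \<pi>" by fact
      have sb: "supp \<mu> \<in> sets borel" using closed_supp[of \<mu>] by (simp add: borel_closed)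
      have "emeasure (marg1 \<pi>) (space (marg1 \<pi>) - supp \<mu>) = 0"
        using M.prob_compl[of "supp \<mu>"] supp sb mp(2) by (simp add: M.emeasure_eq_measure)
      also have "space (marg1 \<pi>) - supp \<mu> = - supp \<mu>" using sets_eq_imp_space_eq[OF mp(2)] by auto
      finally have "emeasure \<sigma> (- supp \<mu>) = 0"
        using sb by (simp add: m emeasure_add_measure \<sigma> s\<mu>)
      then show ?thesis using sb by (intro AE_I[of _ _ "- supp \<mu>"]) (auto simp: \<sigma>)
    qed
    then show "AE z in \<sigma>. (\<lambda>n. F n z) \<longlonglongrightarrow> r z z"
    proof eventually_elim
      case (elim z)
      have "continuous_on UNIV (\<lambda>x. recession c x (\<kappa> z))"
        using C disintegration_kernel(4)[OF d, of z] by (auto simp: cond_C_def)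
      then have "((\<lambda>x. r x z) \<longlongrightarrow> r z z) (at z)"
        unfolding continuous_on_def r by simp
      then have cont: "isCont (\<lambda>x. r x z) z" by (simp add: isCont_def)
      show ?case
      proof (rule LIMSEQ_I)
        fix e :: real assume "0 < e"
        then obtain \<delta> where \<delta>: "0 < \<delta>" "\<And>x. dist x z < \<delta> \<Longrightarrow> dist (r x z) (r z z) < e / 2"
          using cont unfolding continuous_at_eps_delta by (metis half_gt_zero)
        obtain n0 where n0: "1 / real (Suc n0) < \<delta>" using nat_approx_posE[OF \<delta>(1)] by auto
        have "norm (F n z - r z z) < e" if "n0 \<le> n" for n
        proof -
          have "1 / real (Suc n) \<le> 1 / real (Suc n0)" using that by (simp add: frac_le)
          then have close: "\<bar>r x z - r z z\<bar> \<le> e / 2" if "s n x z \<noteq> 0" for x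
            using \<delta>(2)[of x] sd[OF elim that] n0 by (simp add: dist_real_def)
          have bd: "\<bar>r x z - r z z\<bar> \<le> R + R" for x using rR[of x z] rR[of z z] by linarith
          have "\<bar>\<integral>x. s n x z * (r x z - r z z) \<partial>\<mu>\<bar> \<le> e / 2"
            using rxm by (intro est[OF _ bd close]) auto
          moreover have "(\<integral>x. s n x z * (r x z - r z z) \<partial>\<mu>) = F n z - r z z"
            using si sri[OF rxm rR] by (simp add: right_diff_distrib F_def s1)
          ultimately show ?thesis using \<open>0 < e\<close> by simp
        qed
        then show "\<exists>no. \<forall>n\<ge>no. norm (F n z - r z z) < e" by blast
      qed
    qed
  qed auto
  then have "(\<lambda>n. ereal ((\<integral>x. D x \<partial>\<mu>) + (\<integral>z. F n z \<partial>\<sigma>))) \<longlonglongrightarrow> ereal ((\<integral>x. D x \<partial>\<mu>) + y)"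
    by (intro tendsto_intros)
  then have "transport_cost c \<mu> \<nu> \<le> ereal ((\<integral>x. D x \<partial>\<mu>) + y)"
    by (rule LIMSEQ_le_const) (use bound in blast)
  also have "\<dots> \<le> ereal t" using Dy by simp
  finally show ?thesis .
qed

end

theorem theorem3p2:
  fixes c :: "'x::polish_space \<Rightarrow> 'y::polish_space measure \<Rightarrow> real"
  assumes "compact (UNIV :: 'x set)"
    and "compact (UNIV :: 'y set)"
    and "cond_A c"
  shows "(cond_Approx c \<longrightarrow>
            (\<forall>\<mu>\<in>prob_measures. \<forall>\<nu>\<in>prob_measures. transport_cost c \<mu> \<nu> = dual_value c \<mu> \<nu>)) \<and>
         (cond_B c \<or> cond_C c \<longrightarrow>
            (\<forall>\<mu>\<in>prob_measures. \<forall>\<nu>\<in>prob_measures. transport_cost c \<mu> \<nu> = dual_value c \<mu> \<nu>))"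
proof -
  obtain a b where "sup_cost c a b"
    using assms unfolding cond_A_def sup_cost_def by blast
  then interpret sup_cost c a b .
  have "transport_cost c \<mu> \<nu> = dual_value c \<mu> \<nu>"
    if C: "cond_Approx c \<or> cond_B c \<or> cond_C c" and \<mu>: "\<mu> \<in> prob_measures" and \<nu>: "\<nu> \<in> prob_measures" for \<mu> \<nu>
  proof (rule antisym)
    show "transport_cost c \<mu> \<nu> \<le> dual_value c \<mu> \<nu>"
    \<comment> \<open>Comparing through real upper bounds \<open>t\<close> treats the values -
      \<infinity> and \<infinity> of the dual uniformly; in the latter case there is no such
      \<open>t\<close> and nothing to show.\<close>
    proof (rule ereal_le_real)
      fix t assume "dual_value c \<mu> \<nu> \<le> ereal t"
      then show "transport_cost c \<mu> \<nu> \<le> ereal t"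
        using C transport_cost_le_dual_Approx[OF _ \<mu> \<nu>] transport_cost_le_dual_B[OF _ \<mu> \<nu>]
          transport_cost_le_dual_C[OF _ \<mu> \<nu>] by blast
    qed
  qed (rule weak_duality[OF \<mu> \<nu>])
  then show ?thesis by blast
qed

end
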